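(* Let $c>0$ be a constant and let $$V(x)=\inf_{\tau\in\mathcal T}\mathbb E\Big[\int_0^\tau c\,du+g(X^x_\tau)\Big],\qquad x\in[0,1],$$ where $\mathcal T$ is the set of $\mathbb F$-stopping times with $\mathbb E[\tau]<\infty$. (i) If conditions (A.i)–(A.iv) of the context hold and $\mathcal Lg(x_0)\ge-c$, then $V\equiv g$. (ii) If conditions (A.i)–(A.iv) of the context hold and $\mathcal Lg(x_0)<-c$, then $$V(x)=\begin{cases}\widehat V_{A^*}(x), & x\in(A^*,B^* ),\\ g(x), & x\in[0,A^*]\cup[B^*,1],\end{cases}$$ where, for any fixed solution $\psi$ of $\psi''(x)=-2c/\sigma^2(x)$ on $(0,1)$, $$\widehat V_A(x)=(x-A)\big(g'(A)-\psi'(A)\big)+g(A)-\psi(A)+\psi(x),$$ and, with $H:=g-\psi$, $(A^*,B^* )$ is the unique pair $0<A<B<1$ solving $$H'(A)=H'(B),\qquad H'(B)=\frac{H(B)-H(A)}{B-A}.$$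
   Context: $B=(B_t)_{t\ge 0}$ (the driving noise, not to be confused with the number $B$) is a standard Brownian motion on a probability space and $\mathbb F$ is the usual augmentation of its natural filtration. $\sigma:[0,1]\to[0,\infty)$ and $g:[0,1]\to[0,\infty)$ are given functions, $\mathcal L=\frac12\sigma^2(x)\partial_{xx}$. For $x\in(0,1)$, $X^x$ is the unique strong solution of $dX^x_t=\sigma(X^x_t)\,dB_t$, $X^x_0=x$ (under (A.i) it stays in $(0,1)$ at finite times); for $x\in\{0,1\}$, $X^x\equiv x$. Conditions: (A.i) $\sigma$ is continuous on $[0,1]$, locally Lipschitz on $(0,1)$, $\sigma(x)=0$ iff $x\in\{0,1\}$, $\sigma^{-2}\in L^1_{\mathrm{loc}}((0,1))$, and for any $a\in(0,1)$, $\int_a^x\int_a^y\sigma^{-2}(z)\,dz\,dy\to\infty$ as $x\to0$ and as $x\to1$. (A.ii) the running cost is the positive constant $c$. (A.iii) $g\in C([0,1])\cap C^2((0,1))$ is concave and $g(x)=0$ iff $x\in\{0,1\}$. (A.iv) There is $x_0\in(0,1)$ such that $\mathcal Lg$ is strictly decreasing on $(0,x_0)$ and strictly increasing on $(x_0,1)$. *)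

theory Defs
  imports "HOL-Probability.Probability"
begin

section \<open>Brownian motion and its augmented filtration\<close>

definition brownian_motion :: "'a measure \<Rightarrow> (real \<Rightarrow> 'a \<Rightarrow> real) \<Rightarrow> bool" where
  "brownian_motion M B \<longleftrightarrow>
     (\<forall>t\<ge>0. B t \<in> borel_measurable M) \<and>
     (AE \<omega> in M. B 0 \<omega> = 0) \<and>
     (\<forall>(n::nat) (t::nat \<Rightarrow> real). 0 \<le> t 0 \<and> (\<forall>i<n. t i \<le> t (Suc i)) \<longrightarrow>
        prob_space.indep_vars M (\<lambda>_. borel) (\<lambda>i \<omega>. B (t (Suc i)) \<omega> - B (t i) \<omega>) {..<n}) \<and>
     (\<forall>s t. 0 \<le> s \<and> s < t \<longrightarrow>
        distributed M lborel (\<lambda>\<omega>. B t \<omega> - B s \<omega>)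
          (\<lambda>y. ennreal (normal_density 0 (sqrt (t - s)) y))) \<and>
     (AE \<omega> in M. continuous_on {0..} (\<lambda>t. B t \<omega>))"

text \<open>
  Processes are indexed by the reals and only used at times \<open>t \<ge> 0\<close>.  Filtrations are indexed
  by \<open>ennreal\<close>, i.e. by \<open>[0, \<infinity>]\<close>, so that the library notion of stopping time covers
  \<open>[0, \<infinity>]\<close>-valued random times.
\<close>

definition natural_events :: "'a measure \<Rightarrow> (real \<Rightarrow> 'a \<Rightarrow> real) \<Rightarrow> ennreal \<Rightarrow> 'a set set" where
  "natural_events M B t =
     {B s -` A \<inter> space M | s A. 0 \<le> s \<and> ennreal s \<le> t \<and> A \<in> sets borel}"

text \<open>
  The usual augmentation: all null sets of the completed probability space are added, and the
  result is made right-continuous by intersecting over all \<open>u > t\<close>.  The value \<open>u = \<infinity>\<close> in the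
  index set is redundant for \<open>t < \<infinity>\<close>; for \<open>t = \<infinity>\<close> it avoids an empty intersection.
\<close>

definition usual_augmentation ::
    "'a measure \<Rightarrow> (real \<Rightarrow> 'a \<Rightarrow> real) \<Rightarrow> ennreal \<Rightarrow> 'a measure" where
  "usual_augmentation M B t =
     sigma (space M)
       (\<Inter>u\<in>insert \<top> {t<..}.
          sigma_sets (space M) (natural_events M B u \<union> null_sets (completion M)))"

lemma natural_events_Un_null_sets_subset:
  "natural_events M B u \<union> null_sets (completion M) \<subseteq> Pow (space M)"
  using sets.sets_into_space[of _ "completion M"]
  by (fastforce simp: natural_events_def null_sets_def)

lemma filtration_usual_augmentation: "filtration (space M) (usual_augmentation M B)"
proof
  have sub: "(\<Inter>u\<in>insert \<top> {t<..}.
      sigma_sets (space M) (natural_events M B u \<union> null_sets (completion M))) \<subseteq> Pow (space M)"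
    for t
    using sigma_sets_into_sp[OF natural_events_Un_null_sets_subset[of M B \<top>]] by blast
  show "space (usual_augmentation M B t) = space M" for t
    unfolding usual_augmentation_def using sub by (rule space_measure_of)
  show "sets (usual_augmentation M B s) \<le> sets (usual_augmentation M B t)" if "s \<le> t" for s t
    unfolding usual_augmentation_def sets_measure_of[OF sub]
    using that by (intro sigma_sets_mono') auto
qed

section \<open>The It\^o integral and strong solutions\<close>

text \<open>
  A simple integrand \<open>\<Sum>i<n. \<xi> i * indicator {t i<..t (Suc i)}\<close> is given by \<open>n\<close>, \<open>t\<close> and \<open>\<xi>\<close>.
\<close>

definition simple_integrand ::
    "(ennreal \<Rightarrow> 'a measure) \<Rightarrow> nat \<Rightarrow> (nat \<Rightarrow> real) \<Rightarrow> (nat \<Rightarrow> 'a \<Rightarrow> real) \<Rightarrow> bool" where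
  "simple_integrand F n t \<xi> \<longleftrightarrow>
     0 \<le> t 0 \<and> (\<forall>i<n. t i \<le> t (Suc i)) \<and>
     (\<forall>i<n. \<xi> i \<in> borel_measurable (F (ennreal (t i))) \<and>
            (\<exists>C. \<forall>\<omega>\<in>space (F (ennreal (t i))). \<bar>\<xi> i \<omega>\<bar> \<le> C))"

definition simple_process ::
    "nat \<Rightarrow> (nat \<Rightarrow> real) \<Rightarrow> (nat \<Rightarrow> 'a \<Rightarrow> real) \<Rightarrow> real \<Rightarrow> 'a \<Rightarrow> real" where
  "simple_process n t \<xi> s \<omega> = (\<Sum>i<n. \<xi> i \<omega> * indicator {t i<..t (Suc i)} s)"

definition simple_integral ::
    "(real \<Rightarrow> 'a \<Rightarrow> real) \<Rightarrow> nat \<Rightarrow> (nat \<Rightarrow> real) \<Rightarrow> (nat \<Rightarrow> 'a \<Rightarrow> real) \<Rightarrow> real \<Rightarrow> 'a \<Rightarrow> real" where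
  "simple_integral B n t \<xi> T \<omega> =
     (\<Sum>i<n. \<xi> i \<omega> * (B (min (t (Suc i)) T) \<omega> - B (min (t i) T) \<omega>))"

text \<open>
  \<open>is_ito_integral P F B K T I\<close> says that \<open>I\<close> is (a version of) \<open>\<integral>\<^sub>0\<^sup>T K dB\<close>: simple integrands
  approximate \<open>K\<close> in \<open>L\<^sup>2(P \<otimes> dt)\<close> on \<open>[0, T]\<close>, and their integrals converge to \<open>I\<close> in \<open>L\<^sup>2(P)\<close>.
  This is the It\^o integral of square-integrable integrands, which suffices here because the
  diffusion coefficient is bounded.
\<close>

definition is_ito_integral ::
    "'a measure \<Rightarrow> (ennreal \<Rightarrow> 'a measure) \<Rightarrow> (real \<Rightarrow> 'a \<Rightarrow> real) \<Rightarrow> (real \<Rightarrow> 'a \<Rightarrow> real) \<Rightarrow>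
     real \<Rightarrow> ('a \<Rightarrow> real) \<Rightarrow> bool" where
  "is_ito_integral P F B K T I \<longleftrightarrow>
     I \<in> borel_measurable P \<and>
     (\<exists>n t \<xi>. (\<forall>k. simple_integrand F (n k) (t k) (\<xi> k)) \<and>
        (\<lambda>k::nat. \<integral>\<^sup>+\<omega>. (\<integral>\<^sup>+s\<in>{0..T}.
            ennreal ((simple_process (n k) (t k) (\<xi> k) s \<omega> - K s \<omega>)\<^sup>2) \<partial>lborel) \<partial>P)
          \<longlonglongrightarrow> 0 \<and>
        (\<lambda>k. \<integral>\<^sup>+\<omega>. ennreal ((simple_integral B (n k) (t k) (\<xi> k) T \<omega> - I \<omega>)\<^sup>2) \<partial>P)
          \<longlonglongrightarrow> 0)"

text \<open>
  Strong solution of \<open>dX = \<sigma>(X) dB\<close>, \<open>X\<^sub>0 = x\<close>: adapted to the augmented Brownian filtration, with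
  continuous paths in \<open>[0, 1]\<close>, the domain of \<open>\<sigma>\<close>.
\<close>

definition strong_solution ::
    "'a measure \<Rightarrow> (real \<Rightarrow> 'a \<Rightarrow> real) \<Rightarrow> (real \<Rightarrow> real) \<Rightarrow> real \<Rightarrow> (real \<Rightarrow> 'a \<Rightarrow> real) \<Rightarrow> bool" where
  "strong_solution M B \<sigma> x X \<longleftrightarrow>
     (\<forall>t\<ge>0. X t \<in> borel_measurable (usual_augmentation M B (ennreal t))) \<and>
     (AE \<omega> in completion M. X 0 \<omega> = x) \<and>
     (AE \<omega> in completion M. continuous_on {0..} (\<lambda>t. X t \<omega>) \<and> (\<forall>t\<ge>0. X t \<omega> \<in> {0..1})) \<and>
     (\<forall>t\<ge>0. is_ito_integral (completion M) (usual_augmentation M B) B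
        (\<lambda>s \<omega>. \<sigma> (X s \<omega>)) t (\<lambda>\<omega>. X t \<omega> - x))"

section \<open>The stopping problem\<close>

definition admissible_times ::
    "'a measure \<Rightarrow> (real \<Rightarrow> 'a \<Rightarrow> real) \<Rightarrow> ('a \<Rightarrow> ennreal) set" where
  "admissible_times M B =
     {\<tau>. stopping_time (usual_augmentation M B) \<tau> \<and> (\<integral>\<^sup>+\<omega>. \<tau> \<omega> \<partial>completion M) < \<infinity>}"

text \<open>
  An admissible time is finite almost surely, so the value of \<open>enn2real\<close> at \<open>\<infinity>\<close> is immaterial.
\<close>

definition value_function ::
    "'a measure \<Rightarrow> (real \<Rightarrow> 'a \<Rightarrow> real) \<Rightarrow> (real \<Rightarrow> real \<Rightarrow> 'a \<Rightarrow> real) \<Rightarrow> real \<Rightarrow> (real \<Rightarrow> real) \<Rightarrow>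
     real \<Rightarrow> real" where
  "value_function M B X c g x =
     (INF \<tau>\<in>admissible_times M B.
        \<integral>\<omega>. (LINT u:{0..enn2real (\<tau> \<omega>)}|lborel. c) + g (X x (enn2real (\<tau> \<omega>)) \<omega>)
          \<partial>completion M)"

section \<open>Conditions on the data\<close>

definition generator :: "(real \<Rightarrow> real) \<Rightarrow> (real \<Rightarrow> real) \<Rightarrow> real \<Rightarrow> real" where
  "generator \<sigma> f x = 1/2 * (\<sigma> x)\<^sup>2 * deriv (deriv f) x"

text \<open>The inner and outer integrals are oriented, hence the double integral is nonnegative also
  for \<open>x < a\<close>.\<close>

definition cond_sigma :: "(real \<Rightarrow> real) \<Rightarrow> bool" where
  "cond_sigma \<sigma> \<longleftrightarrow>
     continuous_on {0..1} \<sigma> \<and>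
     local_lipschitz (UNIV :: real set) {0<..<1} (\<lambda>_. \<sigma>) \<and>
     (\<forall>x\<in>{0..1}. \<sigma> x = 0 \<longleftrightarrow> x \<in> {0, 1}) \<and>
     (\<forall>K. compact K \<and> K \<subseteq> {0<..<1} \<longrightarrow> set_integrable lborel K (\<lambda>z. 1 / (\<sigma> z)\<^sup>2)) \<and>
     (\<forall>a\<in>{0<..<1}.
        filterlim (\<lambda>x. LBINT y=ereal a..ereal x. (LBINT z=ereal a..ereal y. 1 / (\<sigma> z)\<^sup>2))
          at_top (at_right 0) \<and>
        filterlim (\<lambda>x. LBINT y=ereal a..ereal x. (LBINT z=ereal a..ereal y. 1 / (\<sigma> z)\<^sup>2))
          at_top (at_left 1))"

definition C2_on :: "real set \<Rightarrow> (real \<Rightarrow> real) \<Rightarrow> bool" where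
  "C2_on S f \<longleftrightarrow>
     (\<forall>x\<in>S. f differentiable (at x)) \<and> (\<forall>x\<in>S. deriv f differentiable (at x)) \<and>
     continuous_on S (deriv (deriv f))"

definition cond_g :: "(real \<Rightarrow> real) \<Rightarrow> bool" where
  "cond_g g \<longleftrightarrow>
     continuous_on {0..1} g \<and> C2_on {0<..<1} g \<and> concave_on {0..1} g \<and>
     (\<forall>x\<in>{0..1}. g x = 0 \<longleftrightarrow> x \<in> {0, 1})"

definition cond_shape :: "(real \<Rightarrow> real) \<Rightarrow> (real \<Rightarrow> real) \<Rightarrow> real \<Rightarrow> bool" where
  "cond_shape \<sigma> g x0 \<longleftrightarrow>
     x0 \<in> {0<..<1} \<and>
     strict_antimono_on {0<..<x0} (generator \<sigma> g) \<and>
     strict_mono_on {x0<..<1} (generator \<sigma> g)"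

section \<open>The candidate value function\<close>

definition psi_solution :: "(real \<Rightarrow> real) \<Rightarrow> real \<Rightarrow> (real \<Rightarrow> real) \<Rightarrow> bool" where
  "psi_solution \<sigma> c \<psi> \<longleftrightarrow>
     (\<forall>x\<in>{0<..<1}. \<psi> differentiable (at x) \<and>
        (deriv \<psi> has_real_derivative (- 2 * c / (\<sigma> x)\<^sup>2)) (at x))"

definition V_hat :: "(real \<Rightarrow> real) \<Rightarrow> (real \<Rightarrow> real) \<Rightarrow> real \<Rightarrow> real \<Rightarrow> real" where
  "V_hat g \<psi> A x = (x - A) * (deriv g A - deriv \<psi> A) + g A - \<psi> A + \<psi> x"

definition double_tangent :: "(real \<Rightarrow> real) \<Rightarrow> real \<Rightarrow> real \<Rightarrow> bool" where
  "double_tangent H A B \<longleftrightarrow>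
     0 < A \<and> A < B \<and> B < 1 \<and>
     deriv H A = deriv H B \<and> deriv H B = (H B - H A) / (B - A)"

end

theory Submission
  imports Defs
begin

text \<open>
  Since \<open>X\<close> is a bounded martingale with bracket \<open>\<integral> \<sigma>\<^sup>2(X) dt\<close>, Dynkin's formula holds for \<open>C\<^sup>2\<close>
  functions on \<open>[0, 1]\<close> by Taylor expansion along a grid, and optional stopping extends it to all
  integrable stopping times.  The upper bound comes from stopping when \<open>X\<close> leaves \<open>(A\<^sup>*, B\<^sup>*)\<close>.  For the lower
  bound, the function \<open>H = g - \<psi>\<close> has \<open>H'' = (2 / \<sigma>\<^sup>2) (L g + c)\<close>, hence is convex, concave and convex again, and
  blows up at \<open>0\<close> and \<open>1\<close>; its unique bitangent lies below its graph
  (if \<open>L g \<ge> - c\<close> everywhere, then \<open>g\<close> itself is the candidate).  So at each \<open>x\<close> some line \<open>l\<close> satisfies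
  \<open>l \<le> H\<close> and \<open>l + \<psi>\<close> agrees at \<open>x\<close> with the candidate value.  As \<open>L (l + \<psi>) = - c\<close> and \<open>l + \<psi> \<le> g\<close>,
  no stopping time does better than the candidate.  Truncating \<open>\<sigma>\<^sup>-\<^sup>2\<close> near the
  boundary makes \<open>\<psi>\<close> an admissible test function and removes the need to localise.
\<close>

section \<open>Increments of Brownian motion and the augmented filtration\<close>

text \<open>Two features of the definitions shape the probabilistic half.
  \<open>is_ito_integral\<close> describes the integral one time at a time, as an L2 limit, so Ito's
  formula is bypassed: the diffusion enters only through the first two moments of its increments,
  tested against bounded weights from the past, which is exactly what a second-order Taylor
  expansion consumes. And the filtration is right-continuous, so independence of increments is first
  proved for the completed natural filtration; the moment identities reach \<open>F a\<close> by
  starting the increment at a + h and letting h tend to 0. On the analytic side, test functions must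
  be C2 up to the boundary, whereas \<psi> tends to -infinity there. After truncation the generator
  stays in [-c, 0], which is the inequality that the lower bound uses; keeping the test function
  below g near 0 and 1 costs an error \<eta>, removed at the end. In the upper bound truncation is
  invisible, because the process is stopped inside a compact subinterval of (0, 1).\<close>

lemma brownian_motion_cylinder_indep:
  fixes S :: "real \<Rightarrow> real set"
  assumes "prob_space M" and BM: "brownian_motion M B"
    and J: "finite J" "J \<subseteq> {0..v}" and v: "0 \<le> v" "v < w"
    and S: "\<And>s. s \<in> J \<Longrightarrow> S s \<in> sets borel" and T: "T \<in> sets borel"
  shows "measure M {\<omega> \<in> space M. (\<forall>s\<in>J. B s \<omega> \<in> S s) \<and> B w \<omega> - B v \<omega> \<in> T} =
    measure M {\<omega> \<in> space M. \<forall>s\<in>J. B s \<omega> \<in> S s} *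
    measure M {\<omega> \<in> space M. B w \<omega> - B v \<omega> \<in> T}"
proof -
  interpret prob_space M by fact
  have meas: "\<And>t. t \<ge> 0 \<Longrightarrow> B t \<in> borel_measurable M" and B0: "AE \<omega> in M. B 0 \<omega> = 0"
    and ind: "\<And>(n::nat) t. 0 \<le> t 0 \<Longrightarrow> (\<And>i. i < n \<Longrightarrow> t i \<le> t (Suc i)) \<Longrightarrow>
        indep_vars (\<lambda>_. borel) (\<lambda>i \<omega>. B (t (Suc i)) \<omega> - B (t i) \<omega>) {..<n}"
    using BM unfolding brownian_motion_def by auto
  \<comment> \<open>Independence is given only for increments along a grid. Adding 0 and v to J and
    sorting makes every \<open>B s\<close> with s in J a sum of increments before v, up to the null
    event where \<open>B 0\<close> is not 0; the increment from v to w comes last.\<close>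
  define K where "K = insert 0 (insert v J)"
  define ts where "ts = sorted_list_of_set K"
  have K: "finite K" "K \<subseteq> {0..v}" "0 \<in> K" "v \<in> K"
    using J v by (auto simp: K_def)
  have ts: "set ts = K" "sorted ts" "distinct ts"
    using K by (auto simp: ts_def)
  then have len: "length ts > 0" using K by auto
  define m where "m = length ts - 1"
  \<comment> \<open>The default value w past the end of the list makes w the grid point after v =
    \<open>t m\<close>, so \<open>D m\<close> is the increment in question.\<close>
  define t where "t i = (if i < length ts then ts ! i else w)" for i
  have tm: "t (Suc m) = w" "length ts = Suc m"
    using len by (auto simp: t_def m_def)
  have t_in: "t i \<in> K" if "i \<le> m" for i
    using that tm ts by (auto simp: t_def)
  have t_mono: "t i \<le> t j" if "i \<le> j" "j \<le> m" for i j
    using that tm ts by (auto simp: t_def sorted_nth_mono)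
  have ex: "\<exists>k\<le>m. t k = s" if "s \<in> K" for s
  proof -
    from that obtain k where "k < length ts" "ts ! k = s" using ts by (metis in_set_conv_nth)
    then show ?thesis using tm by (intro exI[of _ k]) (auto simp: t_def)
  qed
  have t0: "t 0 = 0"
  proof -
    obtain k where "k \<le> m" "t k = 0" using ex K by blast
    then have "t 0 \<le> 0" using t_mono[of 0 k] by auto
    then show ?thesis using t_in[of 0] K by fastforce
  qed
  have tmv: "t m = v"
  proof -
    obtain k where "k \<le> m" "t k = v" using ex K by blast
    then have "v \<le> t m" using t_mono[of k m] by auto
    then show ?thesis using t_in[of m] K by fastforce
  qed
  have t_step: "t i \<le> t (Suc i)" if "i < Suc m" for i
    using that t_mono[of i "Suc i"] tm(1) tmv v by (cases "i = m") auto
  define D where "D i \<omega> = B (t (Suc i)) \<omega> - B (t i) \<omega>" for i \<omega>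
  have indD: "indep_vars (\<lambda>_. borel) D {..<Suc m}"
    unfolding D_def by (rule ind) (use t0 t_step in auto)
  have iv: "indep_var (PiM {..<m} (\<lambda>_. borel)) (\<lambda>\<omega>. restrict (\<lambda>i. D i \<omega>) {..<m})
      (PiM {m} (\<lambda>_. borel)) (\<lambda>\<omega>. restrict (\<lambda>i. D i \<omega>) {m})"
    by (rule indep_var_restrict[OF indD]) auto
  \<comment> \<open>The cylinder event rewritten through increments: for s = \<open>t k\<close> in
    J, the k-th partial sum must lie in \<open>S s\<close>. As it ignores \<open>B 0\<close>, it
    agrees with the original event only almost surely.\<close>
  define Q where "Q y \<longleftrightarrow> (\<forall>k\<in>{k. k \<le> m \<and> t k \<in> J}. (\<Sum>i<k. y i) \<in> S (t k))" for y :: "nat \<Rightarrow> real"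
  let ?PM = "PiM {..<m} (\<lambda>_. borel :: real measure)"
  have Qm: "{y \<in> space ?PM. Q y} \<in> sets ?PM"
  proof -
    have "(\<lambda>y. \<Sum>i<k. y i) \<in> borel_measurable ?PM" if "k \<le> m" for k
      using that by (intro borel_measurable_sum measurable_component_singleton) auto
    then have "Measurable.pred ?PM (\<lambda>y. (\<Sum>i<k. y i) \<in> S (t k))" if "k \<le> m" "t k \<in> J" for k
      using S[OF that(2)] that(1) by (intro pred_sets2) auto
    then have "Measurable.pred ?PM Q" unfolding Q_def
      by (intro pred_intros_finite) (auto simp: finite_Collect_conjI)
    then show ?thesis by (simp add: pred_def)
  qed
  have Tm: "{y \<in> space (PiM {m} (\<lambda>_. borel :: real measure)). y m \<in> T}
      \<in> sets (PiM {m} (\<lambda>_. borel :: real measure))"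
    using T by measurable
  have Bt: "B (t k) \<omega> = B 0 \<omega> + (\<Sum>i<k. D i \<omega>)" for k \<omega>
    unfolding D_def by (subst sum_lessThan_telescope) (simp add: t0)
  have AEQ: "AE \<omega> in M. (\<forall>s\<in>J. B s \<omega> \<in> S s) \<longleftrightarrow> Q (restrict (\<lambda>i. D i \<omega>) {..<m})"
    using B0
  proof eventually_elim
    case (elim \<omega>)
    have "(\<Sum>i<k. restrict (\<lambda>i. D i \<omega>) {..<m} i) = (\<Sum>i<k. D i \<omega>)" if "k \<le> m" for k
      using that by (intro sum.cong) auto
    then have "Q (restrict (\<lambda>i. D i \<omega>) {..<m}) \<longleftrightarrow> (\<forall>k\<in>{k. k \<le> m \<and> t k \<in> J}. B (t k) \<omega> \<in> S (t k))"
      unfolding Q_def Bt using elim by auto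
    also have "\<dots> \<longleftrightarrow> (\<forall>s\<in>J. B s \<omega> \<in> S s)"
    proof (safe)
      fix s assume *: "\<forall>k\<in>{k. k \<le> m \<and> t k \<in> J}. B (t k) \<omega> \<in> S (t k)" "s \<in> J"
      then obtain k where "k \<le> m" "t k = s" using ex[of s] by (auto simp: K_def)
      with * show "B s \<omega> \<in> S s" by auto
    qed auto
    finally show ?case ..
  qed
  have evJ: "{\<omega> \<in> space M. \<forall>s\<in>J. B s \<omega> \<in> S s} \<in> sets M"
  proof -
    have "Measurable.pred M (\<lambda>\<omega>. \<forall>s\<in>J. B s \<omega> \<in> S s)"
      using J S by (intro pred_intros_finite pred_sets2[OF _ meas]) auto
    then show ?thesis by (simp add: pred_def)
  qed
  have evT: "{\<omega> \<in> space M. B w \<omega> - B v \<omega> \<in> T} \<in> sets M"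
  proof -
    have [measurable]: "B w \<in> borel_measurable M" "B v \<in> borel_measurable M"
      using v by (auto intro: meas)
    show ?thesis using T by measurable
  qed
  have rv: "random_variable ?PM (\<lambda>\<omega>. restrict (\<lambda>i. D i \<omega>) {..<m})"
    using iv by (rule indep_var_rv1)
  have evQ: "{\<omega> \<in> space M. Q (restrict (\<lambda>i. D i \<omega>) {..<m})} \<in> sets M"
  proof -
    have "{\<omega> \<in> space M. Q (restrict (\<lambda>i. D i \<omega>) {..<m})} =
      (\<lambda>\<omega>. restrict (\<lambda>i. D i \<omega>) {..<m}) -` {y \<in> space ?PM. Q y} \<inter> space M"
      using measurable_space[OF rv] by auto
    then show ?thesis using measurable_sets[OF rv Qm] by simp
  qed
  have "prob ((\<lambda>\<omega>. (restrict (\<lambda>i. D i \<omega>) {..<m}, restrict (\<lambda>i. D i \<omega>) {m})) -`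
        ({y \<in> space ?PM. Q y} \<times> {y \<in> space (PiM {m} (\<lambda>_. borel :: real measure)). y m \<in> T}) \<inter> space M) =
      prob ((\<lambda>\<omega>. restrict (\<lambda>i. D i \<omega>) {..<m}) -` {y \<in> space ?PM. Q y} \<inter> space M) *
      prob ((\<lambda>\<omega>. restrict (\<lambda>i. D i \<omega>) {m}) -` {y \<in> space (PiM {m} (\<lambda>_. borel :: real measure)). y m \<in> T} \<inter> space M)"
    by (rule indep_varD[OF iv Qm Tm])
  also have "(\<lambda>\<omega>. (restrict (\<lambda>i. D i \<omega>) {..<m}, restrict (\<lambda>i. D i \<omega>) {m})) -`
        ({y \<in> space ?PM. Q y} \<times> {y \<in> space (PiM {m} (\<lambda>_. borel :: real measure)). y m \<in> T}) \<inter> space M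
      = {\<omega> \<in> space M. Q (restrict (\<lambda>i. D i \<omega>) {..<m}) \<and> D m \<omega> \<in> T}"
    using measurable_space[OF rv] by (auto simp: space_PiM)
  also have "(\<lambda>\<omega>. restrict (\<lambda>i. D i \<omega>) {..<m}) -` {y \<in> space ?PM. Q y} \<inter> space M =
      {\<omega> \<in> space M. Q (restrict (\<lambda>i. D i \<omega>) {..<m})}"
    using measurable_space[OF rv] by auto
  also have "(\<lambda>\<omega>. restrict (\<lambda>i. D i \<omega>) {m}) -` {y \<in> space (PiM {m} (\<lambda>_. borel :: real measure)). y m \<in> T} \<inter> space M
      = {\<omega> \<in> space M. B w \<omega> - B v \<omega> \<in> T}"
    by (auto simp: space_PiM D_def tm tmv)
  also have "{\<omega> \<in> space M. Q (restrict (\<lambda>i. D i \<omega>) {..<m}) \<and> D m \<omega> \<in> T} =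
     {\<omega> \<in> space M. Q (restrict (\<lambda>i. D i \<omega>) {..<m})} \<inter> {\<omega> \<in> space M. B w \<omega> - B v \<omega> \<in> T}"
    by (auto simp: D_def tm tmv)
  also have "prob \<dots> = prob {\<omega> \<in> space M. (\<forall>s\<in>J. B s \<omega> \<in> S s) \<and> B w \<omega> - B v \<omega> \<in> T}"
  proof (rule measure_eq_AE)
    show "{\<omega> \<in> space M. (\<forall>s\<in>J. B s \<omega> \<in> S s) \<and> B w \<omega> - B v \<omega> \<in> T} \<in> events"
      using sets.Int[OF evJ evT] by (rule back_subst[where P="\<lambda>A. A \<in> events"]) auto
  qed (use AEQ sets.Int[OF evQ evT] in auto)
  also have "prob {\<omega> \<in> space M. Q (restrict (\<lambda>i. D i \<omega>) {..<m})} = prob {\<omega> \<in> space M. \<forall>s\<in>J. B s \<omega> \<in> S s}"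
    by (rule measure_eq_AE) (use AEQ evQ evJ in auto)
  finally show ?thesis .
qed

lemma integrable_mult_L2:
  fixes f g :: "'a \<Rightarrow> real"
  assumes [measurable]: "f \<in> borel_measurable M" "g \<in> borel_measurable M"
    and "integrable M (\<lambda>x. (f x)\<^sup>2)" "integrable M (\<lambda>x. (g x)\<^sup>2)"
  shows "integrable M (\<lambda>x. f x * g x)"
proof (rule Bochner_Integration.integrable_bound)
  show "integrable M (\<lambda>x. (f x)\<^sup>2 + (g x)\<^sup>2)" using assms by simp
  have "\<bar>a * b\<bar> \<le> a\<^sup>2 + b\<^sup>2" for a b :: real
    using sum_squares_bound[of "\<bar>a\<bar>" "\<bar>b\<bar>"] mult_nonneg_nonneg[OF abs_ge_zero[of a] abs_ge_zero[of b]]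
    unfolding abs_mult power2_abs by linarith
  then show "AE x in M. norm (f x * g x) \<le> norm ((f x)\<^sup>2 + (g x)\<^sup>2)" by simp
qed simp

lemma Int_stable_vimage: "Int_stable {f -` A \<inter> S | A. A \<in> sets N}"
proof (rule Int_stableI)
  fix a b assume "a \<in> {f -` A \<inter> S | A. A \<in> sets N}" "b \<in> {f -` A \<inter> S | A. A \<in> sets N}"
  then obtain T T' where "a = f -` T \<inter> S" "T \<in> sets N" "b = f -` T' \<inter> S" "T' \<in> sets N" by auto
  then show "a \<inter> b \<in> {f -` A \<inter> S | A. A \<in> sets N}" by (intro CollectI exI[of _ "T \<inter> T'"]) auto
qed

lemma (in prob_space) indep_set_mono:
  "indep_set A B \<Longrightarrow> A' \<subseteq> A \<Longrightarrow> B' \<subseteq> B \<Longrightarrow> indep_set A' B'"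
  unfolding indep_set_def by (erule indep_sets_mono_sets) (auto split: bool.split)

section \<open>Completed Brownian filtrations and moments of increments\<close>

locale brownian = prob_space M for M :: "'a measure" +
  fixes B :: "real \<Rightarrow> 'a \<Rightarrow> real"
  assumes BM: "brownian_motion M B"
begin

abbreviation P :: "'a measure" where "P \<equiv> completion M"

abbreviation F :: "real \<Rightarrow> 'a measure" where "F t \<equiv> usual_augmentation M B (ennreal t)"

text \<open>The completed filtration before the right limit is taken. Every \<open>F a\<close> lies
  inside \<open>natural_completed u\<close> for all u > a, which is how facts proved here reach the
  right-continuous filtration.\<close>

definition natural_completed :: "real \<Rightarrow> 'a measure" where
  "natural_completed u = sigma (space M) (natural_events M B (ennreal u) \<union> null_sets P)"

sublocale P: prob_space P
  by (rule prob_space_completion)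

sublocale P: complete_measure P
  by (rule completion.complete_measure_axioms)

lemma B_measurable: "0 \<le> t \<Longrightarrow> B t \<in> borel_measurable M"
  using BM by (auto simp: brownian_motion_def)

lemma B_measurable_P: "0 \<le> t \<Longrightarrow> B t \<in> borel_measurable P"
  by (intro measurable_completion B_measurable)

lemma natural_events_subset: "natural_events M B u \<subseteq> sets P"
  by (auto simp: natural_events_def intro!: sets_completionI_sets measurable_sets[OF B_measurable])

lemma sets_natural_completed:
  "sets (natural_completed u) = sigma_sets (space M) (natural_events M B (ennreal u) \<union> null_sets P)"
  unfolding natural_completed_def
  by (rule sets_measure_of) (rule natural_events_Un_null_sets_subset)

lemma space_natural_completed [simp]: "space (natural_completed u) = space M"
  unfolding natural_completed_def
  by (rule space_measure_of) (rule natural_events_Un_null_sets_subset)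

text \<open>An intersection of sigma-algebras is one itself, so the outer \<open>sigma\<close> in
  the definition adds no sets.\<close>

lemma sets_usual_augmentation:
  "sets (usual_augmentation M B t) = (\<Inter>u\<in>insert \<top> {t<..}.
          sigma_sets (space M) (natural_events M B u \<union> null_sets P))"
proof -
  let ?A = "\<Inter>u\<in>insert \<top> {t<..}. sigma_sets (space M) (natural_events M B u \<union> null_sets P)"
  have "sigma_algebra (space M) ?A"
    unfolding sigma_algebra_iff2
    using sigma_sets_into_sp[OF natural_events_Un_null_sets_subset[of M B \<top>]]
    by (auto intro: sigma_sets.intros simp: image_subset_iff subset_iff)
  then show ?thesis
    unfolding usual_augmentation_def
    by (rule sigma_algebra.sets_measure_of_eq)
qed

lemma space_usual_augmentation [simp]: "space (usual_augmentation M B t) = space M"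
  by (rule filtration.space_F[OF filtration_usual_augmentation])

lemma sets_usual_augmentation_subset: "sets (usual_augmentation M B t) \<subseteq> sets P"
proof -
  have "sigma_sets (space P) (natural_events M B \<top> \<union> null_sets P) \<subseteq> sets P"
    using natural_events_subset by (intro sets.sigma_sets_subset) auto
  then show ?thesis
    unfolding sets_usual_augmentation by auto
qed

lemma sets_natural_completed_subset: "sets (natural_completed u) \<subseteq> sets P"
proof -
  have "sigma_sets (space P) (natural_events M B (ennreal u) \<union> null_sets P) \<subseteq> sets P"
    using natural_events_subset by (intro sets.sigma_sets_subset) auto
  then show ?thesis
    unfolding sets_natural_completed by auto
qed

lemma sets_usual_augmentation_natural:
  "a < u \<Longrightarrow> 0 \<le> a \<Longrightarrow> sets (F a) \<subseteq> sets (natural_completed u)"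
  unfolding sets_natural_completed sets_usual_augmentation by (auto simp: ennreal_less_iff)

lemma measurable_P [measurable_dest]:
  "f \<in> measurable (usual_augmentation M B t) N \<Longrightarrow> f \<in> measurable P N"
  using measurable_mono[of N N "usual_augmentation M B t" P] sets_usual_augmentation_subset by auto

lemma measurable_usual_augmentation_mono:
  "f \<in> measurable (F s) N \<Longrightarrow> s \<le> t \<Longrightarrow> f \<in> measurable (F t) N"
  using measurable_mono[of N N "F s" "F t"]
    filtration.sets_F_mono[OF filtration_usual_augmentation, of "ennreal s" "ennreal t" M B]
  by (auto simp: ennreal_leI)

lemma measurable_natural_completed:
  "f \<in> measurable (F a) N \<Longrightarrow> 0 \<le> a \<Longrightarrow> a < u \<Longrightarrow> f \<in> measurable (natural_completed u) N"
  using measurable_mono[of N N "F a" "natural_completed u"] sets_usual_augmentation_natural by auto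

lemma measurable_natural_completed_P:
  "f \<in> measurable (natural_completed u) N \<Longrightarrow> f \<in> measurable P N"
  using measurable_mono[of N N "natural_completed u" P] sets_natural_completed_subset by auto

lemma B_adapted_natural:
  assumes "0 \<le> s" "s \<le> u" shows "B s \<in> borel_measurable (natural_completed u)"
proof (rule measurableI)
  fix A :: "real set" assume "A \<in> sets borel"
  then have "B s -` A \<inter> space M \<in> natural_events M B (ennreal u)"
    unfolding natural_events_def using assms by (auto simp: ennreal_leI)
  then show "B s -` A \<inter> space (natural_completed u) \<in> sets (natural_completed u)"
    unfolding sets_natural_completed by auto
qed auto

lemma B_adapted:
  assumes "0 \<le> s" shows "B s \<in> borel_measurable (F s)"
proof (rule measurableI)
  fix A :: "real set" assume A: "A \<in> sets borel"
  have "B s -` A \<inter> space M \<in> natural_events M B u" if "u \<in> insert \<top> {ennreal s<..}" for u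
    unfolding natural_events_def using A assms that
    by (intro CollectI exI[of _ s] exI[of _ A]) auto
  then show "B s -` A \<inter> space (F s) \<in> sets (F s)"
    unfolding sets_usual_augmentation by auto
qed auto

lemma B_adapted': "0 \<le> s \<Longrightarrow> s \<le> t \<Longrightarrow> B s \<in> borel_measurable (F t)"
  using measurable_usual_augmentation_mono[OF B_adapted] .

text \<open>Cylinder events together with the null sets form an intersection-stable generator. Null
  sets are independent of everything, cylinders are covered by
  \<open>brownian_motion_cylinder_indep\<close>, and the pi-lambda theorem extends independence to
  the generated sigma-algebras.\<close>

lemma indep_set_natural_completed:
  assumes "0 \<le> u" "u < w"
  shows "P.indep_set (sets (natural_completed u))
    {(\<lambda>\<omega>. B w \<omega> - B u \<omega>) -` T \<inter> space M | T. T \<in> sets borel}" (is "P.indep_set _ ?D")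
proof -
  have [measurable]: "B u \<in> borel_measurable M" "B w \<in> borel_measurable M"
    using assms by (auto intro: B_measurable)
  define C where "C = {{\<omega> \<in> space M. \<forall>s\<in>J. B s \<omega> \<in> S s} | J S.
      finite J \<and> J \<subseteq> {0..u} \<and> (\<forall>s\<in>J. S s \<in> sets borel)}"
  have C_sets: "C \<subseteq> sets M"
  proof
    fix A assume "A \<in> C"
    then obtain J S where A: "A = {\<omega> \<in> space M. \<forall>s\<in>J. B s \<omega> \<in> S s}" "finite J" "J \<subseteq> {0..u}"
      "\<forall>s\<in>J. S s \<in> sets borel" unfolding C_def by auto
    have "Measurable.pred M (\<lambda>\<omega>. \<forall>s\<in>J. B s \<omega> \<in> S s)"
      using A by (intro pred_intros_finite pred_sets2[OF _ B_measurable]) auto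
    then show "A \<in> sets M" unfolding A by (simp add: pred_def)
  qed
  have D_sets: "?D \<subseteq> sets M"
    by auto
  have C_Int: "A \<inter> A' \<in> C" if "A \<in> C" "A' \<in> C" for A A'
  proof -
    from that obtain J S where A: "A = {\<omega> \<in> space M. \<forall>s\<in>J. B s \<omega> \<in> S s}" "finite J" "J \<subseteq> {0..u}"
      "\<forall>s\<in>J. S s \<in> sets borel" unfolding C_def by auto
    from that obtain J' S' where A': "A' = {\<omega> \<in> space M. \<forall>s\<in>J'. B s \<omega> \<in> S' s}" "finite J'" "J' \<subseteq> {0..u}"
      "\<forall>s\<in>J'. S' s \<in> sets borel" unfolding C_def by auto
    show ?thesis unfolding C_def
    proof (intro CollectI exI conjI)
      show "A \<inter> A' = {\<omega> \<in> space M. \<forall>s\<in>J \<union> J'.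
          B s \<omega> \<in> (if s \<in> J then S s else UNIV) \<inter> (if s \<in> J' then S' s else UNIV)}"
        unfolding A A' by auto
    qed (use A A' in auto)
  qed
  have "P.indep_set (C \<union> null_sets P) ?D"
    unfolding P.indep_sets2_eq
  proof (intro conjI ballI)
    show "C \<union> null_sets P \<subseteq> sets P" using C_sets by (auto intro: sets_completionI_sets)
    show "?D \<subseteq> sets P" using D_sets by (auto intro: sets_completionI_sets)
  next
    fix a b assume a: "a \<in> C \<union> null_sets P" and b: "b \<in> ?D"
    then obtain T where T: "b = (\<lambda>\<omega>. B w \<omega> - B u \<omega>) -` T \<inter> space M" "T \<in> sets borel" by auto
    have bM: "b \<in> sets M" using b D_sets by auto
    show "measure P (a \<inter> b) = measure P a * measure P b"
    proof (cases "a \<in> null_sets P")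
      case True
      moreover have "a \<inter> b \<in> null_sets P"
        using True bM by (intro null_set_Int2) (auto intro: sets_completionI_sets)
      ultimately show ?thesis by (simp add: measure_eq_0_null_sets)
    next
      case False
      then have aC: "a \<in> C" using a by auto
      then obtain J S where A: "a = {\<omega> \<in> space M. \<forall>s\<in>J. B s \<omega> \<in> S s}" "finite J" "J \<subseteq> {0..u}"
        "\<forall>s\<in>J. S s \<in> sets borel" unfolding C_def by auto
      have b_eq: "b = {\<omega> \<in> space M. B w \<omega> - B u \<omega> \<in> T}" using T by auto
      have ab: "a \<inter> b = {\<omega> \<in> space M. (\<forall>s\<in>J. B s \<omega> \<in> S s) \<and> B w \<omega> - B u \<omega> \<in> T}"
        unfolding A b_eq by auto
      have "measure M (a \<inter> b) = measure M a * measure M b"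
        unfolding ab unfolding A b_eq
        by (rule brownian_motion_cylinder_indep[OF prob_space_axioms BM]) (use A T assms in auto)
      moreover have "a \<in> sets M" "a \<inter> b \<in> sets M" using aC C_sets bM by auto
      ultimately show ?thesis using bM by simp
    qed
  qed
  moreover have "Int_stable (C \<union> null_sets P)"
  proof (rule Int_stableI)
    fix a b assume ab: "a \<in> C \<union> null_sets P" "b \<in> C \<union> null_sets P"
    then have "a \<in> sets P" "b \<in> sets P" using C_sets by (auto intro: sets_completionI_sets)
    then show "a \<inter> b \<in> C \<union> null_sets P"
      using ab C_Int null_set_Int1[of b P a] null_set_Int2[of a P b] by auto
  qed
  moreover have "Int_stable ?D"
    by (rule Int_stable_vimage)
  ultimately have "P.indep_set (sigma_sets (space P) (C \<union> null_sets P)) (sigma_sets (space P) ?D)"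
    by (rule P.indep_set_sigma_sets)
  moreover have "sets (natural_completed u) \<subseteq> sigma_sets (space P) (C \<union> null_sets P)"
    unfolding sets_natural_completed space_completion
  proof (intro sigma_sets_mono Un_least)
    show "natural_events M B (ennreal u) \<subseteq> sigma_sets (space M) (C \<union> null_sets P)"
    proof
      fix A assume "A \<in> natural_events M B (ennreal u)"
      then obtain s S where "A = B s -` S \<inter> space M" "0 \<le> s" "s \<le> u" "S \<in> sets borel"
        using assms unfolding natural_events_def by (auto simp: ennreal_le_iff)
      then have "A \<in> C" unfolding C_def
        by (intro CollectI exI[of _ "{s}"] exI[of _ "\<lambda>_. S"]) auto
      then show "A \<in> sigma_sets (space M) (C \<union> null_sets P)" by auto
    qed
  qed auto
  ultimately show ?thesis
    by (rule P.indep_set_mono) (rule sigma_sets_superset_generator)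
qed

lemma indep_var_increment:
  assumes "0 \<le> u" "u < w" and z: "z \<in> borel_measurable (natural_completed u)"
  shows "P.indep_var borel z borel (\<lambda>\<omega>. B w \<omega> - B u \<omega>)"
proof -
  have rv: "z \<in> borel_measurable P" "(\<lambda>\<omega>. B w \<omega> - B u \<omega>) \<in> borel_measurable P"
    by (rule measurable_natural_completed_P[OF z])
      (use assms in \<open>intro borel_measurable_diff B_measurable_P; simp\<close>)
  let ?Z = "{z -` A \<inter> space M | A. A \<in> sets borel}"
  let ?D = "{(\<lambda>\<omega>. B w \<omega> - B u \<omega>) -` A \<inter> space M | A. A \<in> sets borel}"
  have Z: "?Z \<subseteq> sets (natural_completed u)"
    using measurable_sets[OF z] by auto
  have "P.indep_set ?Z ?D"
    using indep_set_natural_completed[OF assms(1,2)] Z by (rule P.indep_set_mono) (rule order_refl)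
  then have "P.indep_set (sigma_sets (space P) ?Z) (sigma_sets (space P) ?D)"
    by (rule P.indep_set_sigma_sets) (rule Int_stable_vimage)+
  then show ?thesis
    unfolding P.indep_var_eq space_completion using rv by (intro conjI)
qed

lemma increment_moments:
  assumes "0 \<le> u" "u \<le> w"
  shows "integrable P (\<lambda>\<omega>. B w \<omega> - B u \<omega>)" "(\<integral>\<omega>. B w \<omega> - B u \<omega> \<partial>P) = 0"
    and "integrable P (\<lambda>\<omega>. (B w \<omega> - B u \<omega>)\<^sup>2)" "(\<integral>\<omega>. (B w \<omega> - B u \<omega>)\<^sup>2 \<partial>P) = w - u"
proof -
  have "integrable P (\<lambda>\<omega>. B w \<omega> - B u \<omega>) \<and> (\<integral>\<omega>. B w \<omega> - B u \<omega> \<partial>P) = 0 \<and>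
    integrable P (\<lambda>\<omega>. (B w \<omega> - B u \<omega>)\<^sup>2) \<and> (\<integral>\<omega>. (B w \<omega> - B u \<omega>)\<^sup>2 \<partial>P) = w - u"
  proof (cases "u = w")
    case False
    then have "u < w" using assms by simp
    have [measurable]: "B u \<in> borel_measurable M" "B w \<in> borel_measurable M"
      using assms by (auto intro: B_measurable)
    let ?s = "sqrt (w - u)"
    have s: "0 < ?s" using \<open>u < w\<close> by simp
    have D: "distributed M lborel (\<lambda>\<omega>. B w \<omega> - B u \<omega>) (\<lambda>y. ennreal (normal_density 0 ?s y))"
      using BM assms \<open>u < w\<close> unfolding brownian_motion_def by blast
    have "integrable M (\<lambda>\<omega>. B w \<omega> - B u \<omega>)"
      using distributed_integrable[OF D, of "\<lambda>x. x"] integrable_normal_moment_nz_1[OF s, of 0] by simp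
    moreover have "expectation (\<lambda>\<omega>. B w \<omega> - B u \<omega>) = 0"
      by (rule normal_distributed_expectation[OF s D])
    moreover have "integrable M (\<lambda>\<omega>. (B w \<omega> - B u \<omega>)\<^sup>2)"
      using distributed_integrable[OF D, of "\<lambda>x. x\<^sup>2"] integrable_normal_moment[OF s, of 0 2] by simp
    moreover have "expectation (\<lambda>\<omega>. (B w \<omega> - B u \<omega>)\<^sup>2) = w - u"
      using normal_distributed_variance[OF s D] calculation(2) \<open>u < w\<close> by simp
    ultimately show ?thesis
      by (simp add: integrable_completion integral_completion)
  qed auto
  then show "integrable P (\<lambda>\<omega>. B w \<omega> - B u \<omega>)" "(\<integral>\<omega>. B w \<omega> - B u \<omega> \<partial>P) = 0"
    and "integrable P (\<lambda>\<omega>. (B w \<omega> - B u \<omega>)\<^sup>2)" "(\<integral>\<omega>. (B w \<omega> - B u \<omega>)\<^sup>2 \<partial>P) = w - u"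
    by auto
qed

lemma expectation_increment_natural:
  assumes "0 \<le> u" "u < w" "z \<in> borel_measurable (natural_completed u)" "integrable P z"
  shows "(\<integral>\<omega>. z \<omega> * (B w \<omega> - B u \<omega>) \<partial>P) = 0"
  using P.indep_var_lebesgue_integral[OF indep_var_increment[OF assms(1-3)] assms(4)]
    increment_moments[of u w] assms by simp

lemma expectation_increment_sq_natural:
  assumes "0 \<le> u" "u < w" "z \<in> borel_measurable (natural_completed u)" "integrable P z"
  shows "(\<integral>\<omega>. z \<omega> * (B w \<omega> - B u \<omega>)\<^sup>2 \<partial>P) = (w - u) * (\<integral>\<omega>. z \<omega> \<partial>P)"
    and "integrable P (\<lambda>\<omega>. z \<omega> * (B w \<omega> - B u \<omega>)\<^sup>2)"
proof -
  have "P.indep_var borel (id \<circ> z) borel ((\<lambda>x. x\<^sup>2) \<circ> (\<lambda>\<omega>. B w \<omega> - B u \<omega>))"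
    by (rule P.indep_var_compose[OF indep_var_increment[OF assms(1-3)]]) auto
  then have *: "P.indep_var borel z borel (\<lambda>\<omega>. (B w \<omega> - B u \<omega>)\<^sup>2)" by (simp add: comp_def)
  show "(\<integral>\<omega>. z \<omega> * (B w \<omega> - B u \<omega>)\<^sup>2 \<partial>P) = (w - u) * (\<integral>\<omega>. z \<omega> \<partial>P)"
    using P.indep_var_lebesgue_integral[OF * assms(4)] increment_moments[of u w] assms by simp
  show "integrable P (\<lambda>\<omega>. z \<omega> * (B w \<omega> - B u \<omega>)\<^sup>2)"
    using P.indep_var_integrable[OF * assms(4)] increment_moments[of u w] assms by simp
qed

text \<open>\<open>z\<close> is known to be measurable for \<open>natural_completed\<close> only
  strictly after a. The increment from a + h on is uncorrelated with \<open>z\<close>, and the piece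
  over [a, a + h] contributes O(sqrt h), so h is sent to 0.\<close>

lemma expectation_increment:
  assumes a: "0 \<le> a" "a \<le> w" and z: "z \<in> borel_measurable (F a)" and z2: "integrable P (\<lambda>\<omega>. (z \<omega>)\<^sup>2)"
  shows "integrable P (\<lambda>\<omega>. z \<omega> * (B w \<omega> - B a \<omega>))"
    and "(\<integral>\<omega>. z \<omega> * (B w \<omega> - B a \<omega>) \<partial>P) = 0"
proof -
  have [measurable]: "z \<in> borel_measurable P" using z by measurable
  have int: "integrable P (\<lambda>\<omega>. z \<omega> * (B u' \<omega> - B u \<omega>))" if "0 \<le> u" "u \<le> u'" for u u'
    using that z2 increment_moments[of u u'] by (intro integrable_mult_L2) auto
  from int[OF a] show "integrable P (\<lambda>\<omega>. z \<omega> * (B w \<omega> - B a \<omega>))" .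
  show "(\<integral>\<omega>. z \<omega> * (B w \<omega> - B a \<omega>) \<partial>P) = 0"
  proof (cases "a = w")
    case False
    then have aw: "a < w" using a by simp
    have zi: "integrable P z"
      using P.square_integrable_imp_integrable[of z] z2 by simp
    let ?\<phi> = "\<integral>\<omega>. z \<omega> * (B w \<omega> - B a \<omega>) \<partial>P"
    let ?C = "(\<integral>\<omega>. (z \<omega>)\<^sup>2 \<partial>P) + 1"
    have bound: "\<bar>?\<phi>\<bar> \<le> sqrt h * ?C" if h: "0 < h" "h < w - a" for h
    proof -
      let ?u = "a + h"
      have "(\<integral>\<omega>. z \<omega> * (B w \<omega> - B ?u \<omega>) \<partial>P) = 0"
        by (rule expectation_increment_natural) (use a h zi measurable_natural_completed[OF z, of ?u] in auto)
      moreover have "?\<phi> = (\<integral>\<omega>. z \<omega> * (B w \<omega> - B ?u \<omega>) + z \<omega> * (B ?u \<omega> - B a \<omega>) \<partial>P)"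
        by (simp add: algebra_simps)
      ultimately have "?\<phi> = (\<integral>\<omega>. z \<omega> * (B ?u \<omega> - B a \<omega>) \<partial>P)"
        using int a h by (subst (asm) Bochner_Integration.integral_add) auto
      then have "\<bar>?\<phi>\<bar> \<le> (\<integral>\<omega>. \<bar>z \<omega> * (B ?u \<omega> - B a \<omega>)\<bar> \<partial>P)"
        using integral_abs_bound by simp
      \<comment> \<open>Young's inequality with weight sqrt h: the increment over [a, a + h] has
        second moment h, so both terms come out of order sqrt h.\<close>
      also have "\<dots> \<le> (\<integral>\<omega>. sqrt h * (z \<omega>)\<^sup>2 + (B ?u \<omega> - B a \<omega>)\<^sup>2 / sqrt h \<partial>P)"
      proof (rule integral_mono)
        have "\<bar>x * y\<bar> \<le> s * x\<^sup>2 + y\<^sup>2 / s" if "s > 0" for s x y :: real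
        proof -
          have "0 \<le> (s * \<bar>x\<bar> - \<bar>y\<bar>)\<^sup>2 + s * \<bar>x * y\<bar>" using that by simp
          then have "s * \<bar>x * y\<bar> \<le> s * (s * x\<^sup>2 + y\<^sup>2 / s)" using that
            by (simp add: power2_eq_square algebra_simps abs_mult)
          then show ?thesis using that by (simp add: mult_le_cancel_left_pos)
        qed
        then show "\<bar>z \<omega> * (B ?u \<omega> - B a \<omega>)\<bar> \<le> sqrt h * (z \<omega>)\<^sup>2 + (B ?u \<omega> - B a \<omega>)\<^sup>2 / sqrt h" for \<omega>
          using h by auto
      qed (use int[of a ?u] z2 increment_moments[of a ?u] a h in auto)
      also have "\<dots> = sqrt h * ?C"
        using z2 increment_moments[of a ?u] a h
        by (simp add: algebra_simps real_div_sqrt)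
      finally show ?thesis .
    qed
    have "((\<lambda>h. sqrt h * ?C) \<longlongrightarrow> sqrt 0 * ?C) (at_right 0)"
      by (intro tendsto_intros)
    moreover have "\<forall>\<^sub>F h in at_right 0. \<bar>?\<phi>\<bar> \<le> sqrt h * ?C"
      using eventually_at_right_real[of 0 "w - a"] aw by (auto elim!: eventually_mono intro!: bound)
    ultimately have "\<bar>?\<phi>\<bar> \<le> sqrt 0 * ?C"
      by (rule tendsto_lowerbound) simp
    then show ?thesis by simp
  qed simp
qed

text \<open>Same limit as for the first moment. When the square is split at a + h, the cross term
  vanishes because \<open>z\<close> times the early increment is known at a + h. The early square
  and the discrepancy h times the mean of \<open>z\<close> are each at most C h, hence the bound
  \<open>2 * C * h\<close>.\<close>

lemma expectation_increment_sq:
  assumes a: "0 \<le> a" "a \<le> w" and z: "z \<in> borel_measurable (F a)" and C: "\<And>\<omega>. \<omega> \<in> space M \<Longrightarrow> \<bar>z \<omega>\<bar> \<le> C"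
  shows "integrable P (\<lambda>\<omega>. z \<omega> * (B w \<omega> - B a \<omega>)\<^sup>2)"
    and "(\<integral>\<omega>. z \<omega> * (B w \<omega> - B a \<omega>)\<^sup>2 \<partial>P) = (w - a) * (\<integral>\<omega>. z \<omega> \<partial>P)"
proof -
  have zP [measurable]: "z \<in> borel_measurable P" using z by measurable
  have C0: "C \<ge> 0" using C not_empty by fastforce
  have int: "integrable P (\<lambda>\<omega>. z \<omega> * (B u' \<omega> - B u \<omega>)\<^sup>2)" if "0 \<le> u" "u \<le> u'" for u u'
  proof (rule Bochner_Integration.integrable_bound)
    show "integrable P (\<lambda>\<omega>. C * (B u' \<omega> - B u \<omega>)\<^sup>2)"
      using increment_moments[of u u'] that by simp
    show "(\<lambda>\<omega>. z \<omega> * (B u' \<omega> - B u \<omega>)\<^sup>2) \<in> borel_measurable P"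
      using that by (intro borel_measurable_times borel_measurable_power borel_measurable_diff B_measurable_P zP) auto
    show "AE x in P. norm (z x * (B u' x - B u x)\<^sup>2) \<le> norm (C * (B u' x - B u x)\<^sup>2)"
      by (rule AE_I2) (use C C0 in \<open>auto simp: abs_mult intro!: mult_right_mono\<close>)
  qed
  from int[OF a] show "integrable P (\<lambda>\<omega>. z \<omega> * (B w \<omega> - B a \<omega>)\<^sup>2)" .
  have zi: "integrable P z"
    by (rule P.integrable_const_bound[of _ C]) (use C in auto)
  show "(\<integral>\<omega>. z \<omega> * (B w \<omega> - B a \<omega>)\<^sup>2 \<partial>P) = (w - a) * (\<integral>\<omega>. z \<omega> \<partial>P)" (is "?I = _")
  proof (cases "a = w")
    case False
    then have aw: "a < w" using a by simp
    have bound: "\<bar>?I - (w - a) * (\<integral>\<omega>. z \<omega> \<partial>P)\<bar> \<le> 2 * C * h" if h: "0 < h" "h < w - a" for h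
    proof -
      let ?u = "a + h"
      have zn: "z \<in> borel_measurable (natural_completed ?u)"
        using measurable_natural_completed[OF z] a h by simp
      have [measurable]: "B ?u \<in> borel_measurable P" "B a \<in> borel_measurable P" "B w \<in> borel_measurable P"
        using a h by (auto intro: B_measurable_P)
      have 1: "(\<integral>\<omega>. z \<omega> * (B w \<omega> - B ?u \<omega>)\<^sup>2 \<partial>P) = (w - ?u) * (\<integral>\<omega>. z \<omega> \<partial>P)"
        by (rule expectation_increment_sq_natural) (use a h zn zi in auto)
      have z2: "integrable P (\<lambda>\<omega>. (z \<omega> * (B ?u \<omega> - B a \<omega>))\<^sup>2)"
      proof (rule Bochner_Integration.integrable_bound)
        show "integrable P (\<lambda>\<omega>. C\<^sup>2 * (B ?u \<omega> - B a \<omega>)\<^sup>2)"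
          using increment_moments[of a ?u] a h by simp
        show "AE x in P. norm ((z x * (B ?u x - B a x))\<^sup>2) \<le> norm (C\<^sup>2 * (B ?u x - B a x)\<^sup>2)"
          by (rule AE_I2) (use C C0 in \<open>auto simp: power_mult_distrib intro!: mult_right_mono abs_le_square_iff[THEN iffD1]\<close>)
      qed (use a h in measurable)
      have zi': "integrable P (\<lambda>\<omega>. z \<omega> * (B ?u \<omega> - B a \<omega>))"
        using a h by (intro P.square_integrable_imp_integrable[OF _ z2]) measurable
      have 2: "(\<integral>\<omega>. z \<omega> * (B ?u \<omega> - B a \<omega>) * (B w \<omega> - B ?u \<omega>) \<partial>P) = 0"
      proof (rule expectation_increment_natural)
        show "(\<lambda>\<omega>. z \<omega> * (B ?u \<omega> - B a \<omega>)) \<in> borel_measurable (natural_completed ?u)"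
          by (intro borel_measurable_times borel_measurable_diff zn B_adapted_natural) (use a h in simp_all)
      qed (use a h zi' in simp_all)
      have m2: "integrable P (\<lambda>\<omega>. z \<omega> * (B ?u \<omega> - B a \<omega>) * (B w \<omega> - B ?u \<omega>))"
        by (rule integrable_mult_L2[OF _ _ z2]) (use increment_moments(3)[of ?u w] a h in \<open>simp_all\<close>)
      have "?I = (\<integral>\<omega>. z \<omega> * (B w \<omega> - B ?u \<omega>)\<^sup>2 + (2 * (z \<omega> * (B ?u \<omega> - B a \<omega>) * (B w \<omega> - B ?u \<omega>))
           + z \<omega> * (B ?u \<omega> - B a \<omega>)\<^sup>2) \<partial>P)"
        by (simp add: algebra_simps power2_eq_square)
      also have "\<dots> = (w - ?u) * (\<integral>\<omega>. z \<omega> \<partial>P) + (\<integral>\<omega>. z \<omega> * (B ?u \<omega> - B a \<omega>)\<^sup>2 \<partial>P)"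
        using int[of ?u w] int[of a ?u] m2 1 2 a h by simp
      finally have "?I - (w - a) * (\<integral>\<omega>. z \<omega> \<partial>P) = (\<integral>\<omega>. z \<omega> * (B ?u \<omega> - B a \<omega>)\<^sup>2 \<partial>P) - h * (\<integral>\<omega>. z \<omega> \<partial>P)"
        by (simp add: algebra_simps)
      moreover have "\<bar>\<integral>\<omega>. z \<omega> * (B ?u \<omega> - B a \<omega>)\<^sup>2 \<partial>P\<bar> \<le> C * h"
      proof -
        have "\<bar>\<integral>\<omega>. z \<omega> * (B ?u \<omega> - B a \<omega>)\<^sup>2 \<partial>P\<bar> \<le> (\<integral>\<omega>. \<bar>z \<omega> * (B ?u \<omega> - B a \<omega>)\<^sup>2\<bar> \<partial>P)"
          by (rule integral_abs_bound)
        also have "\<dots> \<le> (\<integral>\<omega>. C * (B ?u \<omega> - B a \<omega>)\<^sup>2 \<partial>P)"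
        proof (rule integral_mono)
          show "integrable P (\<lambda>\<omega>. \<bar>z \<omega> * (B ?u \<omega> - B a \<omega>)\<^sup>2\<bar>)" using int[of a ?u] a h by simp
          show "integrable P (\<lambda>\<omega>. C * (B ?u \<omega> - B a \<omega>)\<^sup>2)" using increment_moments(3)[of a ?u] a h by simp
          fix \<omega> assume "\<omega> \<in> space P"
          then show "\<bar>z \<omega> * (B ?u \<omega> - B a \<omega>)\<^sup>2\<bar> \<le> C * (B ?u \<omega> - B a \<omega>)\<^sup>2"
            using C by (simp add: abs_mult mult_right_mono)
        qed
        finally show ?thesis using increment_moments[of a ?u] a h by simp
      qed
      moreover have "\<bar>h * (\<integral>\<omega>. z \<omega> \<partial>P)\<bar> \<le> C * h"
      proof -
        have "\<bar>\<integral>\<omega>. z \<omega> \<partial>P\<bar> \<le> (\<integral>\<omega>. \<bar>z \<omega>\<bar> \<partial>P)" by (rule integral_abs_bound)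
        also have "\<dots> \<le> (\<integral>\<omega>. C \<partial>P)" by (rule integral_mono) (use zi C in auto)
        finally show ?thesis using h by (simp add: abs_mult prob_space)
      qed
      ultimately show ?thesis by linarith
    qed
    have "((\<lambda>h. 2 * C * h) \<longlongrightarrow> 2 * C * 0) (at_right 0)"
      by (intro tendsto_intros)
    moreover have "\<forall>\<^sub>F h in at_right 0. \<bar>?I - (w - a) * (\<integral>\<omega>. z \<omega> \<partial>P)\<bar> \<le> 2 * C * h"
      using eventually_at_right_real[of 0 "w - a"] aw by (auto elim!: eventually_mono intro!: bound)
    ultimately have "\<bar>?I - (w - a) * (\<integral>\<omega>. z \<omega> \<partial>P)\<bar> \<le> 2 * C * 0"
      by (rule tendsto_lowerbound) simp
    then show ?thesis by simp
  qed simp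
qed

end

section \<open>The Ito isometry\<close>

lemma Cauchy_Schwarz_integral:
  fixes f g :: "'a \<Rightarrow> real"
  assumes f: "f \<in> borel_measurable M" "integrable M (\<lambda>x. (f x)\<^sup>2)"
    and g: "g \<in> borel_measurable M" "integrable M (\<lambda>x. (g x)\<^sup>2)"
  shows "\<bar>\<integral>x. f x * g x \<partial>M\<bar> \<le> sqrt (\<integral>x. (f x)\<^sup>2 \<partial>M) * sqrt (\<integral>x. (g x)\<^sup>2 \<partial>M)"
proof -
  let ?a = "\<integral>x. (f x)\<^sup>2 \<partial>M" and ?b = "\<integral>x. f x * g x \<partial>M" and ?c = "\<integral>x. (g x)\<^sup>2 \<partial>M"
  have fg: "integrable M (\<lambda>x. f x * g x)" using assms by (intro integrable_mult_L2)
  have "?b\<^sup>2 \<le> ?a * ?c"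
  proof (cases "?c = 0")
    case True
    then have "AE x in M. (g x)\<^sup>2 = 0"
      using integral_nonneg_eq_0_iff_AE[OF g(2)] by simp
    then have "AE x in M. f x * g x = 0" by eventually_elim simp
    then have "?b = 0" using fg by (simp add: integral_eq_zero_AE)
    then show ?thesis using True by simp
  next
    case False
    then have c: "?c > 0" using Bochner_Integration.integral_nonneg[of M "\<lambda>x. (g x)\<^sup>2"] by (simp add: less_le)
    have "0 \<le> (\<integral>x. (?c * f x - ?b * g x)\<^sup>2 \<partial>M)" by simp
    also have "\<dots> = (\<integral>x. ?c\<^sup>2 * (f x)\<^sup>2 + (?b\<^sup>2 * (g x)\<^sup>2 - (2 * ?b * ?c) * (f x * g x)) \<partial>M)"
      by (intro Bochner_Integration.integral_cong) (auto simp: power2_eq_square algebra_simps)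
    also have "\<dots> = ?c\<^sup>2 * ?a + (?b\<^sup>2 * ?c - (2 * ?b * ?c) * ?b)"
      using f(2) g(2) fg by simp
    also have "\<dots> = ?c * (?a * ?c - ?b\<^sup>2)" by (simp add: power2_eq_square algebra_simps)
    finally show ?thesis using c by (simp add: zero_le_mult_iff)
  qed
  then have "sqrt (?b\<^sup>2) \<le> sqrt (?a * ?c)" by (rule real_sqrt_le_mono)
  then show ?thesis by (simp add: real_sqrt_mult)
qed

lemma integrable_diff_L2:
  fixes f g :: "'a \<Rightarrow> real"
  assumes "f \<in> borel_measurable M" "integrable M (\<lambda>x. (f x)\<^sup>2)"
    and "g \<in> borel_measurable M" "integrable M (\<lambda>x. (g x)\<^sup>2)"
  shows "integrable M (\<lambda>x. (f x - g x)\<^sup>2)"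
proof -
  have "integrable M (\<lambda>x. (f x)\<^sup>2 + (g x)\<^sup>2 - 2 * (f x * g x))"
    using integrable_mult_L2[of f M g] assms by simp
  then show ?thesis by (simp add: power2_diff mult.assoc)
qed

text \<open>Write f as g plus the error and expand: the cross term is controlled by
  Cauchy-Schwarz.\<close>

lemma L2_limit_integral_sq:
  fixes f :: "nat \<Rightarrow> 'a \<Rightarrow> real"
  assumes f: "\<And>k. f k \<in> borel_measurable M" "\<And>k. integrable M (\<lambda>x. (f k x)\<^sup>2)"
    and g: "g \<in> borel_measurable M" "integrable M (\<lambda>x. (g x)\<^sup>2)"
    and lim: "(\<lambda>k. \<integral>x. (f k x - g x)\<^sup>2 \<partial>M) \<longlonglongrightarrow> 0"
  shows "(\<lambda>k. \<integral>x. (f k x)\<^sup>2 \<partial>M) \<longlonglongrightarrow> (\<integral>x. (g x)\<^sup>2 \<partial>M)"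
proof -
  have d: "integrable M (\<lambda>x. (f k x - g x)\<^sup>2)" "(\<lambda>x. f k x - g x) \<in> borel_measurable M" for k
    using f g by (auto intro: integrable_diff_L2)
  have eq: "(\<integral>x. (f k x)\<^sup>2 \<partial>M) = (\<integral>x. (g x)\<^sup>2 \<partial>M) + ((\<integral>x. (f k x - g x)\<^sup>2 \<partial>M) + 2 * (\<integral>x. g x * (f k x - g x) \<partial>M))" for k
  proof -
    have "(\<integral>x. (f k x)\<^sup>2 \<partial>M) = (\<integral>x. (g x)\<^sup>2 + ((f k x - g x)\<^sup>2 + 2 * (g x * (f k x - g x))) \<partial>M)"
      by (intro Bochner_Integration.integral_cong) (auto simp: power2_eq_square algebra_simps)
    also have "\<dots> = (\<integral>x. (g x)\<^sup>2 \<partial>M) + ((\<integral>x. (f k x - g x)\<^sup>2 \<partial>M) + 2 * (\<integral>x. g x * (f k x - g x) \<partial>M))"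
      using g d[of k] integrable_mult_L2[OF g(1) d(2) g(2) d(1)] by simp
    finally show ?thesis .
  qed
  have "(\<lambda>k. \<integral>x. g x * (f k x - g x) \<partial>M) \<longlonglongrightarrow> 0"
  proof (rule Lim_null_comparison)
    show "\<forall>\<^sub>F k in sequentially. norm (\<integral>x. g x * (f k x - g x) \<partial>M) \<le>
        sqrt (\<integral>x. (g x)\<^sup>2 \<partial>M) * sqrt (\<integral>x. (f k x - g x)\<^sup>2 \<partial>M)"
      using Cauchy_Schwarz_integral[OF g d(2,1)] by simp
    show "(\<lambda>k. sqrt (\<integral>x. (g x)\<^sup>2 \<partial>M) * sqrt (\<integral>x. (f k x - g x)\<^sup>2 \<partial>M)) \<longlonglongrightarrow> 0"
      using tendsto_mult_left[OF tendsto_real_sqrt[OF lim], of "sqrt (\<integral>x. (g x)\<^sup>2 \<partial>M)"] by simp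
  qed
  then have "(\<lambda>k. (\<integral>x. (g x)\<^sup>2 \<partial>M) + ((\<integral>x. (f k x - g x)\<^sup>2 \<partial>M) + 2 * (\<integral>x. g x * (f k x - g x) \<partial>M)))
      \<longlonglongrightarrow> (\<integral>x. (g x)\<^sup>2 \<partial>M) + (0 + 2 * 0)"
    by (intro tendsto_intros lim)
  then show ?thesis using eq by simp
qed

lemma (in pair_sigma_finite) product_mult_integral:
  fixes f :: "'a \<Rightarrow> real" and g :: "'b \<Rightarrow> real"
  assumes f: "integrable M1 f" and g: "integrable M2 g"
  shows "integrable (M1 \<Otimes>\<^sub>M M2) (\<lambda>x. f (fst x) * g (snd x))"
    and "(\<integral>x. f (fst x) * g (snd x) \<partial>(M1 \<Otimes>\<^sub>M M2)) = (\<integral>x. f x \<partial>M1) * (\<integral>x. g x \<partial>M2)"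
proof -
  have [measurable]: "f \<in> borel_measurable M1" "g \<in> borel_measurable M2" using f g by auto
  show i: "integrable (M1 \<Otimes>\<^sub>M M2) (\<lambda>x. f (fst x) * g (snd x))"
  proof (rule Fubini_integrable)
    have "integrable M1 (\<lambda>x. \<bar>f x\<bar> * (\<integral>y. \<bar>g y\<bar> \<partial>M2))" using f by simp
    then show "integrable M1 (\<lambda>x. \<integral>y. norm (f (fst (x, y)) * g (snd (x, y))) \<partial>M2)"
      using g by (simp add: abs_mult)
  qed (use g in auto)
  show "(\<integral>x. f (fst x) * g (snd x) \<partial>(M1 \<Otimes>\<^sub>M M2)) = (\<integral>x. f x \<partial>M1) * (\<integral>x. g x \<partial>M2)"
    using integral_fst'[OF i] f g by simp
qed

section \<open>Elementary integrands and the closure of their integrals\<close>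

context brownian
begin

abbreviation Q :: "('a \<times> real) measure" where "Q \<equiv> P \<Otimes>\<^sub>M lborel"

sublocale PQ: pair_sigma_finite P lborel ..

definition valid_step :: "real \<times> real \<times> ('a \<Rightarrow> real) \<Rightarrow> bool" where
  "valid_step = (\<lambda>(a, b, \<xi>). 0 \<le> a \<and> a \<le> b \<and> \<xi> \<in> borel_measurable (F a) \<and>
     (\<exists>C. \<forall>\<omega>\<in>space M. \<bar>\<xi> \<omega>\<bar> \<le> C))"

definition step_int :: "real \<times> real \<times> ('a \<Rightarrow> real) \<Rightarrow> 'a \<Rightarrow> real" where
  "step_int = (\<lambda>(a, b, \<xi>) \<omega>. \<xi> \<omega> * (B b \<omega> - B a \<omega>))"

definition step_proc :: "real \<times> real \<times> ('a \<Rightarrow> real) \<Rightarrow> 'a \<times> real \<Rightarrow> real" where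
  "step_proc = (\<lambda>(a, b, \<xi>) x. \<xi> (fst x) * indicator {a<..b} (snd x))"

lemma step_int_L2:
  assumes "valid_step p"
  shows "step_int p \<in> borel_measurable P" "integrable P (\<lambda>\<omega>. (step_int p \<omega>)\<^sup>2)"
    "integrable P (step_int p)" "(\<integral>\<omega>. step_int p \<omega> \<partial>P) = 0"
proof -
  obtain a b \<xi> C where p: "p = (a, b, \<xi>)" "0 \<le> a" "a \<le> b" and \<xi>: "\<xi> \<in> borel_measurable (F a)"
    and C: "\<And>\<omega>. \<omega> \<in> space M \<Longrightarrow> \<bar>\<xi> \<omega>\<bar> \<le> C"
    using assms by (auto simp: valid_step_def split: prod.splits)
  note [measurable] = measurable_P[OF \<xi>]
  have [measurable]: "B a \<in> borel_measurable P" "B b \<in> borel_measurable P"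
    using p by (auto intro: B_measurable_P)
  show m: "step_int p \<in> borel_measurable P" unfolding p step_int_def by simp
  show i: "integrable P (\<lambda>\<omega>. (step_int p \<omega>)\<^sup>2)"
  proof (rule Bochner_Integration.integrable_bound)
    show "integrable P (\<lambda>\<omega>. C\<^sup>2 * (B b \<omega> - B a \<omega>)\<^sup>2)"
      using increment_moments(3)[of a b] p by simp
    have "(\<xi> \<omega>)\<^sup>2 \<le> C\<^sup>2" if "\<omega> \<in> space M" for \<omega>
      using C[OF that] by (rule abs_le_square_iff[THEN iffD1, OF order_trans]) simp
    then show "AE x in P. norm ((step_int p x)\<^sup>2) \<le> norm (C\<^sup>2 * (B b x - B a x)\<^sup>2)"
      unfolding p step_int_def by (intro AE_I2) (simp add: power_mult_distrib mult_right_mono)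
  qed (use m in measurable)
  have "integrable P (\<lambda>\<omega>. (\<xi> \<omega>)\<^sup>2)"
    by (rule P.integrable_const_bound[of _ "C\<^sup>2"])
      (use C in \<open>auto intro!: abs_le_square_iff[THEN iffD1] simp: order_trans[OF _ abs_ge_self]\<close>)
  then show "integrable P (step_int p)" "(\<integral>\<omega>. step_int p \<omega> \<partial>P) = 0"
    using expectation_increment[OF p(2,3) \<xi>] unfolding p step_int_def by auto
qed

text \<open>The bilinear form of the isometry is what extends to sums of overlapping steps. Let
  \<open>p\<close> be the step that starts first: the product \<zeta> of both coefficients is then
  known at a', and after cutting at a' and at the ends of both intervals only the square over the
  common part has a mean that need not vanish.\<close>

lemma step_ito_isometry:
  assumes "valid_step p" "valid_step q"
  shows "integrable Q (\<lambda>x. step_proc p x * step_proc q x)" (is ?A)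
    and "(\<integral>\<omega>. step_int p \<omega> * step_int q \<omega> \<partial>P) = (\<integral>x. step_proc p x * step_proc q x \<partial>Q)" (is ?B)
proof -
  have *: "integrable Q (\<lambda>x. step_proc p x * step_proc q x) \<and>
      (\<integral>\<omega>. step_int p \<omega> * step_int q \<omega> \<partial>P) = (\<integral>x. step_proc p x * step_proc q x \<partial>Q)"
    if vp: "valid_step p" and vq: "valid_step q" and le: "fst p \<le> fst q" for p q
  proof -
    obtain a b \<xi> C where p: "p = (a, b, \<xi>)" "0 \<le> a" "a \<le> b" and \<xi>: "\<xi> \<in> borel_measurable (F a)"
      and C: "\<And>\<omega>. \<omega> \<in> space M \<Longrightarrow> \<bar>\<xi> \<omega>\<bar> \<le> C"
      using vp by (auto simp: valid_step_def split: prod.splits)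
    obtain a' b' \<xi>' C' where q: "q = (a', b', \<xi>')" "0 \<le> a'" "a' \<le> b'" and \<xi>': "\<xi>' \<in> borel_measurable (F a')"
      and C': "\<And>\<omega>. \<omega> \<in> space M \<Longrightarrow> \<bar>\<xi>' \<omega>\<bar> \<le> C'"
      using vq by (auto simp: valid_step_def split: prod.splits)
    have aa: "a \<le> a'" using le p q by simp
    define \<zeta> where "\<zeta> = (\<lambda>\<omega>. \<xi> \<omega> * \<xi>' \<omega>)"
    have \<zeta>: "\<zeta> \<in> borel_measurable (F a')"
      unfolding \<zeta>_def using measurable_usual_augmentation_mono[OF \<xi> aa] \<xi>' by simp
    have \<zeta>_bd: "\<bar>\<zeta> \<omega>\<bar> \<le> C * C'" if "\<omega> \<in> space M" for \<omega>
      unfolding \<zeta>_def abs_mult using C[OF that] C'[OF that] by (intro mult_mono) auto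
    note [measurable] = measurable_P[OF \<zeta>]
    have \<zeta>i: "integrable P \<zeta>"
      by (rule P.integrable_const_bound[of _ "C * C'"]) (use \<zeta>_bd in auto)
    have vs: "valid_step (a', b', \<lambda>\<omega>. \<zeta> \<omega>)" if "a' \<le> b'" for b'
      using that \<zeta> \<zeta>_bd q by (auto simp: valid_step_def)
    let ?l = "max 0 (min b b' - a')"
    have procs: "step_proc p x * step_proc q x = \<zeta> (fst x) * indicator {a'<..min b b'} (snd x)" for x
      unfolding p q step_proc_def \<zeta>_def using aa by (auto split: split_indicator)
    have ind: "integrable lborel (indicator {a'<..min b b'} :: real \<Rightarrow> real)"
      by (cases "a' \<le> min b b'") (auto intro!: integrable_real_indicator)
    have indv: "(\<integral>s. indicator {a'<..min b b'} s \<partial>lborel) = ?l"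
      by (cases "a' \<le> min b b'") (auto simp: max_def not_le)
    have Qi: "integrable Q (\<lambda>x. step_proc p x * step_proc q x)"
      unfolding procs by (rule PQ.product_mult_integral(1)[OF \<zeta>i ind])
    have Qv: "(\<integral>x. step_proc p x * step_proc q x \<partial>Q) = (\<integral>\<omega>. \<zeta> \<omega> \<partial>P) * ?l"
      unfolding procs PQ.product_mult_integral(2)[OF \<zeta>i ind] indv ..
    have zD2: "integrable P (\<lambda>\<omega>. (\<zeta> \<omega> * (B u \<omega> - B v \<omega>))\<^sup>2)" if "0 \<le> v" "v \<le> u" for u v
    proof (rule Bochner_Integration.integrable_bound)
      show "integrable P (\<lambda>\<omega>. (C * C')\<^sup>2 * (B u \<omega> - B v \<omega>)\<^sup>2)"
        using increment_moments(3)[of v u] that by simp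
      have "(\<zeta> \<omega>)\<^sup>2 \<le> (C * C')\<^sup>2" if "\<omega> \<in> space M" for \<omega>
        using \<zeta>_bd[OF that] by (rule abs_le_square_iff[THEN iffD1, OF order_trans]) simp
      then show "AE x in P. norm ((\<zeta> x * (B u x - B v x))\<^sup>2) \<le> norm ((C * C')\<^sup>2 * (B u x - B v x)\<^sup>2)"
        by (intro AE_I2) (simp add: power_mult_distrib mult_right_mono)
      have [measurable]: "B u \<in> borel_measurable P" "B v \<in> borel_measurable P"
        using that by (auto intro: B_measurable_P)
      show "(\<lambda>\<omega>. (\<zeta> \<omega> * (B u \<omega> - B v \<omega>))\<^sup>2) \<in> borel_measurable P" by simp
    qed
    have past: "(\<integral>\<omega>. \<zeta> \<omega> * (B v \<omega> - B u \<omega>) * (B t \<omega> - B r \<omega>) \<partial>P) = 0 \<and>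
        integrable P (\<lambda>\<omega>. \<zeta> \<omega> * (B v \<omega> - B u \<omega>) * (B t \<omega> - B r \<omega>))"
      if "0 \<le> u" "u \<le> v" "v \<le> r" "r \<le> t" "a' \<le> r" for u v r t
    proof -
      have m: "(\<lambda>\<omega>. \<zeta> \<omega> * (B v \<omega> - B u \<omega>)) \<in> borel_measurable (F r)"
        using that \<zeta> by (intro borel_measurable_times borel_measurable_diff B_adapted' measurable_usual_augmentation_mono[OF \<zeta>]) auto
      show ?thesis
        using expectation_increment[OF _ _ m zD2] that by auto
    qed
    have "(\<integral>\<omega>. step_int p \<omega> * step_int q \<omega> \<partial>P) = (\<integral>\<omega>. \<zeta> \<omega> \<partial>P) * ?l"
    proof (cases "b \<le> a'")
      case True
      have "step_int p \<omega> * step_int q \<omega> = \<zeta> \<omega> * (B b \<omega> - B a \<omega>) * (B b' \<omega> - B a' \<omega>)" for \<omega>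
        unfolding p q step_int_def \<zeta>_def by (simp add: ac_simps)
      then have "(\<integral>\<omega>. step_int p \<omega> * step_int q \<omega> \<partial>P) = 0"
        using past[of a b a' b'] True p q by simp
      then show ?thesis using True by simp
    next
      case False
      let ?m = "min b b'" and ?n = "max b b'"
      \<comment> \<open>The pieces are: the part of the first step before a' against the whole
        second step, the square over the common interval, and the common interval against what
        sticks out beyond it. The first and the last have mean zero by \<open>past\<close>.\<close>
      have eq: "step_int p \<omega> * step_int q \<omega> = \<zeta> \<omega> * (B a' \<omega> - B a \<omega>) * (B b' \<omega> - B a' \<omega>)
          + (\<zeta> \<omega> * (B ?m \<omega> - B a' \<omega>)\<^sup>2 + \<zeta> \<omega> * (B ?m \<omega> - B a' \<omega>) * (B ?n \<omega> - B ?m \<omega>))" for \<omega>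
        unfolding p q step_int_def \<zeta>_def
        by (cases "b \<le> b'") (auto simp: min_def max_def power2_eq_square algebra_simps)
      have 1: "(\<integral>\<omega>. \<zeta> \<omega> * (B ?m \<omega> - B a' \<omega>)\<^sup>2 \<partial>P) = (?m - a') * (\<integral>\<omega>. \<zeta> \<omega> \<partial>P)"
         "integrable P (\<lambda>\<omega>. \<zeta> \<omega> * (B ?m \<omega> - B a' \<omega>)\<^sup>2)"
        using expectation_increment_sq[OF _ _ \<zeta> \<zeta>_bd, of ?m] q False by auto
      have "(\<integral>\<omega>. step_int p \<omega> * step_int q \<omega> \<partial>P) = (?m - a') * (\<integral>\<omega>. \<zeta> \<omega> \<partial>P)"
        unfolding eq using past[of a a' a' b'] past[of a' ?m ?m ?n] 1 p q aa False by simp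
      then show ?thesis using False q by simp
    qed
    then show ?thesis using Qi Qv by simp
  qed
  have "?A \<and> ?B"
  proof (cases "fst p \<le> fst q")
    case True then show ?thesis using * assms by blast
  next
    case False
    then show ?thesis using *[of q p] assms by (simp add: mult.commute)
  qed
  then show ?A ?B by auto
qed

lemma step_proc_L2:
  assumes "valid_step p"
  shows "step_proc p \<in> borel_measurable Q" "integrable Q (\<lambda>x. (step_proc p x)\<^sup>2)"
proof -
  show "integrable Q (\<lambda>x. (step_proc p x)\<^sup>2)"
    using step_ito_isometry(1)[OF assms assms] by (simp add: power2_eq_square)
  obtain a b \<xi> where p: "p = (a, b, \<xi>)" and \<xi>: "\<xi> \<in> borel_measurable (F a)"
    using assms by (auto simp: valid_step_def split: prod.splits)
  note [measurable] = measurable_P[OF \<xi>]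
  show "step_proc p \<in> borel_measurable Q" unfolding p step_proc_def by simp
qed

text \<open>Elementary integrands are lists of steps that may overlap. Addition is then
  concatenation, and two partitions never have to be refined to a common one.\<close>

definition elem_int :: "(real \<times> real \<times> ('a \<Rightarrow> real)) list \<Rightarrow> 'a \<Rightarrow> real" where
  "elem_int e \<omega> = (\<Sum>p\<leftarrow>e. step_int p \<omega>)"

definition elem_proc :: "(real \<times> real \<times> ('a \<Rightarrow> real)) list \<Rightarrow> 'a \<times> real \<Rightarrow> real" where
  "elem_proc e x = (\<Sum>p\<leftarrow>e. step_proc p x)"

abbreviation elem :: "(real \<times> real \<times> ('a \<Rightarrow> real)) list \<Rightarrow> bool" where
  "elem e \<equiv> (\<forall>p\<in>set e. valid_step p)"

lemma elem_L2:
  assumes "elem e"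
  shows "elem_int e \<in> borel_measurable P" "integrable P (\<lambda>\<omega>. (elem_int e \<omega>)\<^sup>2)"
    "elem_proc e \<in> borel_measurable Q" "integrable Q (\<lambda>x. (elem_proc e x)\<^sup>2)"
    "(\<integral>\<omega>. (elem_int e \<omega>)\<^sup>2 \<partial>P) = (\<integral>x. (elem_proc e x)\<^sup>2 \<partial>Q)"
    "integrable P (elem_int e)" "(\<integral>\<omega>. elem_int e \<omega> \<partial>P) = 0"
proof -
  have m: "(\<forall>p\<in>set e. valid_step p) \<Longrightarrow> elem_int e \<in> borel_measurable P \<and> elem_proc e \<in> borel_measurable Q \<and>
      integrable P (elem_int e) \<and> (\<integral>\<omega>. elem_int e \<omega> \<partial>P) = 0" for e
    unfolding elem_int_def elem_proc_def
    by (induction e) (auto intro!: borel_measurable_add Bochner_Integration.integrable_add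
        simp: step_int_L2 step_proc_L2 Bochner_Integration.integral_add)
  then show "elem_int e \<in> borel_measurable P" "elem_proc e \<in> borel_measurable Q"
    "integrable P (elem_int e)" "(\<integral>\<omega>. elem_int e \<omega> \<partial>P) = 0" using assms by auto
  \<comment> \<open>Bilinearity by two inductions: one step against a list here, list against list
    afterwards.\<close>
  have 1: "elem e \<Longrightarrow> valid_step p \<Longrightarrow> integrable P (\<lambda>\<omega>. step_int p \<omega> * elem_int e \<omega>) \<and>
     integrable Q (\<lambda>x. step_proc p x * elem_proc e x) \<and>
     (\<integral>\<omega>. step_int p \<omega> * elem_int e \<omega> \<partial>P) = (\<integral>x. step_proc p x * elem_proc e x \<partial>Q)" for p e
  proof (induction e)
    case (Cons q e)
    then show ?case
      using step_ito_isometry[of p q] integrable_mult_L2[of "step_int p" P "step_int q"] step_int_L2[of p] step_int_L2[of q]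
      by (simp add: elem_int_def elem_proc_def distrib_left)
  qed (simp add: elem_int_def elem_proc_def)
  have 2: "elem e \<Longrightarrow> elem e' \<Longrightarrow> integrable P (\<lambda>\<omega>. elem_int e \<omega> * elem_int e' \<omega>) \<and>
     integrable Q (\<lambda>x. elem_proc e x * elem_proc e' x) \<and>
     (\<integral>\<omega>. elem_int e \<omega> * elem_int e' \<omega> \<partial>P) = (\<integral>x. elem_proc e x * elem_proc e' x \<partial>Q)" for e e'
  proof (induction e)
    case (Cons p e)
    then have "integrable P (\<lambda>\<omega>. elem_int e \<omega> * elem_int e' \<omega>) \<and>
     integrable Q (\<lambda>x. elem_proc e x * elem_proc e' x) \<and>
     (\<integral>\<omega>. elem_int e \<omega> * elem_int e' \<omega> \<partial>P) = (\<integral>x. elem_proc e x * elem_proc e' x \<partial>Q)" by simp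
    with 1[of e' p] Cons.prems show ?case
      by (simp add: elem_int_def[of "p # e"] elem_proc_def[of "p # e"] elem_int_def[of e, symmetric]
          elem_proc_def[of e, symmetric] distrib_right)
  qed (simp add: elem_int_def[of "[]"] elem_proc_def[of "[]"])
  from 2[OF assms assms] show "integrable P (\<lambda>\<omega>. (elem_int e \<omega>)\<^sup>2)" "integrable Q (\<lambda>x. (elem_proc e x)\<^sup>2)"
    "(\<integral>\<omega>. (elem_int e \<omega>)\<^sup>2 \<partial>P) = (\<integral>x. (elem_proc e x)\<^sup>2 \<partial>Q)"
    by (auto simp: power2_eq_square)
qed

text \<open>The graph of the Ito integral: the closure of the elementary pairs in
  L2(\<open>Q\<close>) times L2(\<open>P\<close>). The time window is carried by the integrand, as
  an indicator, instead of being a parameter.\<close>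

definition ito_pair :: "('a \<times> real \<Rightarrow> real) \<Rightarrow> ('a \<Rightarrow> real) \<Rightarrow> bool" where
  "ito_pair K I \<longleftrightarrow> K \<in> borel_measurable Q \<and> I \<in> borel_measurable P \<and>
     integrable Q (\<lambda>x. (K x)\<^sup>2) \<and> integrable P (\<lambda>\<omega>. (I \<omega>)\<^sup>2) \<and>
     (\<exists>e. (\<forall>k. elem (e k)) \<and>
       (\<lambda>k::nat. \<integral>x. (elem_proc (e k) x - K x)\<^sup>2 \<partial>Q) \<longlonglongrightarrow> 0 \<and>
       (\<lambda>k. \<integral>\<omega>. (elem_int (e k) \<omega> - I \<omega>)\<^sup>2 \<partial>P) \<longlonglongrightarrow> 0)"

lemma ito_pair_isometry:
  assumes "ito_pair K I"
  shows "(\<integral>\<omega>. (I \<omega>)\<^sup>2 \<partial>P) = (\<integral>x. (K x)\<^sup>2 \<partial>Q)"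
proof -
  obtain e where e: "\<And>k. elem (e k)" and K: "(\<lambda>k::nat. \<integral>x. (elem_proc (e k) x - K x)\<^sup>2 \<partial>Q) \<longlonglongrightarrow> 0"
    and I: "(\<lambda>k. \<integral>\<omega>. (elem_int (e k) \<omega> - I \<omega>)\<^sup>2 \<partial>P) \<longlonglongrightarrow> 0"
    and m: "K \<in> borel_measurable Q" "integrable Q (\<lambda>x. (K x)\<^sup>2)" "I \<in> borel_measurable P" "integrable P (\<lambda>\<omega>. (I \<omega>)\<^sup>2)"
    using assms by (auto simp: ito_pair_def)
  have "(\<lambda>k. \<integral>x. (elem_proc (e k) x)\<^sup>2 \<partial>Q) \<longlonglongrightarrow> (\<integral>x. (K x)\<^sup>2 \<partial>Q)"
    by (rule L2_limit_integral_sq[OF elem_L2(3,4)[OF e] m(1,2) K])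
  moreover have "(\<lambda>k. \<integral>\<omega>. (elem_int (e k) \<omega>)\<^sup>2 \<partial>P) \<longlonglongrightarrow> (\<integral>\<omega>. (I \<omega>)\<^sup>2 \<partial>P)"
    by (rule L2_limit_integral_sq[OF elem_L2(1,2)[OF e] m(3,4) I])
  ultimately show ?thesis
    unfolding elem_L2(5)[OF e] by (metis LIMSEQ_unique)
qed

lemma ito_pair_mean:
  assumes "ito_pair K I"
  shows "integrable P I" "(\<integral>\<omega>. I \<omega> \<partial>P) = 0"
proof -
  obtain e where e: "\<And>k. elem (e k)"
    and I: "(\<lambda>k::nat. \<integral>\<omega>. (elem_int (e k) \<omega> - I \<omega>)\<^sup>2 \<partial>P) \<longlonglongrightarrow> 0"
    and m: "I \<in> borel_measurable P" "integrable P (\<lambda>\<omega>. (I \<omega>)\<^sup>2)"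
    using assms by (auto simp: ito_pair_def)
  show i: "integrable P I" by (rule P.square_integrable_imp_integrable[OF m])
  have "(\<lambda>k. \<integral>\<omega>. I \<omega> \<partial>P) \<longlonglongrightarrow> 0"
  proof (rule Lim_null_comparison)
    show "\<forall>\<^sub>F k in sequentially. norm (\<integral>\<omega>. I \<omega> \<partial>P) \<le> sqrt (\<integral>\<omega>. (elem_int (e k) \<omega> - I \<omega>)\<^sup>2 \<partial>P)"
    proof (rule always_eventually, rule allI)
      fix k
      have d: "integrable P (\<lambda>\<omega>. (elem_int (e k) \<omega> - I \<omega>)\<^sup>2)" "(\<lambda>\<omega>. elem_int (e k) \<omega> - I \<omega>) \<in> borel_measurable P"
        using elem_L2(1,2)[OF e] m by (auto intro!: integrable_diff_L2)
      have "\<bar>\<integral>\<omega>. (elem_int (e k) \<omega> - I \<omega>) * 1 \<partial>P\<bar> \<le> sqrt (\<integral>\<omega>. (elem_int (e k) \<omega> - I \<omega>)\<^sup>2 \<partial>P) * sqrt (\<integral>\<omega>. 1\<^sup>2 \<partial>P)"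
        by (rule Cauchy_Schwarz_integral[OF d(2,1)]) auto
      then show "norm (\<integral>\<omega>. I \<omega> \<partial>P) \<le> sqrt (\<integral>\<omega>. (elem_int (e k) \<omega> - I \<omega>)\<^sup>2 \<partial>P)"
        using elem_L2(6,7)[OF e] i by (simp add: prob_space)
    qed
    show "(\<lambda>k. sqrt (\<integral>\<omega>. (elem_int (e k) \<omega> - I \<omega>)\<^sup>2 \<partial>P)) \<longlonglongrightarrow> 0"
      using tendsto_real_sqrt[OF I] by simp
  qed
  then show "(\<integral>\<omega>. I \<omega> \<partial>P) = 0" by (simp add: LIMSEQ_const_iff)
qed

end

lemma integral_sq_add_le:
  fixes f g :: "'a \<Rightarrow> real"
  assumes "f \<in> borel_measurable M" "integrable M (\<lambda>x. (f x)\<^sup>2)"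
    and "g \<in> borel_measurable M" "integrable M (\<lambda>x. (g x)\<^sup>2)"
  shows "(\<integral>x. (f x - g x)\<^sup>2 \<partial>M) \<le> 2 * (\<integral>x. (f x)\<^sup>2 \<partial>M) + 2 * (\<integral>x. (g x)\<^sup>2 \<partial>M)"
proof -
  have "(\<integral>x. (f x - g x)\<^sup>2 \<partial>M) \<le> (\<integral>x. 2 * (f x)\<^sup>2 + 2 * (g x)\<^sup>2 \<partial>M)"
  proof (rule integral_mono)
    show "integrable M (\<lambda>x. (f x - g x)\<^sup>2)" using assms by (rule integrable_diff_L2)
    show "(f x - g x)\<^sup>2 \<le> 2 * (f x)\<^sup>2 + 2 * (g x)\<^sup>2" for x
      using zero_le_power2[of "f x + g x"] by (simp add: power2_eq_square algebra_simps)
  qed (use assms in auto)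
  then show ?thesis using assms by simp
qed

context brownian
begin

lemma ito_pair_diff:
  assumes "ito_pair K I" "ito_pair K' I'"
  shows "ito_pair (\<lambda>x. K x - K' x) (\<lambda>\<omega>. I \<omega> - I' \<omega>)"
proof -
  obtain e where e: "\<And>k. elem (e k)" and K: "(\<lambda>k::nat. \<integral>x. (elem_proc (e k) x - K x)\<^sup>2 \<partial>Q) \<longlonglongrightarrow> 0"
    and I: "(\<lambda>k. \<integral>\<omega>. (elem_int (e k) \<omega> - I \<omega>)\<^sup>2 \<partial>P) \<longlonglongrightarrow> 0"
    and m: "K \<in> borel_measurable Q" "integrable Q (\<lambda>x. (K x)\<^sup>2)" "I \<in> borel_measurable P" "integrable P (\<lambda>\<omega>. (I \<omega>)\<^sup>2)"
    using assms(1) by (auto simp: ito_pair_def)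
  obtain e' where e': "\<And>k. elem (e' k)" and K': "(\<lambda>k::nat. \<integral>x. (elem_proc (e' k) x - K' x)\<^sup>2 \<partial>Q) \<longlonglongrightarrow> 0"
    and I': "(\<lambda>k. \<integral>\<omega>. (elem_int (e' k) \<omega> - I' \<omega>)\<^sup>2 \<partial>P) \<longlonglongrightarrow> 0"
    and m': "K' \<in> borel_measurable Q" "integrable Q (\<lambda>x. (K' x)\<^sup>2)" "I' \<in> borel_measurable P" "integrable P (\<lambda>\<omega>. (I' \<omega>)\<^sup>2)"
    using assms(2) by (auto simp: ito_pair_def)
  define neg where "neg = map (\<lambda>(a::real, b::real, \<xi>::'a \<Rightarrow> real). (a, b, \<lambda>\<omega>. - \<xi> \<omega>))"
  have neg: "elem_int (e @ neg e') \<omega> = elem_int e \<omega> - elem_int e' \<omega>"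
    "elem_proc (e @ neg e') x = elem_proc e x - elem_proc e' x" for e e' \<omega> x
    unfolding elem_int_def elem_proc_def neg_def
    by (induction e') (auto simp: step_int_def step_proc_def)
  have el: "elem (e k @ neg (e' k))" for k
    using e[of k] e'[of k] by (fastforce simp: neg_def valid_step_def)
  show ?thesis unfolding ito_pair_def
  proof (intro conjI exI[of _ "\<lambda>k. e k @ neg (e' k)"] allI)
    show "elem (e k @ neg (e' k))" for k by (rule el)
    show "(\<lambda>k. \<integral>x. (elem_proc (e k @ neg (e' k)) x - (K x - K' x))\<^sup>2 \<partial>Q) \<longlonglongrightarrow> 0"
    proof (rule tendsto_sandwich[OF _ _ tendsto_const])
      show "(\<lambda>k. 2 * (\<integral>x. (elem_proc (e k) x - K x)\<^sup>2 \<partial>Q) + 2 * (\<integral>x. (elem_proc (e' k) x - K' x)\<^sup>2 \<partial>Q)) \<longlonglongrightarrow> 0"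
        using tendsto_add[OF tendsto_mult_left[OF K] tendsto_mult_left[OF K']] by simp
      have "(\<integral>x. (elem_proc (e k @ neg (e' k)) x - (K x - K' x))\<^sup>2 \<partial>Q)
        \<le> 2 * (\<integral>x. (elem_proc (e k) x - K x)\<^sup>2 \<partial>Q) + 2 * (\<integral>x. (elem_proc (e' k) x - K' x)\<^sup>2 \<partial>Q)" for k
      proof -
        have "(\<integral>x. ((elem_proc (e k) x - K x) - (elem_proc (e' k) x - K' x))\<^sup>2 \<partial>Q)
          \<le> 2 * (\<integral>x. (elem_proc (e k) x - K x)\<^sup>2 \<partial>Q) + 2 * (\<integral>x. (elem_proc (e' k) x - K' x)\<^sup>2 \<partial>Q)"
          using elem_L2(3,4)[OF e] elem_L2(3,4)[OF e'] m m'
          by (intro integral_sq_add_le integrable_diff_L2 borel_measurable_diff)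
        then show ?thesis by (simp add: neg algebra_simps)
      qed
      then show "\<forall>\<^sub>F k in sequentially. (\<integral>x. (elem_proc (e k @ neg (e' k)) x - (K x - K' x))\<^sup>2 \<partial>Q)
        \<le> 2 * (\<integral>x. (elem_proc (e k) x - K x)\<^sup>2 \<partial>Q) + 2 * (\<integral>x. (elem_proc (e' k) x - K' x)\<^sup>2 \<partial>Q)"
        by simp
    qed simp
    show "(\<lambda>k. \<integral>\<omega>. (elem_int (e k @ neg (e' k)) \<omega> - (I \<omega> - I' \<omega>))\<^sup>2 \<partial>P) \<longlonglongrightarrow> 0"
    proof (rule tendsto_sandwich[OF _ _ tendsto_const])
      show "(\<lambda>k. 2 * (\<integral>\<omega>. (elem_int (e k) \<omega> - I \<omega>)\<^sup>2 \<partial>P) + 2 * (\<integral>\<omega>. (elem_int (e' k) \<omega> - I' \<omega>)\<^sup>2 \<partial>P)) \<longlonglongrightarrow> 0"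
        using tendsto_add[OF tendsto_mult_left[OF I] tendsto_mult_left[OF I']] by simp
      have "(\<integral>\<omega>. (elem_int (e k @ neg (e' k)) \<omega> - (I \<omega> - I' \<omega>))\<^sup>2 \<partial>P)
        \<le> 2 * (\<integral>\<omega>. (elem_int (e k) \<omega> - I \<omega>)\<^sup>2 \<partial>P) + 2 * (\<integral>\<omega>. (elem_int (e' k) \<omega> - I' \<omega>)\<^sup>2 \<partial>P)" for k
      proof -
        have "(\<integral>\<omega>. ((elem_int (e k) \<omega> - I \<omega>) - (elem_int (e' k) \<omega> - I' \<omega>))\<^sup>2 \<partial>P)
          \<le> 2 * (\<integral>\<omega>. (elem_int (e k) \<omega> - I \<omega>)\<^sup>2 \<partial>P) + 2 * (\<integral>\<omega>. (elem_int (e' k) \<omega> - I' \<omega>)\<^sup>2 \<partial>P)"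
          using elem_L2(1,2)[OF e] elem_L2(1,2)[OF e'] m m'
          by (intro integral_sq_add_le integrable_diff_L2 borel_measurable_diff)
        then show ?thesis by (simp add: neg algebra_simps)
      qed
      then show "\<forall>\<^sub>F k in sequentially. (\<integral>\<omega>. (elem_int (e k @ neg (e' k)) \<omega> - (I \<omega> - I' \<omega>))\<^sup>2 \<partial>P)
        \<le> 2 * (\<integral>\<omega>. (elem_int (e k) \<omega> - I \<omega>)\<^sup>2 \<partial>P) + 2 * (\<integral>\<omega>. (elem_int (e' k) \<omega> - I' \<omega>)\<^sup>2 \<partial>P)"
        by simp
    qed simp
  qed (use m m' integrable_diff_L2 in auto)
qed

text \<open>A factor known at r may enter the integrand once nothing of it lies before r. The
  approximants of \<open>K\<close> need not vanish up to r, so each is split: \<open>clip\<close>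
  keeps the part after r and multiplies it by \<open>z\<close>, \<open>cut\<close> keeps the part up
  to r. As \<open>K\<close> vanishes there, the cut parts are dominated by the approximation error,
  and by the isometry their integrals tend to 0.\<close>

lemma ito_pair_mult:
  assumes KI: "ito_pair K I" and r: "0 \<le> r" and K0: "\<And>\<omega> u. u \<le> r \<Longrightarrow> K (\<omega>, u) = 0"
    and z: "z \<in> borel_measurable (F r)" and C: "\<And>\<omega>. \<omega> \<in> space M \<Longrightarrow> \<bar>z \<omega>\<bar> \<le> C"
  shows "ito_pair (\<lambda>x. z (fst x) * K x) (\<lambda>\<omega>. z \<omega> * I \<omega>)"
proof -
  obtain e where e: "\<And>k. elem (e k)" and K: "(\<lambda>k::nat. \<integral>x. (elem_proc (e k) x - K x)\<^sup>2 \<partial>Q) \<longlonglongrightarrow> 0"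
    and I: "(\<lambda>k. \<integral>\<omega>. (elem_int (e k) \<omega> - I \<omega>)\<^sup>2 \<partial>P) \<longlonglongrightarrow> 0"
    and m: "K \<in> borel_measurable Q" "integrable Q (\<lambda>x. (K x)\<^sup>2)" "I \<in> borel_measurable P" "integrable P (\<lambda>\<omega>. (I \<omega>)\<^sup>2)"
    using KI by (auto simp: ito_pair_def)
  note [measurable] = measurable_P[OF z] m(1,3)
  define clip where "clip = map (\<lambda>(a, b, \<xi>). (max a r, max b r, \<lambda>\<omega>. z \<omega> * \<xi> \<omega>))"
  \<comment> \<open>A step that starts at or after r collapses to the point r; its coefficient need
    not be known at r and is therefore replaced by 0.\<close>
  define cut where "cut = map (\<lambda>(a, b, \<xi>::'a \<Rightarrow> real). (min a r, min b r, \<lambda>\<omega>. if a < r then \<xi> \<omega> else 0))"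
  have elem_clip: "elem (clip (e k))" for k
  proof
    fix p assume "p \<in> set (clip (e k))"
    then obtain a b \<xi> where p: "p = (max a r, max b r, \<lambda>\<omega>. z \<omega> * \<xi> \<omega>)" "(a, b, \<xi>) \<in> set (e k)"
      by (auto simp: clip_def)
    then have v: "0 \<le> a" "a \<le> b" "\<xi> \<in> borel_measurable (F a)" and "\<exists>D. \<forall>\<omega>\<in>space M. \<bar>\<xi> \<omega>\<bar> \<le> D"
      using e[of k] by (auto simp: valid_step_def)
    then obtain D where D: "\<And>\<omega>. \<omega> \<in> space M \<Longrightarrow> \<bar>\<xi> \<omega>\<bar> \<le> D" by auto
    have "\<bar>z \<omega> * \<xi> \<omega>\<bar> \<le> C * D" if "\<omega> \<in> space M" for \<omega>
      unfolding abs_mult using C[OF that] D[OF that] by (intro mult_mono) auto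
    moreover have "(\<lambda>\<omega>. z \<omega> * \<xi> \<omega>) \<in> borel_measurable (F (max a r))"
      using measurable_usual_augmentation_mono[OF z, of "max a r"] measurable_usual_augmentation_mono[OF v(3), of "max a r"]
      by (intro borel_measurable_times) auto
    ultimately show "valid_step p"
      unfolding p valid_step_def using r v by auto
  qed
  have elem_cut: "elem (cut (e k))" for k
  proof
    fix p assume "p \<in> set (cut (e k))"
    then obtain a b \<xi> where p: "p = (min a r, min b r, \<lambda>\<omega>. if a < r then \<xi> \<omega> else 0)" "(a, b, \<xi>) \<in> set (e k)"
      by (auto simp: cut_def)
    then have v: "0 \<le> a" "a \<le> b" "\<xi> \<in> borel_measurable (F a)" and "\<exists>D. \<forall>\<omega>\<in>space M. \<bar>\<xi> \<omega>\<bar> \<le> D"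
      using e[of k] by (auto simp: valid_step_def)
    then obtain D where D: "\<And>\<omega>. \<omega> \<in> space M \<Longrightarrow> \<bar>\<xi> \<omega>\<bar> \<le> D" by auto
    show "valid_step p"
      unfolding p valid_step_def using r v D by (cases "a < r") (auto simp: min_def)
  qed
  have proc_clip: "elem_proc (clip e) x = z (fst x) * (indicator {r<..} (snd x) * elem_proc e x)" for e x
    unfolding elem_proc_def clip_def
    by (induction e) (auto simp: step_proc_def distrib_left split: split_indicator)
  have proc_cut: "elem_proc (cut e) x = indicator {..r} (snd x) * elem_proc e x" for e x
    unfolding elem_proc_def cut_def
    by (induction e) (auto simp: step_proc_def distrib_left split: split_indicator)
  have int_clip: "elem e \<Longrightarrow> elem_int (clip e) \<omega> = z \<omega> * (elem_int e \<omega> - elem_int (cut e) \<omega>)" for e \<omega>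
    unfolding elem_int_def clip_def cut_def
  proof (induction e)
    case (Cons p e)
    obtain a b \<xi> where p: "p = (a, b, \<xi>)" by (cases p)
    have "a \<le> b" using Cons.prems by (simp add: p valid_step_def)
    then consider "r \<le> a" "r \<le> b" | "a < r" "r \<le> b" | "a < r" "b < r" by linarith
    then have "step_int (max a r, max b r, \<lambda>\<omega>. z \<omega> * \<xi> \<omega>) \<omega> =
      z \<omega> * (step_int p \<omega> - step_int (min a r, min b r, \<lambda>\<omega>. if a < r then \<xi> \<omega> else 0) \<omega>)"
      by cases (auto simp: p step_int_def algebra_simps)
    with Cons show ?case by (simp add: p algebra_simps)
  qed auto
  have zC: "(z \<omega>)\<^sup>2 \<le> C\<^sup>2" if "\<omega> \<in> space M" for \<omega>
    using C[OF that] by (rule abs_le_square_iff[THEN iffD1, OF order_trans]) simp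
  have dP: "integrable P (\<lambda>\<omega>. (elem_int (e k) \<omega> - I \<omega>)\<^sup>2)" "(\<lambda>\<omega>. elem_int (e k) \<omega> - I \<omega>) \<in> borel_measurable P" for k
    using elem_L2(1,2)[OF e] m by (auto intro!: integrable_diff_L2)
  have dQ: "integrable Q (\<lambda>x. (elem_proc (e k) x - K x)\<^sup>2)" "(\<lambda>x. elem_proc (e k) x - K x) \<in> borel_measurable Q" for k
    using elem_L2(3,4)[OF e] m by (auto intro!: integrable_diff_L2)
  have zK: "(\<lambda>x. z (fst x) * K x) \<in> borel_measurable Q" by measurable
  have zI: "(\<lambda>\<omega>. z \<omega> * I \<omega>) \<in> borel_measurable P" by measurable
  have zK2: "integrable Q (\<lambda>x. (z (fst x) * K x)\<^sup>2)"
  proof (rule Bochner_Integration.integrable_bound)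
    show "integrable Q (\<lambda>x. C\<^sup>2 * (K x)\<^sup>2)" using m by simp
    show "AE x in Q. norm ((z (fst x) * K x)\<^sup>2) \<le> norm (C\<^sup>2 * (K x)\<^sup>2)"
      by (intro AE_I2) (auto simp: power_mult_distrib space_pair_measure intro!: mult_right_mono zC)
  qed (use zK in measurable)
  have zI2: "integrable P (\<lambda>\<omega>. (z \<omega> * I \<omega>)\<^sup>2)"
  proof (rule Bochner_Integration.integrable_bound)
    show "integrable P (\<lambda>\<omega>. C\<^sup>2 * (I \<omega>)\<^sup>2)" using m by simp
    show "AE \<omega> in P. norm ((z \<omega> * I \<omega>)\<^sup>2) \<le> norm (C\<^sup>2 * (I \<omega>)\<^sup>2)"
      by (intro AE_I2) (auto simp: power_mult_distrib intro!: mult_right_mono zC)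
  qed (use zI in measurable)
  have bound_proc: "(\<integral>x. (elem_proc (clip (e k)) x - z (fst x) * K x)\<^sup>2 \<partial>Q) \<le> C\<^sup>2 * (\<integral>x. (elem_proc (e k) x - K x)\<^sup>2 \<partial>Q)" for k
  proof -
    have "(\<integral>x. (elem_proc (clip (e k)) x - z (fst x) * K x)\<^sup>2 \<partial>Q) \<le> (\<integral>x. C\<^sup>2 * (elem_proc (e k) x - K x)\<^sup>2 \<partial>Q)"
    proof (rule integral_mono)
      show "integrable Q (\<lambda>x. (elem_proc (clip (e k)) x - z (fst x) * K x)\<^sup>2)"
        by (rule integrable_diff_L2[OF elem_L2(3,4)[OF elem_clip] zK zK2])
      fix x assume x: "x \<in> space Q"
      have "elem_proc (clip (e k)) x - z (fst x) * K x = z (fst x) * (indicator {r<..} (snd x) * (elem_proc (e k) x - K x))"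
        using K0[of "snd x" "fst x"] unfolding proc_clip by (auto simp: algebra_simps split: split_indicator)
      then have "(elem_proc (clip (e k)) x - z (fst x) * K x)\<^sup>2 = (z (fst x))\<^sup>2 * (indicator {r<..} (snd x) * (elem_proc (e k) x - K x)\<^sup>2)"
        by (auto simp: power_mult_distrib split: split_indicator)
      also have "\<dots> \<le> C\<^sup>2 * (1 * (elem_proc (e k) x - K x)\<^sup>2)"
        using x by (intro mult_mono zC) (auto simp: space_pair_measure split: split_indicator)
      finally show "(elem_proc (clip (e k)) x - z (fst x) * K x)\<^sup>2 \<le> C\<^sup>2 * (elem_proc (e k) x - K x)\<^sup>2" by simp
    qed (use dQ in auto)
    then show ?thesis by simp
  qed
  have bound_cut: "(\<integral>\<omega>. (elem_int (cut (e k)) \<omega>)\<^sup>2 \<partial>P) \<le> (\<integral>x. (elem_proc (e k) x - K x)\<^sup>2 \<partial>Q)" for k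
    unfolding elem_L2(5)[OF elem_cut]
  proof (rule integral_mono)
    show "integrable Q (\<lambda>x. (elem_proc (cut (e k)) x)\<^sup>2)" by (rule elem_L2(4)[OF elem_cut])
    show "integrable Q (\<lambda>x. (elem_proc (e k) x - K x)\<^sup>2)" by (rule dQ)
    show "(elem_proc (cut (e k)) x)\<^sup>2 \<le> (elem_proc (e k) x - K x)\<^sup>2" for x
      using K0[of "snd x" "fst x"] unfolding proc_cut by (auto split: split_indicator)
  qed
  have bound_int: "(\<integral>\<omega>. (elem_int (clip (e k)) \<omega> - z \<omega> * I \<omega>)\<^sup>2 \<partial>P) \<le>
      C\<^sup>2 * (2 * (\<integral>\<omega>. (elem_int (e k) \<omega> - I \<omega>)\<^sup>2 \<partial>P) + 2 * (\<integral>x. (elem_proc (e k) x - K x)\<^sup>2 \<partial>Q))" for k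
  proof -
    have d: "integrable P (\<lambda>\<omega>. (elem_int (e k) \<omega> - I \<omega> - elem_int (cut (e k)) \<omega>)\<^sup>2)"
      by (rule integrable_diff_L2[OF dP(2,1) elem_L2(1,2)[OF elem_cut]])
    have "(\<integral>\<omega>. (elem_int (clip (e k)) \<omega> - z \<omega> * I \<omega>)\<^sup>2 \<partial>P) \<le> (\<integral>\<omega>. C\<^sup>2 * (elem_int (e k) \<omega> - I \<omega> - elem_int (cut (e k)) \<omega>)\<^sup>2 \<partial>P)"
    proof (rule integral_mono)
      show "integrable P (\<lambda>\<omega>. (elem_int (clip (e k)) \<omega> - z \<omega> * I \<omega>)\<^sup>2)"
        by (rule integrable_diff_L2[OF elem_L2(1,2)[OF elem_clip] zI zI2])
      fix \<omega> assume "\<omega> \<in> space P"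
      then have w: "\<omega> \<in> space M" by simp
      have "elem_int (clip (e k)) \<omega> - z \<omega> * I \<omega> = z \<omega> * (elem_int (e k) \<omega> - I \<omega> - elem_int (cut (e k)) \<omega>)"
        unfolding int_clip[OF e] by (simp add: algebra_simps)
      then show "(elem_int (clip (e k)) \<omega> - z \<omega> * I \<omega>)\<^sup>2 \<le> C\<^sup>2 * (elem_int (e k) \<omega> - I \<omega> - elem_int (cut (e k)) \<omega>)\<^sup>2"
        using zC[OF w] by (simp add: power_mult_distrib mult_right_mono)
    qed (use d in auto)
    also have "\<dots> \<le> C\<^sup>2 * (2 * (\<integral>\<omega>. (elem_int (e k) \<omega> - I \<omega>)\<^sup>2 \<partial>P) + 2 * (\<integral>\<omega>. (elem_int (cut (e k)) \<omega>)\<^sup>2 \<partial>P))"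
      using integral_sq_add_le[OF dP(2,1) elem_L2(1,2)[OF elem_cut]] by (simp add: mult_left_mono)
    also have "\<dots> \<le> C\<^sup>2 * (2 * (\<integral>\<omega>. (elem_int (e k) \<omega> - I \<omega>)\<^sup>2 \<partial>P) + 2 * (\<integral>x. (elem_proc (e k) x - K x)\<^sup>2 \<partial>Q))"
      using bound_cut[of k] by (intro mult_left_mono) auto
    finally show ?thesis .
  qed
  show ?thesis unfolding ito_pair_def
  proof (intro conjI exI[of _ "\<lambda>k. clip (e k)"] allI zK zI zK2 zI2)
    show "elem (clip (e k))" for k by (rule elem_clip)
    show "(\<lambda>k. \<integral>x. (elem_proc (clip (e k)) x - z (fst x) * K x)\<^sup>2 \<partial>Q) \<longlonglongrightarrow> 0"
    proof (rule tendsto_sandwich[OF _ _ tendsto_const])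
      show "(\<lambda>k. C\<^sup>2 * (\<integral>x. (elem_proc (e k) x - K x)\<^sup>2 \<partial>Q)) \<longlonglongrightarrow> 0"
        using tendsto_mult_left[OF K] by simp
    qed (use bound_proc in auto)
    show "(\<lambda>k. \<integral>\<omega>. (elem_int (clip (e k)) \<omega> - z \<omega> * I \<omega>)\<^sup>2 \<partial>P) \<longlonglongrightarrow> 0"
    proof (rule tendsto_sandwich[OF _ _ tendsto_const])
      show "(\<lambda>k. C\<^sup>2 * (2 * (\<integral>\<omega>. (elem_int (e k) \<omega> - I \<omega>)\<^sup>2 \<partial>P) + 2 * (\<integral>x. (elem_proc (e k) x - K x)\<^sup>2 \<partial>Q))) \<longlonglongrightarrow> 0"
        using tendsto_mult_left[OF tendsto_add[OF tendsto_mult_left[OF I, of 2] tendsto_mult_left[OF K, of 2]], of "C\<^sup>2"] by simp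
    qed (use bound_int in auto)
  qed
qed

text \<open>\<open>is_ito_integral\<close> does not ask its integrand to be jointly measurable;
  \<open>K\<close> is a bounded, jointly measurable copy that agrees with it on [0, T] almost
  surely. Steps are left-open, hence the indicator of (0, T].\<close>

lemma is_ito_integral_imp_ito_pair:
  assumes ito: "is_ito_integral P (usual_augmentation M B) B K0 T I" and T: "0 \<le> T"
    and K: "K \<in> borel_measurable Q" and KC: "\<And>x. \<bar>K x\<bar> \<le> C"
    and eq: "AE \<omega> in P. \<forall>s\<in>{0..T}. K0 s \<omega> = K (\<omega>, s)"
    and I2: "integrable P (\<lambda>\<omega>. (I \<omega>)\<^sup>2)"
  shows "ito_pair (\<lambda>x. K x * indicator {0<..T} (snd x)) I"
proof -
  note [measurable] = K
  from ito obtain n t \<xi> where I: "I \<in> borel_measurable P" and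
    simple: "\<And>k. simple_integrand (usual_augmentation M B) (n k) (t k) (\<xi> k)" and
    procs: "(\<lambda>k::nat. \<integral>\<^sup>+\<omega>. (\<integral>\<^sup>+s\<in>{0..T}.
            ennreal ((simple_process (n k) (t k) (\<xi> k) s \<omega> - K0 s \<omega>)\<^sup>2) \<partial>lborel) \<partial>P) \<longlonglongrightarrow> 0" and
    ints: "(\<lambda>k. \<integral>\<^sup>+\<omega>. ennreal ((simple_integral B (n k) (t k) (\<xi> k) T \<omega> - I \<omega>)\<^sup>2) \<partial>P) \<longlonglongrightarrow> 0"
    unfolding is_ito_integral_def by blast
  let ?K = "\<lambda>x. K x * indicator {0<..T} (snd x)"
  have Km: "?K \<in> borel_measurable Q" by measurable
  have K2: "integrable Q (\<lambda>x. (?K x)\<^sup>2)"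
  proof (rule Bochner_Integration.integrable_bound)
    have "integrable lborel (indicator {0<..T} :: real \<Rightarrow> real)"
      using T by (intro integrable_real_indicator) auto
    then show "integrable Q (\<lambda>x. (\<lambda>_. C\<^sup>2) (fst x) * indicator {0<..T} (snd x))"
      by (intro PQ.product_mult_integral(1)) auto
    have "(K x)\<^sup>2 \<le> C\<^sup>2" for x
      using KC[of x] by (rule abs_le_square_iff[THEN iffD1, OF order_trans]) simp
    then show "AE x in Q. norm ((?K x)\<^sup>2) \<le> norm (C\<^sup>2 * indicator {0<..T} (snd x) :: real)"
      by (intro AE_I2) (auto split: split_indicator)
  qed (use Km in measurable)
  \<comment> \<open>Steps are truncated at T. One that starts at or after T becomes empty and gets
    coefficient 0, since its own coefficient need not be known at T.\<close>
  define e where "e k = map (\<lambda>i. (min (t k i) T, min (t k (Suc i)) T, \<lambda>\<omega>. if t k i < T then \<xi> k i \<omega> else 0)) [0..<n k]" for k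
  have t0: "0 \<le> t k i" if "i \<le> n k" for k i
    using that
  proof (induction i)
    case 0 then show ?case using simple[of k] by (simp add: simple_integrand_def)
  next
    case (Suc i)
    then show ?case using simple[of k] by (auto simp: simple_integrand_def intro: order_trans)
  qed
  have el: "elem (e k)" for k
  proof
    fix p assume "p \<in> set (e k)"
    then obtain i where i: "i < n k" and p: "p = (min (t k i) T, min (t k (Suc i)) T, \<lambda>\<omega>. if t k i < T then \<xi> k i \<omega> else 0)"
      by (auto simp: e_def)
    have v: "0 \<le> t k i" "t k i \<le> t k (Suc i)" "\<xi> k i \<in> borel_measurable (F (t k i))"
      "\<exists>C. \<forall>\<omega>\<in>space M. \<bar>\<xi> k i \<omega>\<bar> \<le> C"
      using simple[of k] i t0[of i k] by (auto simp: simple_integrand_def)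
    then show "valid_step p"
      unfolding p valid_step_def using T by (cases "t k i < T") (auto simp: min_def)
  qed
  have el_int: "elem_int (e k) \<omega> = simple_integral B (n k) (t k) (\<xi> k) T \<omega>" for k \<omega>
  proof -
    have "elem_int (e k) \<omega> = (\<Sum>i<n k. step_int (min (t k i) T, min (t k (Suc i)) T, \<lambda>\<omega>. if t k i < T then \<xi> k i \<omega> else 0) \<omega>)"
      unfolding elem_int_def e_def by (simp add: comp_def interv_sum_list_conv_sum_set_nat atLeast0LessThan)
    also have "\<dots> = simple_integral B (n k) (t k) (\<xi> k) T \<omega>"
      unfolding simple_integral_def
    proof (rule sum.cong)
      fix i assume "i \<in> {..<n k}"
      then have "t k i \<le> t k (Suc i)" using simple[of k] by (simp add: simple_integrand_def)
      then show "step_int (min (t k i) T, min (t k (Suc i)) T, \<lambda>\<omega>. if t k i < T then \<xi> k i \<omega> else 0) \<omega> =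
         \<xi> k i \<omega> * (B (min (t k (Suc i)) T) \<omega> - B (min (t k i) T) \<omega>)"
        by (auto simp: step_int_def)
    qed simp
    finally show ?thesis .
  qed
  have el_proc: "elem_proc (e k) x = simple_process (n k) (t k) (\<xi> k) (snd x) (fst x) * indicator {0<..T} (snd x)" for k x
  proof -
    have "elem_proc (e k) x = (\<Sum>i<n k. step_proc (min (t k i) T, min (t k (Suc i)) T, \<lambda>\<omega>. if t k i < T then \<xi> k i \<omega> else 0) x)"
      unfolding elem_proc_def e_def by (simp add: comp_def interv_sum_list_conv_sum_set_nat atLeast0LessThan)
    also have "\<dots> = (\<Sum>i<n k. (\<xi> k i (fst x) * indicator {t k i<..t k (Suc i)} (snd x)) * indicator {0<..T} (snd x))"
    proof (rule sum.cong)
      fix i assume i: "i \<in> {..<n k}"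
      then have "t k i \<le> t k (Suc i)" using simple[of k] by (simp add: simple_integrand_def)
      then show "step_proc (min (t k i) T, min (t k (Suc i)) T, \<lambda>\<omega>. if t k i < T then \<xi> k i \<omega> else 0) x =
         (\<xi> k i (fst x) * indicator {t k i<..t k (Suc i)} (snd x)) * indicator {0<..T} (snd x)"
        using t0[of i k] i by (auto simp: step_proc_def split: split_indicator)
    qed simp
    finally show ?thesis unfolding simple_process_def sum_distrib_right .
  qed
  \<comment> \<open>Some terms may be infinite. The Bochner integral and \<open>enn2real\<close>
    both give 0 in that case, so the equality below holds for every k.\<close>
  have to_real: "(\<lambda>k. \<integral>x. (f k x)\<^sup>2 \<partial>N) \<longlonglongrightarrow> 0"
    if "\<And>k. f k \<in> borel_measurable N" "(\<lambda>k. \<integral>\<^sup>+x. ennreal ((f k x)\<^sup>2) \<partial>N) \<longlonglongrightarrow> 0"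
    for f :: "nat \<Rightarrow> 'z \<Rightarrow> real" and N
  proof -
    have "(\<integral>x. (f k x)\<^sup>2 \<partial>N) = enn2real (\<integral>\<^sup>+x. ennreal ((f k x)\<^sup>2) \<partial>N)" for k
      using that(1)[of k] by (intro integral_eq_nn_integral) auto
    then show ?thesis using tendsto_enn2real[OF that(2)[folded ennreal_0]] by simp
  qed
  show ?thesis unfolding ito_pair_def
  proof (intro conjI exI[of _ e] allI Km K2 I I2)
    show "elem (e k)" for k by (rule el)
    show "(\<lambda>k. \<integral>\<omega>. (elem_int (e k) \<omega> - I \<omega>)\<^sup>2 \<partial>P) \<longlonglongrightarrow> 0"
    proof (rule to_real)
      show "(\<lambda>\<omega>. elem_int (e k) \<omega> - I \<omega>) \<in> borel_measurable P" for k
        using elem_L2(1)[OF el] I by (rule borel_measurable_diff)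
    qed (use ints in \<open>simp add: el_int\<close>)
    show "(\<lambda>k. \<integral>x. (elem_proc (e k) x - ?K x)\<^sup>2 \<partial>Q) \<longlonglongrightarrow> 0"
    proof (rule to_real)
      show "(\<lambda>x. elem_proc (e k) x - ?K x) \<in> borel_measurable Q" for k
        using elem_L2(3)[OF el] Km by (rule borel_measurable_diff)
      show "(\<lambda>k. \<integral>\<^sup>+x. ennreal ((elem_proc (e k) x - ?K x)\<^sup>2) \<partial>Q) \<longlonglongrightarrow> 0"
      proof (rule tendsto_sandwich[OF _ _ tendsto_const procs])
        have "(\<integral>\<^sup>+x. ennreal ((elem_proc (e k) x - ?K x)\<^sup>2) \<partial>Q) \<le> (\<integral>\<^sup>+\<omega>. (\<integral>\<^sup>+s\<in>{0..T}.
            ennreal ((simple_process (n k) (t k) (\<xi> k) s \<omega> - K0 s \<omega>)\<^sup>2) \<partial>lborel) \<partial>P)" for k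
        proof -
          have [measurable]: "elem_proc (e k) \<in> borel_measurable Q" by (rule elem_L2(3)[OF el])
          have "(\<integral>\<^sup>+x. ennreal ((elem_proc (e k) x - ?K x)\<^sup>2) \<partial>Q) =
            (\<integral>\<^sup>+\<omega>. (\<integral>\<^sup>+s. ennreal ((elem_proc (e k) (\<omega>, s) - ?K (\<omega>, s))\<^sup>2) \<partial>lborel) \<partial>P)"
            by (rule lborel.nn_integral_fst[symmetric]) measurable
          also have "\<dots> \<le> (\<integral>\<^sup>+\<omega>. (\<integral>\<^sup>+s\<in>{0..T}.
            ennreal ((simple_process (n k) (t k) (\<xi> k) s \<omega> - K0 s \<omega>)\<^sup>2) \<partial>lborel) \<partial>P)"
          proof (rule nn_integral_mono_AE)
            show "AE \<omega> in P. (\<integral>\<^sup>+s. ennreal ((elem_proc (e k) (\<omega>, s) - ?K (\<omega>, s))\<^sup>2) \<partial>lborel) \<le>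
              (\<integral>\<^sup>+s\<in>{0..T}. ennreal ((simple_process (n k) (t k) (\<xi> k) s \<omega> - K0 s \<omega>)\<^sup>2) \<partial>lborel)"
              using eq
              by eventually_elim (intro nn_integral_mono, auto simp: el_proc split: split_indicator)
          qed
          finally show ?thesis .
        qed
        then show "\<forall>\<^sub>F k in sequentially. (\<integral>\<^sup>+x. ennreal ((elem_proc (e k) x - ?K x)\<^sup>2) \<partial>Q) \<le> (\<integral>\<^sup>+\<omega>. (\<integral>\<^sup>+s\<in>{0..T}.
            ennreal ((simple_process (n k) (t k) (\<xi> k) s \<omega> - K0 s \<omega>)\<^sup>2) \<partial>lborel) \<partial>P)" by simp
      qed simp
    qed
  qed
qed

end

section \<open>Strong solutions as bounded martingales\<close>

text \<open>Rounding time down to multiples of 1/(n + 1) involves only countably many coordinates,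
  so the rounded process is jointly measurable; path continuity carries this to the limit.\<close>

lemma continuous_process_measurable:
  fixes Y :: "real \<Rightarrow> 'a \<Rightarrow> real"
  assumes Y: "\<And>t. Y t \<in> borel_measurable M" and cont: "\<And>\<omega>. \<omega> \<in> space M \<Longrightarrow> continuous_on UNIV (\<lambda>t. Y t \<omega>)"
  shows "(\<lambda>x. Y (snd x) (fst x)) \<in> borel_measurable (M \<Otimes>\<^sub>M lborel)"
proof (rule borel_measurable_LIMSEQ_real)
  let ?g = "\<lambda>n t. real_of_int \<lfloor>real (Suc n) * t\<rfloor> / real (Suc n)"
  show "(\<lambda>x. Y (?g n (snd x)) (fst x)) \<in> borel_measurable (M \<Otimes>\<^sub>M lborel)" for n
    by (rule measurable_compose_countable[where f="\<lambda>i x. Y (real_of_int i / real (Suc n)) (fst x)" and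
          g="\<lambda>x. \<lfloor>real (Suc n) * snd x\<rfloor>"])
       (auto intro!: measurable_compose[OF measurable_fst Y] measurable_compose[OF _ measurable_real_floor])
  fix x assume x: "x \<in> space (M \<Otimes>\<^sub>M (lborel :: real measure))"
  have "(\<lambda>n. ?g n (snd x)) \<longlonglongrightarrow> snd x"
  proof (rule LIM_zero_cancel, rule Lim_null_comparison)
    have "\<bar>?g n (snd x) - snd x\<bar> \<le> 1 / real (Suc n)" for n
    proof -
      have "\<bar>real_of_int \<lfloor>real (Suc n) * snd x\<rfloor> - real (Suc n) * snd x\<bar> \<le> 1" by linarith
      then have "\<bar>real_of_int \<lfloor>real (Suc n) * snd x\<rfloor> - real (Suc n) * snd x\<bar> / real (Suc n) \<le> 1 / real (Suc n)"
        by (rule divide_right_mono) simp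
      also have "\<bar>real_of_int \<lfloor>real (Suc n) * snd x\<rfloor> - real (Suc n) * snd x\<bar> / real (Suc n) = \<bar>?g n (snd x) - snd x\<bar>"
      proof -
        have "?g n (snd x) - snd x = (real_of_int \<lfloor>real (Suc n) * snd x\<rfloor> - real (Suc n) * snd x) / real (Suc n)"
          by (simp add: diff_divide_distrib del: of_nat_Suc)
        then show ?thesis by (simp only: abs_divide abs_of_nat)
      qed
      finally show ?thesis .
    qed
    then show "\<forall>\<^sub>F n in sequentially. norm (?g n (snd x) - snd x) \<le> 1 / real (Suc n)" by simp
    show "(\<lambda>n. 1 / real (Suc n)) \<longlonglongrightarrow> 0" by (rule lim_1_over_n[THEN LIMSEQ_Suc])
  qed
  moreover have "isCont (\<lambda>t. Y t (fst x)) (snd x)"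
    using cont[of "fst x"] x by (auto simp: continuous_on_eq_continuous_at space_pair_measure)
  ultimately show "(\<lambda>n. Y (?g n (snd x)) (fst x)) \<longlonglongrightarrow> Y (snd x) (fst x)"
    by (rule isCont_tendsto_compose[rotated])
qed

text \<open>All that the sequel uses of the diffusion: a martingale in [0, 1] whose bracket has
  density \<open>v (Y u)\<close>, expressed through bounded weights from the past in place of
  conditional expectations. Range, continuity and initial value hold for every \<omega>, so path
  arguments meet no null sets.\<close>

locale bounded_diffusion = prob_space P for P :: "'a measure" +
  fixes F :: "real \<Rightarrow> 'a measure" and Y :: "real \<Rightarrow> 'a \<Rightarrow> real" and v :: "real \<Rightarrow> real" and x :: real
  assumes space_F: "space (F t) = space P"
    and sets_F: "sets (F t) \<subseteq> sets P"
    and sets_F_mono: "s \<le> t \<Longrightarrow> sets (F s) \<subseteq> sets (F t)"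
    and adapted: "0 \<le> t \<Longrightarrow> Y t \<in> borel_measurable (F t)"
    and cont: "continuous_on UNIV (\<lambda>t. Y t \<omega>)"
    and range_Y: "Y t \<omega> \<in> {0..1}"
    and Y_0: "Y 0 \<omega> = x"
    and Y_measurable: "Y t \<in> borel_measurable P"
    and v: "continuous_on {0..1} v"
    and mean: "\<lbrakk>0 \<le> s; s \<le> t; z \<in> borel_measurable (F s); \<And>\<omega>. \<omega> \<in> space P \<Longrightarrow> \<bar>z \<omega>\<bar> \<le> C\<rbrakk> \<Longrightarrow>
       (\<integral>\<omega>. z \<omega> * (Y t \<omega> - Y s \<omega>) \<partial>P) = 0"
    and var: "\<lbrakk>0 \<le> s; s \<le> t; z \<in> borel_measurable (F s); \<And>\<omega>. \<omega> \<in> space P \<Longrightarrow> \<bar>z \<omega>\<bar> \<le> C\<rbrakk> \<Longrightarrow>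
       (\<integral>\<omega>. z \<omega> * (Y t \<omega> - Y s \<omega>)\<^sup>2 \<partial>P) = (\<integral>\<omega>. z \<omega> * integral {s..t} (\<lambda>u. v (Y u \<omega>)) \<partial>P)"

text \<open>\<open>Y\<close> follows \<open>X\<close> on the set \<open>G\<close> of good paths and
  is constantly x elsewhere; at negative times it is frozen at its value at 0. As \<open>G\<close>
  has full measure it belongs to every \<open>F t\<close>, so \<open>Y\<close> remains adapted. The
  two moment identities are the mean and the isometry for the integrand on (s, t] multiplied by a
  weight known at s.\<close>

lemma (in brownian) strong_solution_bounded_diffusion:
  assumes X: "strong_solution M B \<sigma> x X" and \<sigma>: "continuous_on {0..1} \<sigma>" and x: "x \<in> {0..1}"
  obtains Y where "bounded_diffusion P F Y (\<lambda>y. (\<sigma> y)\<^sup>2) x"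
    and "AE \<omega> in P. \<forall>t\<ge>0. Y t \<omega> = X t \<omega>"
proof -
  define G where "G = {\<omega> \<in> space M. X 0 \<omega> = x \<and> continuous_on {0..} (\<lambda>t. X t \<omega>) \<and> (\<forall>t\<ge>0. X t \<omega> \<in> {0..1})}"
  have ad: "X t \<in> borel_measurable (F t)" if "0 \<le> t" for t
    using X that by (auto simp: strong_solution_def)
  have ito: "is_ito_integral P (usual_augmentation M B) B (\<lambda>s \<omega>. \<sigma> (X s \<omega>)) t (\<lambda>\<omega>. X t \<omega> - x)" if "0 \<le> t" for t
    using X that by (auto simp: strong_solution_def)
  have "AE \<omega> in P. \<omega> \<in> space P" by (rule AE_space)
  moreover have "AE \<omega> in P. X 0 \<omega> = x"
    "AE \<omega> in P. continuous_on {0..} (\<lambda>t. X t \<omega>) \<and> (\<forall>t\<ge>0. X t \<omega> \<in> {0..1})"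
    using X by (auto simp: strong_solution_def)
  ultimately have AEG: "AE \<omega> in P. \<omega> \<in> G"
    by eventually_elim (auto simp: G_def)
  then have null: "space M - G \<in> null_sets P"
    unfolding P.AE_iff_null_sets by (rule back_subst[where P="\<lambda>A. A \<in> null_sets P"]) auto
  have GF: "G \<in> sets (usual_augmentation M B t)" for t
  proof -
    have "space M - G \<in> sets (usual_augmentation M B t)"
      unfolding sets_usual_augmentation using null by auto
    then have "space (usual_augmentation M B t) - (space M - G) \<in> sets (usual_augmentation M B t)" by (rule sets.compl_sets)
    also have "space (usual_augmentation M B t) - (space M - G) = G" by (auto simp: G_def)
    finally show ?thesis .
  qed
  define Y where "Y t \<omega> = (if \<omega> \<in> G then X (max t 0) \<omega> else x)" for t \<omega>
  have YX: "AE \<omega> in P. \<forall>t\<ge>0. Y t \<omega> = X t \<omega>"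
    using AEG by eventually_elim (auto simp: Y_def max_def)
  have cont: "continuous_on UNIV (\<lambda>t. Y t \<omega>)" for \<omega>
  proof (cases "\<omega> \<in> G")
    case True
    then have "continuous_on {0..} (\<lambda>t. X t \<omega>)" by (simp add: G_def)
    then have "continuous_on UNIV (\<lambda>t. X (max t 0) \<omega>)"
      by (rule continuous_on_compose2) (auto intro!: continuous_intros)
    then show ?thesis using True by (simp add: Y_def comp_def)
  qed (simp add: Y_def)
  have range_Y: "Y t \<omega> \<in> {0..1}" for t \<omega>
    using x by (auto simp: Y_def G_def)
  have Y0: "Y 0 \<omega> = x" for \<omega> by (simp add: Y_def G_def)
  have adY: "Y t \<in> borel_measurable (F (max t 0))" for t
  proof -
    have "(\<lambda>\<omega>. if \<omega> \<in> G then X (max t 0) \<omega> else x) \<in> borel_measurable (F (max t 0))"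
      by (rule measurable_If_set[OF ad _ sets.Int[OF GF sets.top]]) simp_all
    then show ?thesis by (simp add: Y_def[abs_def])
  qed
  have YP: "Y t \<in> borel_measurable P" for t
    by (rule measurable_P[OF adY])
  have YQ: "(\<lambda>x. Y (snd x) (fst x)) \<in> borel_measurable Q"
    by (rule continuous_process_measurable[OF YP cont])
  \<comment> \<open>Clamping extends \<sigma> continuously from [0, 1] to the line; on the range of
    \<open>Y\<close> nothing changes.\<close>
  have \<sigma>m: "(\<lambda>y. \<sigma> (max 0 (min 1 y))) \<in> borel_measurable borel"
  proof (rule borel_measurable_continuous_onI)
    show "continuous_on UNIV (\<lambda>y. \<sigma> (max 0 (min 1 y)))"
      by (rule continuous_on_compose2[OF \<sigma>]) (auto intro!: continuous_intros)
  qed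
  have clamp: "max 0 (min 1 (Y t \<omega>)) = Y t \<omega>" for t \<omega>
    using range_Y[of t \<omega>] by auto
  define K where "K p = \<sigma> (Y (snd p) (fst p))" for p
  have K: "K \<in> borel_measurable Q"
    using measurable_compose[OF YQ \<sigma>m] by (simp add: clamp K_def[abs_def])
  obtain D where "\<forall>y\<in>{0..1}. \<bar>\<sigma> y\<bar> \<le> D"
    using compact_imp_bounded[OF compact_continuous_image[OF \<sigma> compact_Icc]]
    by (auto simp: bounded_iff)
  then have D: "\<And>y. y \<in> {0..1} \<Longrightarrow> \<bar>\<sigma> y\<bar> \<le> D" by blast
  have KD: "\<bar>K p\<bar> \<le> D" for p unfolding K_def by (rule D[OF range_Y])
  have pair0: "ito_pair (\<lambda>p. K p * indicator {0<..t} (snd p)) (\<lambda>\<omega>. Y t \<omega> - x)" if t: "0 \<le> t" for t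
  proof -
    have Xt: "AE \<omega> in P. X t \<omega> - x = Y t \<omega> - x" using YX t by auto
    have "integrable P (\<lambda>\<omega>. (Y t \<omega> - x)\<^sup>2)"
    proof (rule P.integrable_const_bound[of _ 1])
      have "\<bar>Y t \<omega> - x\<bar> \<le> 1" for \<omega> using range_Y[of t \<omega>] x by auto
      then show "AE \<omega> in P. norm ((Y t \<omega> - x)\<^sup>2) \<le> 1" by (simp add: abs_square_le_1)
    qed (use YP[of t] in measurable)
    moreover have XP: "X t \<in> borel_measurable P" using ad[OF t] by (rule measurable_P)
    ultimately have I2: "integrable P (\<lambda>\<omega>. (X t \<omega> - x)\<^sup>2)"
      using YP[of t] Xt by (subst integrable_cong_AE[where g="\<lambda>\<omega>. (Y t \<omega> - x)\<^sup>2"]) auto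
    have "ito_pair (\<lambda>p. K p * indicator {0<..t} (snd p)) (\<lambda>\<omega>. X t \<omega> - x)"
    proof (rule is_ito_integral_imp_ito_pair[OF ito[OF t] t K KD _ I2])
      show "AE \<omega> in P. \<forall>s\<in>{0..t}. \<sigma> (X s \<omega>) = K (\<omega>, s)"
        using YX by eventually_elim (auto simp: K_def)
    qed
    moreover have "(\<integral>\<omega>. (h \<omega> - (X t \<omega> - x))\<^sup>2 \<partial>P) = (\<integral>\<omega>. (h \<omega> - (Y t \<omega> - x))\<^sup>2 \<partial>P)"
      if "h \<in> borel_measurable P" for h
      using that XP YP[of t] Xt by (intro integral_cong_AE) auto
    moreover have "integrable P (\<lambda>\<omega>. (Y t \<omega> - x)\<^sup>2)" by fact
    ultimately show ?thesis
      unfolding ito_pair_def using YP[of t] elem_L2(1) by (auto cong: conj_cong)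
  qed
  have pair: "ito_pair (\<lambda>p. K p * indicator {s<..t} (snd p)) (\<lambda>\<omega>. Y t \<omega> - Y s \<omega>)" if "0 \<le> s" "s \<le> t" for s t
  proof -
    have "(\<lambda>p. K p * indicator {0<..t} (snd p) - K p * indicator {0<..s} (snd p)) = (\<lambda>p. K p * indicator {s<..t} (snd p))"
      using that by (auto split: split_indicator)
    then show ?thesis
      using ito_pair_diff[OF pair0 pair0, of t s] that by simp
  qed
  have pairz: "ito_pair (\<lambda>p. z (fst p) * (K p * indicator {s<..t} (snd p))) (\<lambda>\<omega>. z \<omega> * (Y t \<omega> - Y s \<omega>))"
    if "0 \<le> s" "s \<le> t" "z \<in> borel_measurable (F s)" "\<And>\<omega>. \<omega> \<in> space P \<Longrightarrow> \<bar>z \<omega>\<bar> \<le> C" for s t z C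
    by (rule ito_pair_mult[OF pair, of s t s z C]) (use that in auto)
  have v_cont: "continuous_on {s..t} (\<lambda>u. (\<sigma> (Y u \<omega>))\<^sup>2)" for s t \<omega>
  proof -
    have "continuous_on {s..t} (\<lambda>u. \<sigma> (Y u \<omega>))"
      by (rule continuous_on_compose2[OF \<sigma> continuous_on_subset[OF cont]]) (use range_Y in blast)+
    then show ?thesis by (rule continuous_on_power)
  qed
  have HK: "(\<integral>u. (c * (\<sigma> (Y u \<omega>) * indicator {s<..t} u))\<^sup>2 \<partial>lborel) = c\<^sup>2 * integral {s..t} (\<lambda>u. (\<sigma> (Y u \<omega>))\<^sup>2)" for c s t \<omega>
  proof -
    have meas: "(\<lambda>u. (\<sigma> (Y u \<omega>))\<^sup>2) \<in> borel_measurable borel"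
    proof (rule borel_measurable_continuous_onI)
      have "continuous_on UNIV (\<lambda>u. \<sigma> (Y u \<omega>))"
        by (rule continuous_on_compose2[OF \<sigma> cont]) (use range_Y in blast)
      then show "continuous_on UNIV (\<lambda>u. (\<sigma> (Y u \<omega>))\<^sup>2)" by (rule continuous_on_power)
    qed
    note [measurable] = meas
    have "(\<integral>u. (c * (\<sigma> (Y u \<omega>) * indicator {s<..t} u))\<^sup>2 \<partial>lborel) = (\<integral>u. c\<^sup>2 * (indicator {s<..t} u * (\<sigma> (Y u \<omega>))\<^sup>2) \<partial>lborel)"
      by (intro Bochner_Integration.integral_cong) (auto simp: power_mult_distrib split: split_indicator)
    also have "\<dots> = (\<integral>u. c\<^sup>2 * (indicator {s..t} u * (\<sigma> (Y u \<omega>))\<^sup>2) \<partial>lborel)"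
    proof (rule integral_cong_AE)
      show "AE u in lborel. c\<^sup>2 * (indicator {s<..t} u * (\<sigma> (Y u \<omega>))\<^sup>2) = c\<^sup>2 * (indicator {s..t} u * (\<sigma> (Y u \<omega>))\<^sup>2)"
        using AE_lborel_singleton[of s] by eventually_elim (auto split: split_indicator)
    qed simp_all
    also have "\<dots> = c\<^sup>2 * (LINT u:{s..t}|lborel. (\<sigma> (Y u \<omega>))\<^sup>2)"
      by (simp add: set_lebesgue_integral_def)
    also have "(LINT u:{s..t}|lborel. (\<sigma> (Y u \<omega>))\<^sup>2) = integral {s..t} (\<lambda>u. (\<sigma> (Y u \<omega>))\<^sup>2)"
      by (intro set_borel_integral_eq_integral borel_integrable_atLeastAtMost' v_cont)
    finally show ?thesis .
  qed
  have var0: "(\<integral>\<omega>. (z \<omega>)\<^sup>2 * (Y t \<omega> - Y s \<omega>)\<^sup>2 \<partial>P) = (\<integral>\<omega>. (z \<omega>)\<^sup>2 * integral {s..t} (\<lambda>u. (\<sigma> (Y u \<omega>))\<^sup>2) \<partial>P) \<and>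
     integrable P (\<lambda>\<omega>. (z \<omega>)\<^sup>2 * integral {s..t} (\<lambda>u. (\<sigma> (Y u \<omega>))\<^sup>2)) \<and>
     integrable P (\<lambda>\<omega>. (z \<omega>)\<^sup>2 * (Y t \<omega> - Y s \<omega>)\<^sup>2)"
    if "0 \<le> s" "s \<le> t" "z \<in> borel_measurable (F s)" "\<And>\<omega>. \<omega> \<in> space P \<Longrightarrow> \<bar>z \<omega>\<bar> \<le> C" for s t z C
  proof -
    note p = pairz[OF that]
    have i: "integrable Q (\<lambda>p. (z (fst p) * (K p * indicator {s<..t} (snd p)))\<^sup>2)"
      using p by (simp add: ito_pair_def)
    have "(\<integral>\<omega>. (z \<omega> * (Y t \<omega> - Y s \<omega>))\<^sup>2 \<partial>P) = (\<integral>p. (z (fst p) * (K p * indicator {s<..t} (snd p)))\<^sup>2 \<partial>Q)"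
      by (rule ito_pair_isometry[OF p])
    also have "\<dots> = (\<integral>\<omega>. (\<integral>u. (z \<omega> * (\<sigma> (Y u \<omega>) * indicator {s<..t} u))\<^sup>2 \<partial>lborel) \<partial>P)"
      using PQ.integral_fst'[OF i] by (simp add: K_def)
    finally have "(\<integral>\<omega>. (z \<omega> * (Y t \<omega> - Y s \<omega>))\<^sup>2 \<partial>P) = (\<integral>\<omega>. (z \<omega>)\<^sup>2 * integral {s..t} (\<lambda>u. (\<sigma> (Y u \<omega>))\<^sup>2) \<partial>P)"
      unfolding HK .
    moreover have "integrable P (\<lambda>\<omega>. (z \<omega>)\<^sup>2 * integral {s..t} (\<lambda>u. (\<sigma> (Y u \<omega>))\<^sup>2))"
      using PQ.integrable_fst'[OF i] by (simp add: K_def HK)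
    moreover have "integrable P (\<lambda>\<omega>. (z \<omega> * (Y t \<omega> - Y s \<omega>))\<^sup>2)"
      using p by (simp add: ito_pair_def)
    ultimately show ?thesis by (simp add: power_mult_distrib)
  qed
  have "bounded_diffusion P F Y (\<lambda>y. (\<sigma> y)\<^sup>2) x"
  proof
    show "sets (F s) \<subseteq> sets (F t)" if "s \<le> t" for s t
      using filtration.sets_F_mono[OF filtration_usual_augmentation, of "ennreal s" "ennreal t" M B] that
      by (auto simp: ennreal_leI)
    show "Y t \<in> borel_measurable (F t)" if "0 \<le> t" for t using adY[of t] that by (simp add: max_def)
    show "continuous_on {0..1} (\<lambda>y. (\<sigma> y)\<^sup>2)" using \<sigma> by (intro continuous_intros)
    show "(\<integral>\<omega>. z \<omega> * (Y t \<omega> - Y s \<omega>) \<partial>P) = 0"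
      if "0 \<le> s" "s \<le> t" "z \<in> borel_measurable (F s)" "\<And>\<omega>. \<omega> \<in> space P \<Longrightarrow> \<bar>z \<omega>\<bar> \<le> C" for s t z C
      by (rule ito_pair_mean(2)[OF pairz[OF that]])
    show "(\<integral>\<omega>. z \<omega> * (Y t \<omega> - Y s \<omega>)\<^sup>2 \<partial>P) = (\<integral>\<omega>. z \<omega> * integral {s..t} (\<lambda>u. (\<sigma> (Y u \<omega>))\<^sup>2) \<partial>P)"
      if "0 \<le> s" "s \<le> t" "z \<in> borel_measurable (F s)" "\<And>\<omega>. \<omega> \<in> space P \<Longrightarrow> \<bar>z \<omega>\<bar> \<le> C" for s t z C
    proof -
      note zm = that(3)
      have C0: "0 \<le> C" using that(4) not_empty by fastforce
      \<comment> \<open>The isometry yields squared weights only. Since z \<ge> -C, the weight z + C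
        is a square, and the constant weight C is subtracted afterwards.\<close>
      let ?w = "\<lambda>\<omega>. sqrt (max 0 (z \<omega> + C))"
      have wm: "?w \<in> borel_measurable (F s)" using zm by measurable
      have wb: "\<bar>?w \<omega>\<bar> \<le> sqrt (2 * C)" if "\<omega> \<in> space P" for \<omega>
        using \<open>\<And>\<omega>. \<omega> \<in> space P \<Longrightarrow> \<bar>z \<omega>\<bar> \<le> C\<close>[OF that] C0 by (auto simp: max_def)
      have w2: "(?w \<omega>)\<^sup>2 = z \<omega> + C" if "\<omega> \<in> space P" for \<omega>
        using \<open>\<And>\<omega>. \<omega> \<in> space P \<Longrightarrow> \<bar>z \<omega>\<bar> \<le> C\<close>[OF that] by (auto simp: max_def)
      let ?D = "\<lambda>\<omega>. (Y t \<omega> - Y s \<omega>)\<^sup>2" and ?V = "\<lambda>\<omega>. integral {s..t} (\<lambda>u. (\<sigma> (Y u \<omega>))\<^sup>2)"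
      have "(\<integral>\<omega>. z \<omega> * ?D \<omega> \<partial>P) = (\<integral>\<omega>. (?w \<omega>)\<^sup>2 * ?D \<omega> - (sqrt C)\<^sup>2 * ?D \<omega> \<partial>P)"
        by (rule Bochner_Integration.integral_cong[OF refl], subst w2, assumption) (use C0 in \<open>simp add: algebra_simps\<close>)
      also have "\<dots> = (\<integral>\<omega>. (?w \<omega>)\<^sup>2 * ?V \<omega> - (sqrt C)\<^sup>2 * ?V \<omega> \<partial>P)"
        using var0[OF that(1,2) wm wb] var0[OF that(1,2), of "\<lambda>_. sqrt C" "sqrt C"] C0 by simp
      also have "\<dots> = (\<integral>\<omega>. z \<omega> * ?V \<omega> \<partial>P)"
        by (rule Bochner_Integration.integral_cong[OF refl], subst w2, assumption) (use C0 in \<open>simp add: algebra_simps\<close>)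
      finally show ?thesis .
    qed
  qed (use sets_usual_augmentation_subset cont range_Y Y0 YP in auto)
  then show ?thesis using YX that by blast
qed

section \<open>Dynkin's formula\<close>

text \<open>The mean value inequality applied twice, first to the first-order error of
  \<open>f'\<close> and then to the second-order error of \<open>f\<close>. Only the oscillation of
  \<open>h\<close> between x and y enters, so continuity of the second derivative is all the
  smoothness that is spent.\<close>

lemma taylor_second_order_bound:
  fixes f f' h :: "real \<Rightarrow> real"
  assumes f: "\<And>u. u \<in> {a..b} \<Longrightarrow> (f has_real_derivative f' u) (at u within {a..b})"
    and f': "\<And>u. u \<in> {a..b} \<Longrightarrow> (f' has_real_derivative h u) (at u within {a..b})"
    and xy: "x \<in> {a..b}" "y \<in> {a..b}"
    and h: "\<And>u. u \<in> closed_segment x y \<Longrightarrow> \<bar>h u - h x\<bar> \<le> e"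
  shows "\<bar>f y - f x - f' x * (y - x) - h x / 2 * (y - x)\<^sup>2\<bar> \<le> e * (y - x)\<^sup>2"
proof -
  let ?S = "closed_segment x y"
  have S: "?S \<subseteq> {a..b}" using xy by (simp add: closed_segment_eq_real_ivl)
  have xS: "x \<in> ?S" "y \<in> ?S" by auto
  have e: "0 \<le> e" using h[OF xS(1)] by simp
  have 1: "\<bar>f' u - f' x - h x * (u - x)\<bar> \<le> e * \<bar>u - x\<bar>" if u: "u \<in> ?S" for u
  proof -
    let ?g = "\<lambda>u. f' u - h x * u"
    have "norm (?g u - ?g x) \<le> e * norm (u - x)"
    proof (rule field_differentiable_bound[where S="?S" and f'="\<lambda>u. h u - h x"])
      show "(?g has_real_derivative h w - h x) (at w within ?S)" if "w \<in> ?S" for w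
        using that S by (auto intro!: derivative_eq_intros DERIV_subset[OF f'])
    qed (use u h xS in auto)
    then show ?thesis by (simp add: algebra_simps)
  qed
  let ?G = "\<lambda>u. f u - f' x * u - h x / 2 * (u - x)\<^sup>2"
  have "norm (?G y - ?G x) \<le> (e * \<bar>y - x\<bar>) * norm (y - x)"
  proof (rule field_differentiable_bound[where S="?S" and f'="\<lambda>u. f' u - f' x - h x * (u - x)"])
    show "(?G has_real_derivative f' w - f' x - h x * (w - x)) (at w within ?S)" if "w \<in> ?S" for w
      using that S by (auto intro!: derivative_eq_intros DERIV_subset[OF f] simp: field_simps)
    show "norm (f' u - f' x - h x * (u - x)) \<le> e * \<bar>y - x\<bar>" if "u \<in> ?S" for u
    proof -
      have "\<bar>u - x\<bar> \<le> \<bar>y - x\<bar>" using that by (auto simp: closed_segment_eq_real_ivl split: if_splits)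
      then have "e * \<bar>u - x\<bar> \<le> e * \<bar>y - x\<bar>" using e by (rule mult_left_mono)
      then show ?thesis using 1[OF that] by simp
    qed
  qed (use xS in auto)
  then show ?thesis by (simp add: algebra_simps power2_eq_square abs_mult)
qed

lemma sum_integral_grid:
  fixes \<phi> :: "real \<Rightarrow> real"
  assumes "continuous_on UNIV \<phi>" "\<And>i. i < N \<Longrightarrow> T i \<le> T (Suc i)"
  shows "(\<Sum>i<N. integral {T i..T (Suc i)} \<phi>) = integral {T 0..T N} \<phi> \<and> T 0 \<le> T N"
  using assms(2)
proof (induction N)
  case (Suc N)
  have "\<phi> integrable_on {T 0..T (Suc N)}"
    by (intro integrable_continuous_interval continuous_on_subset[OF assms(1)]) auto
  then have "integral {T 0..T N} \<phi> + integral {T N..T (Suc N)} \<phi> = integral {T 0..T (Suc N)} \<phi>"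
    using Suc by (intro Henstock_Kurzweil_Integration.integral_combine) auto
  then show ?case using Suc by force
qed simp

lemma abs_mult_le:
  fixes a b :: real
  shows "\<bar>a\<bar> \<le> A \<Longrightarrow> \<bar>b\<bar> \<le> B \<Longrightarrow> \<bar>a * b\<bar> \<le> A * B"
  unfolding abs_mult by (rule mult_mono) auto

context bounded_diffusion
begin

lemma path_continuous: "continuous_on S (\<lambda>t. Y t \<omega>)"
  by (rule continuous_on_subset[OF cont]) simp

lemma comp_continuous: "continuous_on {0..1} \<phi> \<Longrightarrow> continuous_on S (\<lambda>t. \<phi> (Y t \<omega>))"
  by (rule continuous_on_compose2[OF _ path_continuous]) (auto intro: range_Y[unfolded atLeastAtMost_iff, THEN conjunct1] range_Y[unfolded atLeastAtMost_iff, THEN conjunct2])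

lemma comp_measurable:
  fixes \<phi> :: "real \<Rightarrow> real"
  assumes \<phi>: "continuous_on {0..1} \<phi>" and Z: "Z \<in> borel_measurable N" and "\<And>\<omega>. Z \<omega> \<in> {0..1}"
  shows "(\<lambda>\<omega>. \<phi> (Z \<omega>)) \<in> borel_measurable N"
proof -
  have "continuous_on UNIV (\<lambda>y. \<phi> (max 0 (min 1 y)))"
    by (rule continuous_on_compose2[OF \<phi>]) (auto intro!: continuous_intros)
  then have "(\<lambda>y. \<phi> (max 0 (min 1 y))) \<in> borel_measurable borel"
    by (rule borel_measurable_continuous_onI)
  moreover have clamp: "max 0 (min 1 (Z \<omega>)) = Z \<omega>" for \<omega> using assms(3)[of \<omega>] by auto
  ultimately show ?thesis using measurable_compose[OF Z, of "\<lambda>y. \<phi> (max 0 (min 1 y))" borel]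
    by (simp add: clamp)
qed

lemma measurable_F_mono: "f \<in> borel_measurable (F s) \<Longrightarrow> s \<le> t \<Longrightarrow> f \<in> borel_measurable (F t)"
  using measurable_mono[of borel borel "F s" "F t"] sets_F_mono[of s t] space_F by auto

lemma measurable_F_P: "f \<in> borel_measurable (F s) \<Longrightarrow> f \<in> borel_measurable P"
  using measurable_mono[of borel borel "F s" P] sets_F[of s] space_F by auto

lemma comp_F:
  fixes \<phi> :: "real \<Rightarrow> real"
  assumes "continuous_on {0..1} \<phi>" "0 \<le> s" "s \<le> t"
  shows "(\<lambda>\<omega>. \<phi> (Y s \<omega>)) \<in> borel_measurable (F t)"
  by (rule comp_measurable[OF assms(1) measurable_F_mono[OF adapted[OF assms(2)] assms(3)] range_Y])

lemma comp_P:
  fixes \<phi> :: "real \<Rightarrow> real"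
  assumes "continuous_on {0..1} \<phi>"
  shows "(\<lambda>\<omega>. \<phi> (Y s \<omega>)) \<in> borel_measurable P"
  by (rule comp_measurable[OF assms Y_measurable range_Y])

lemma continuous_bounded:
  fixes \<phi> :: "real \<Rightarrow> real"
  assumes "continuous_on {0..1} \<phi>"
  shows "\<exists>C\<ge>0. \<forall>y\<in>{0..1}. \<bar>\<phi> y\<bar> \<le> C"
proof -
  obtain D where D: "\<forall>y\<in>{0..1}. \<bar>\<phi> y\<bar> \<le> D"
    using compact_imp_bounded[OF compact_continuous_image[OF assms compact_Icc]]
    by (auto simp: bounded_iff)
  moreover have "0 \<le> D" using D[rule_format, of 0] by simp
  ultimately show ?thesis by blast
qed

lemma integral_measurable:
  fixes \<phi> :: "real \<Rightarrow> real"
  assumes \<phi>: "continuous_on {0..1} \<phi>"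
  shows "(\<lambda>\<omega>. integral {s..t} (\<lambda>u. \<phi> (Y u \<omega>))) \<in> borel_measurable P"
proof -
  have eq: "integral {s..t} (\<lambda>u. \<phi> (Y u \<omega>)) = (\<integral>u. indicator {s..t} u * \<phi> (Y u \<omega>) \<partial>lborel)" for \<omega>
    using set_borel_integral_eq_integral(2)[OF borel_integrable_atLeastAtMost'[OF comp_continuous[OF \<phi>]], of s t \<omega>]
    by (simp add: set_lebesgue_integral_def)
  have [measurable]: "(\<lambda>p. \<phi> (Y (snd p) (fst p))) \<in> borel_measurable (P \<Otimes>\<^sub>M lborel)"
    by (rule comp_measurable[OF \<phi> continuous_process_measurable[OF Y_measurable cont]]) (rule range_Y)
  have "(\<lambda>(\<omega>, u). indicator {s..t} u * \<phi> (Y u \<omega>)) \<in> borel_measurable (P \<Otimes>\<^sub>M lborel)"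
    unfolding case_prod_beta by measurable
  then show ?thesis unfolding eq by (rule lborel.borel_measurable_lebesgue_integral)
qed

lemma integral_bound:
  fixes \<phi> :: "real \<Rightarrow> real"
  assumes \<phi>: "continuous_on {0..1} \<phi>" and C: "\<And>y. y \<in> {0..1} \<Longrightarrow> \<bar>\<phi> y\<bar> \<le> C" and "s \<le> t"
  shows "\<bar>integral {s..t} (\<lambda>u. \<phi> (Y u \<omega>))\<bar> \<le> C * (t - s)"
proof -
  have "norm (integral {s..t} (\<lambda>u. \<phi> (Y u \<omega>))) \<le> C * (t - s)"
    by (rule Henstock_Kurzweil_Integration.integral_bound[OF \<open>s \<le> t\<close> comp_continuous[OF \<phi>]])
      (simp only: real_norm_def C[OF range_Y])
  then show ?thesis by simp
qed

lemma bounded_integrable: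
  fixes f :: "'a \<Rightarrow> real"
  assumes "f \<in> borel_measurable P" "\<And>\<omega>. \<omega> \<in> space P \<Longrightarrow> \<bar>f \<omega>\<bar> \<le> C"
  shows "integrable P f"
  by (rule integrable_const_bound[where B=C, OF AE_I2 assms(1)]) (simp add: assms(2))

lemma dominated_to_zero:
  fixes f :: "nat \<Rightarrow> 'a \<Rightarrow> real"
  assumes "\<And>n. f n \<in> borel_measurable P" "\<And>n \<omega>. \<omega> \<in> space P \<Longrightarrow> \<bar>f n \<omega>\<bar> \<le> C"
    and "\<And>\<omega>. \<omega> \<in> space P \<Longrightarrow> (\<lambda>n. f n \<omega>) \<longlonglongrightarrow> 0"
  shows "(\<lambda>n. \<integral>\<omega>. f n \<omega> \<partial>P) \<longlonglongrightarrow> 0"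
proof -
  have "(\<lambda>n. \<integral>\<omega>. f n \<omega> \<partial>P) \<longlonglongrightarrow> (\<integral>\<omega>. 0 \<partial>P)"
  proof (rule integral_dominated_convergence)
    show "AE \<omega> in P. norm (f n \<omega>) \<le> C" for n by (rule AE_I2) (simp add: assms(2))
    show "AE \<omega> in P. (\<lambda>n. f n \<omega>) \<longlonglongrightarrow> 0" by (rule AE_I2) (rule assms(3))
  qed (simp_all add: assms(1))
  then show ?thesis by simp
qed

text \<open>Along a grid of [s, t] the first-order Taylor terms have mean zero by
  \<open>mean\<close>, and \<open>var\<close> turns the second-order ones into a Riemann sum for the
  integral of \<open>h (Y u) * v (Y u)\<close>. The delicate part is the remainder: it is small
  relative to the squared increment only if that increment is small, and no modulus of continuity is
  uniform over all paths. Fourth moments are avoided by singling out the first large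
  increment.\<close>

lemma dynkin:
  assumes f: "\<And>u. u \<in> {0..1} \<Longrightarrow> (f has_real_derivative f' u) (at u within {0..1})"
    and f': "\<And>u. u \<in> {0..1} \<Longrightarrow> (f' has_real_derivative h u) (at u within {0..1})"
    and h: "continuous_on {0..1} h"
    and s: "0 \<le> s" "s \<le> t" and z: "z \<in> borel_measurable (F s)"
    and C: "\<And>\<omega>. \<omega> \<in> space P \<Longrightarrow> \<bar>z \<omega>\<bar> \<le> C"
  shows "(\<integral>\<omega>. z \<omega> * (f (Y t \<omega>) - f (Y s \<omega>)) \<partial>P) =
    (\<integral>\<omega>. z \<omega> * integral {s..t} (\<lambda>u. h (Y u \<omega>) * v (Y u \<omega>) / 2) \<partial>P)"
proof -
  have fc: "continuous_on {0..1} f" by (rule DERIV_continuous_on[OF f])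
  have f'c: "continuous_on {0..1} f'" by (rule DERIV_continuous_on[OF f'])
  have C0: "0 \<le> C" using C not_empty by fastforce
  obtain D where "0 \<le> D" "\<forall>y\<in>{0..1}. \<bar>f y\<bar> \<le> D" using continuous_bounded[OF fc] by blast
  then have D: "0 \<le> D" "\<And>y. y \<in> {0..1} \<Longrightarrow> \<bar>f y\<bar> \<le> D" by auto
  obtain D' where "0 \<le> D'" "\<forall>y\<in>{0..1}. \<bar>f' y\<bar> \<le> D'" using continuous_bounded[OF f'c] by blast
  then have D': "0 \<le> D'" "\<And>y. y \<in> {0..1} \<Longrightarrow> \<bar>f' y\<bar> \<le> D'" by auto
  obtain H where "0 \<le> H" "\<forall>y\<in>{0..1}. \<bar>h y\<bar> \<le> H" using continuous_bounded[OF h] by blast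
  then have H: "0 \<le> H" "\<And>y. y \<in> {0..1} \<Longrightarrow> \<bar>h y\<bar> \<le> H" by auto
  obtain V where "0 \<le> V" "\<forall>y\<in>{0..1}. \<bar>v y\<bar> \<le> V" using continuous_bounded[OF v] by blast
  then have V: "0 \<le> V" "\<And>y. y \<in> {0..1} \<Longrightarrow> \<bar>v y\<bar> \<le> V" by auto
  have hv: "continuous_on {0..1} (\<lambda>y. h y * v y)" using h v by (intro continuous_intros)
  have zP: "z \<in> borel_measurable P" using z by (rule measurable_F_P)
  define T where "T n i = s + real i * ((t - s) / real (Suc n))" for n i :: nat
  have T_step: "T n (Suc i) = T n i + (t - s) / real (Suc n)" for n i
    unfolding T_def of_nat_Suc[of i] distrib_right by simp
  have T0: "T n 0 = s" and TN: "T n (Suc n) = t" for n by (simp_all add: T_def)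
  have T_mono: "i \<le> j \<Longrightarrow> T n i \<le> T n j" for n i j
    unfolding T_def using s by (intro add_left_mono mult_right_mono) auto
  have T_ge: "s \<le> T n i" "0 \<le> T n i" for n i using T_mono[of 0 i n] s by (simp_all add: T0)
  define DD where "DD n i \<omega> = Y (T n (Suc i)) \<omega> - Y (T n i) \<omega>" for n i \<omega>
  have DD1: "\<bar>DD n i \<omega>\<bar> \<le> 1" for n i \<omega>
    using range_Y[of "T n (Suc i)" \<omega>] range_Y[of "T n i" \<omega>] by (auto simp: DD_def)
  have DDP: "DD n i \<in> borel_measurable P" for n i
    unfolding DD_def[abs_def] using Y_measurable by (intro borel_measurable_diff)
  define r where "r n i \<omega> = f (Y (T n (Suc i)) \<omega>) - f (Y (T n i) \<omega>) - f' (Y (T n i) \<omega>) * DD n i \<omega>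
     - h (Y (T n i) \<omega>) / 2 * (DD n i \<omega>)\<^sup>2" for n i \<omega>
  have rP: "r n i \<in> borel_measurable P" for n i
    unfolding r_def[abs_def] using DDP comp_P[OF fc] comp_P[OF f'c] comp_P[OF h]
    by (intro borel_measurable_diff borel_measurable_times borel_measurable_power borel_measurable_divide) auto
  have r_le: "\<bar>r n i \<omega>\<bar> \<le> e * (DD n i \<omega>)\<^sup>2"
    if "\<And>u. u \<in> closed_segment (Y (T n i) \<omega>) (Y (T n (Suc i)) \<omega>) \<Longrightarrow> \<bar>h u - h (Y (T n i) \<omega>)\<bar> \<le> e" for n i \<omega> e
    unfolding r_def DD_def by (rule taylor_second_order_bound[OF f f' range_Y range_Y that])
  have seg: "closed_segment (Y a \<omega>) (Y b \<omega>) \<subseteq> {0..1}" for a b \<omega>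
    using range_Y[of a \<omega>] range_Y[of b \<omega>] by (simp add: closed_segment_eq_real_ivl)
  have r_le2: "\<bar>r n i \<omega>\<bar> \<le> 2 * H * (DD n i \<omega>)\<^sup>2" for n i \<omega>
  proof (rule r_le)
    fix u assume "u \<in> closed_segment (Y (T n i) \<omega>) (Y (T n (Suc i)) \<omega>)"
    then have "\<bar>h u\<bar> \<le> H" by (intro H(2) subsetD[OF seg])
    moreover have "\<bar>h (Y (T n i) \<omega>)\<bar> \<le> H" by (rule H(2)[OF range_Y])
    ultimately show "\<bar>h u - h (Y (T n i) \<omega>)\<bar> \<le> 2 * H" by linarith
  qed
  let ?I = "\<lambda>\<phi> n i \<omega>. integral {T n i..T n (Suc i)} (\<lambda>u. \<phi> (Y u \<omega>))"
  \<comment> \<open>Error of a Riemann sum in which \<open>h\<close> is frozen at the left end of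
    each cell while \<open>v\<close> is integrated exactly.\<close>
  define R where "R n \<omega> = (\<Sum>i<Suc n. h (Y (T n i) \<omega>) * ?I v n i \<omega>) - integral {s..t} (\<lambda>u. h (Y u \<omega>) * v (Y u \<omega>))" for n \<omega>
  have RP: "R n \<in> borel_measurable P" for n
    unfolding R_def[abs_def]
    by (intro borel_measurable_diff borel_measurable_sum borel_measurable_times comp_P[OF h] integral_measurable[OF v] integral_measurable[OF hv])
  have VI: "\<bar>?I v n i \<omega>\<bar> \<le> V * ((t - s) / real (Suc n))" for n i \<omega>
    using integral_bound[OF v V(2), of "T n i" "T n (Suc i)" \<omega>] T_mono[of i "Suc i" n] by (simp add: T_step)
  have zh_int: "integrable P (\<lambda>\<omega>. z \<omega> * integral {s..t} (\<lambda>u. h (Y u \<omega>) * v (Y u \<omega>)))"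
  proof (rule bounded_integrable)
    show "(\<lambda>\<omega>. z \<omega> * integral {s..t} (\<lambda>u. h (Y u \<omega>) * v (Y u \<omega>))) \<in> borel_measurable P"
      by (intro borel_measurable_times zP integral_measurable[OF hv])
    fix \<omega> assume w: "\<omega> \<in> space P"
    have "\<bar>integral {s..t} (\<lambda>u. h (Y u \<omega>) * v (Y u \<omega>))\<bar> \<le> (H * V) * (t - s)"
      by (rule integral_bound[OF hv _ s(2)]) (intro abs_mult_le H(2) V(2))
    then show "\<bar>z \<omega> * integral {s..t} (\<lambda>u. h (Y u \<omega>) * v (Y u \<omega>))\<bar> \<le> C * ((H * V) * (t - s))"
      using C[OF w] by (intro abs_mult_le)
  qed
  have R_split: "R n \<omega> = (\<Sum>i<Suc n. integral {T n i..T n (Suc i)} (\<lambda>u. (h (Y (T n i) \<omega>) - h (Y u \<omega>)) * v (Y u \<omega>)))" for n \<omega>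
  proof -
    have "integral {s..t} (\<lambda>u. h (Y u \<omega>) * v (Y u \<omega>)) = (\<Sum>i<Suc n. integral {T n i..T n (Suc i)} (\<lambda>u. h (Y u \<omega>) * v (Y u \<omega>)))"
      using conjunct1[OF sum_integral_grid[OF comp_continuous[OF hv], of "Suc n" "T n" \<omega>, OF T_mono]]
      unfolding T0 TN by simp
    then have "R n \<omega> = (\<Sum>i<Suc n. h (Y (T n i) \<omega>) * ?I v n i \<omega> - integral {T n i..T n (Suc i)} (\<lambda>u. h (Y u \<omega>) * v (Y u \<omega>)))"
      unfolding R_def by (simp only: sum_subtractf)
    also have "\<dots> = (\<Sum>i<Suc n. integral {T n i..T n (Suc i)} (\<lambda>u. (h (Y (T n i) \<omega>) - h (Y u \<omega>)) * v (Y u \<omega>)))"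
    proof (rule sum.cong[OF refl])
      fix i
      have "(\<lambda>u. h (Y (T n i) \<omega>) * v (Y u \<omega>)) integrable_on {T n i..T n (Suc i)}"
        by (intro integrable_continuous_interval continuous_intros comp_continuous v)
      moreover have "(\<lambda>u. h (Y u \<omega>) * v (Y u \<omega>)) integrable_on {T n i..T n (Suc i)}"
        by (intro integrable_continuous_interval comp_continuous[OF hv])
      ultimately show "h (Y (T n i) \<omega>) * ?I v n i \<omega> - integral {T n i..T n (Suc i)} (\<lambda>u. h (Y u \<omega>) * v (Y u \<omega>))
         = integral {T n i..T n (Suc i)} (\<lambda>u. (h (Y (T n i) \<omega>) - h (Y u \<omega>)) * v (Y u \<omega>))"
        by (simp add: left_diff_distrib Henstock_Kurzweil_Integration.integral_diff)
    qed
    finally show ?thesis .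
  qed
  have R_le: "\<bar>R n \<omega>\<bar> \<le> e * V * (t - s)"
    if e: "0 \<le> e" "\<And>i u. i < Suc n \<Longrightarrow> u \<in> {T n i..T n (Suc i)} \<Longrightarrow> \<bar>h (Y (T n i) \<omega>) - h (Y u \<omega>)\<bar> \<le> e" for n \<omega> e
  proof -
    have "\<bar>R n \<omega>\<bar> \<le> (\<Sum>i<Suc n. \<bar>integral {T n i..T n (Suc i)} (\<lambda>u. (h (Y (T n i) \<omega>) - h (Y u \<omega>)) * v (Y u \<omega>))\<bar>)"
      unfolding R_split by (rule sum_abs)
    also have "\<dots> \<le> (\<Sum>i<Suc n. (e * V) * ((t - s) / real (Suc n)))"
    proof (rule sum_mono)
      fix i assume i: "i \<in> {..<Suc n}"
      have "norm (integral {T n i..T n (Suc i)} (\<lambda>u. (h (Y (T n i) \<omega>) - h (Y u \<omega>)) * v (Y u \<omega>))) \<le> (e * V) * (T n (Suc i) - T n i)"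
      proof (rule Henstock_Kurzweil_Integration.integral_bound)
        show "continuous_on {T n i..T n (Suc i)} (\<lambda>u. (h (Y (T n i) \<omega>) - h (Y u \<omega>)) * v (Y u \<omega>))"
          by (intro continuous_intros comp_continuous h v)
        show "norm ((h (Y (T n i) \<omega>) - h (Y u \<omega>)) * v (Y u \<omega>)) \<le> e * V" if "u \<in> {T n i..T n (Suc i)}" for u
          unfolding real_norm_def by (intro abs_mult_le V(2) range_Y e(2)) (use i that in auto)
      qed (rule T_mono, simp)
      then show "\<bar>integral {T n i..T n (Suc i)} (\<lambda>u. (h (Y (T n i) \<omega>) - h (Y u \<omega>)) * v (Y u \<omega>))\<bar> \<le> (e * V) * ((t - s) / real (Suc n))"
        by (simp add: T_step)
    qed
    also have "\<dots> = e * V * (t - s)" by (simp del: of_nat_Suc)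
    finally show ?thesis .
  qed
  \<comment> \<open>Applied to \<open>h\<close> along a path, to make \<open>R\<close> vanish, and
    to the path itself, to make large increments improbable.\<close>
  have unif: "\<exists>N. \<forall>n\<ge>N. \<forall>i<Suc n. \<forall>u\<in>{T n i..T n (Suc i)}. \<bar>\<phi> (T n i) - \<phi> u\<bar> < d"
    if "0 < d" "continuous_on UNIV \<phi>" for \<phi> :: "real \<Rightarrow> real" and d
  proof -
    have "uniformly_continuous_on {s..t} \<phi>"
      by (rule compact_uniformly_continuous[OF continuous_on_subset[OF that(2)]]) auto
    then have "\<exists>k>0. \<forall>a\<in>{s..t}. \<forall>b\<in>{s..t}. dist b a < k \<longrightarrow> dist (\<phi> b) (\<phi> a) < d"
      unfolding uniformly_continuous_on_def by (elim allE[where x=d] mp) (rule that(1))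
    then obtain k where k: "k > 0" "\<forall>a\<in>{s..t}. \<forall>b\<in>{s..t}. dist b a < k \<longrightarrow> dist (\<phi> b) (\<phi> a) < d"
      by (elim exE conjE) (rule that)
    obtain N0 :: nat where N0: "(t - s) / k < real N0" using reals_Archimedean2 by blast
    define N where "N = N0"
    have N: "(t - s) / k < real (Suc N)" using N0 by (simp add: N_def)
    show ?thesis
    proof (intro exI[of _ N] allI impI ballI)
      fix n i u assume n: "N \<le> n" and i: "i < Suc n" and u: "u \<in> {T n i..T n (Suc i)}"
      have "real (Suc N) \<le> real (Suc n)" using n by simp
      with N have "(t - s) / k < real (Suc n)" by (rule less_le_trans)
      then have "(t - s) / real (Suc n) < k" using k(1) by (simp add: pos_divide_less_eq mult.commute del: of_nat_Suc)
      moreover have uT: "T n i \<le> u" "u \<le> T n i + (t - s) / real (Suc n)" using u by (simp_all add: T_step)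
      ultimately have "\<bar>T n i - u\<bar> < k" by linarith
      then have *: "dist (T n i) u < k" by (simp add: dist_real_def)
      have "T n (Suc i) \<le> t" using T_mono[of "Suc i" "Suc n" n] i unfolding TN by simp
      then have "u \<le> t" "T n i \<le> t" using u uT(1) by auto
      then have "T n i \<in> {s..t}" "u \<in> {s..t}" using T_ge(1)[of n i] uT(1) by auto
      then have "dist (\<phi> (T n i)) (\<phi> u) < d" by (intro k(2)[rule_format] *)
      then show "\<bar>\<phi> (T n i) - \<phi> u\<bar> < d" by (simp add: dist_real_def)
    qed
  qed
  have R_lim: "(\<lambda>n. R n \<omega>) \<longlonglongrightarrow> 0" for \<omega>
  proof (rule LIMSEQ_I)
    fix e :: real assume e: "0 < e"
    \<comment> \<open>The summand 1 keeps the divisor positive when V or t - s is zero.\<close>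
    define p where "p = V * (t - s) + 1"
    have pos: "0 < p" using V s by (simp add: p_def add_nonneg_pos)
    define e' where "e' = e / (2 * p)"
    have e': "0 < e'" using e pos by (simp add: e'_def)
    from unif[OF e' comp_continuous[OF h, of UNIV \<omega>]] obtain N where
      N: "\<forall>n\<ge>N. \<forall>i<Suc n. \<forall>u\<in>{T n i..T n (Suc i)}. \<bar>h (Y (T n i) \<omega>) - h (Y u \<omega>)\<bar> < e'" ..
    show "\<exists>N. \<forall>n\<ge>N. norm (R n \<omega> - 0) < e"
    proof (intro exI[of _ N] allI impI)
      fix n assume "N \<le> n"
      then have "\<bar>R n \<omega>\<bar> \<le> e' * V * (t - s)"
        using e' by (intro R_le less_imp_le[OF N[rule_format]]) auto
      also have "\<dots> \<le> e' * p" using e' by (simp add: p_def algebra_simps)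
      also have "\<dots> < e" using e pos by (simp add: e'_def)
      finally show "norm (R n \<omega> - 0) < e" by simp
    qed
  qed
  have R_bd: "\<bar>R n \<omega>\<bar> \<le> 2 * H * V * (t - s)" for n \<omega>
  proof (rule R_le)
    show "0 \<le> 2 * H" using H by simp
    fix i u
    show "\<bar>h (Y (T n i) \<omega>) - h (Y u \<omega>)\<bar> \<le> 2 * H"
      using H(2)[OF range_Y[of "T n i" \<omega>]] H(2)[OF range_Y[of u \<omega>]] by linarith
  qed
  have zR_int: "integrable P (\<lambda>\<omega>. z \<omega> * R n \<omega>)" for n
  proof (rule bounded_integrable)
    show "(\<lambda>\<omega>. z \<omega> * R n \<omega>) \<in> borel_measurable P" using zP RP by (rule borel_measurable_times)
    show "\<bar>z \<omega> * R n \<omega>\<bar> \<le> C * (2 * H * V * (t - s))" if "\<omega> \<in> space P" for \<omega>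
      by (intro abs_mult_le C that R_bd)
  qed
  have zR_lim: "(\<lambda>n. \<integral>\<omega>. z \<omega> * R n \<omega> \<partial>P) \<longlonglongrightarrow> 0"
  proof (rule dominated_to_zero)
    show "(\<lambda>\<omega>. z \<omega> * R n \<omega>) \<in> borel_measurable P" for n using zP RP by (rule borel_measurable_times)
    show "\<bar>z \<omega> * R n \<omega>\<bar> \<le> C * (2 * H * V * (t - s))" if "\<omega> \<in> space P" for n \<omega>
      by (intro abs_mult_le C that R_bd)
    show "(\<lambda>n. z \<omega> * R n \<omega>) \<longlonglongrightarrow> 0" for \<omega>
      using tendsto_mult_left[OF R_lim, of "z \<omega>"] by simp
  qed
  have varD: "(\<integral>\<omega>. w \<omega> * (DD n i \<omega>)\<^sup>2 \<partial>P) = (\<integral>\<omega>. w \<omega> * ?I v n i \<omega> \<partial>P)"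
    if "w \<in> borel_measurable (F (T n i))" "\<And>\<omega>. \<omega> \<in> space P \<Longrightarrow> \<bar>w \<omega>\<bar> \<le> K" for w K n i
    unfolding DD_def by (rule var[OF T_ge(2) T_mono that]) auto
  \<comment> \<open>The defect depends neither on the grid nor on e: for fixed e the grid is refined
    first, and then e is made small.\<close>
  define \<Delta> where "\<Delta> = \<bar>(\<integral>\<omega>. z \<omega> * (f (Y t \<omega>) - f (Y s \<omega>)) \<partial>P) -
    (\<integral>\<omega>. z \<omega> * integral {s..t} (\<lambda>u. h (Y u \<omega>) * v (Y u \<omega>)) \<partial>P) / 2\<bar>"
  have hY_F: "(\<lambda>\<omega>. h (Y (T n i) \<omega>)) \<in> borel_measurable (F (T n i))"
    and f'Y_F: "(\<lambda>\<omega>. f' (Y (T n i) \<omega>)) \<in> borel_measurable (F (T n i))"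
    and z_F: "z \<in> borel_measurable (F (T n i))" for n i
    by (rule comp_F[OF h T_ge(2) order_refl], rule comp_F[OF f'c T_ge(2) order_refl],
        rule measurable_F_mono[OF z T_ge(1)])
  have zfD: "(\<integral>\<omega>. z \<omega> * f' (Y (T n i) \<omega>) * DD n i \<omega> \<partial>P) = 0" for n i
    unfolding DD_def
    by (rule mean[OF T_ge(2) T_mono borel_measurable_times[OF z_F f'Y_F] abs_mult_le[OF C D'(2)[OF range_Y]]]) auto
  have zhD: "(\<integral>\<omega>. z \<omega> * h (Y (T n i) \<omega>) * (DD n i \<omega>)\<^sup>2 \<partial>P) = (\<integral>\<omega>. z \<omega> * h (Y (T n i) \<omega>) * ?I v n i \<omega> \<partial>P)" for n i
    by (rule varD[OF borel_measurable_times[OF z_F hY_F] abs_mult_le[OF C H(2)[OF range_Y]]])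
  have DD2: "(DD n i \<omega>)\<^sup>2 \<le> 1" for n i \<omega> using DD1[of n i \<omega>] by (simp add: abs_square_le_1)
  have ints: "integrable P (\<lambda>\<omega>. z \<omega> * f' (Y (T n i) \<omega>) * DD n i \<omega>)"
    "integrable P (\<lambda>\<omega>. z \<omega> * h (Y (T n i) \<omega>) * (DD n i \<omega>)\<^sup>2)"
    "integrable P (\<lambda>\<omega>. z \<omega> * h (Y (T n i) \<omega>) * ?I v n i \<omega>)"
    "integrable P (\<lambda>\<omega>. z \<omega> * r n i \<omega>)" "integrable P (\<lambda>\<omega>. \<bar>r n i \<omega>\<bar>)"
    "integrable P (\<lambda>\<omega>. (DD n i \<omega>)\<^sup>2)" for n i
  proof -
    have r1: "\<bar>r n i \<omega>\<bar> \<le> 2 * H" for \<omega>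
      using r_le2[of n i \<omega>] mult_left_mono[OF DD2[of n i \<omega>], of "2 * H"] H(1) by simp
    show "integrable P (\<lambda>\<omega>. z \<omega> * f' (Y (T n i) \<omega>) * DD n i \<omega>)"
      by (rule bounded_integrable[OF borel_measurable_times[OF borel_measurable_times[OF zP comp_P[OF f'c]] DDP]
          abs_mult_le[OF abs_mult_le[OF C D'(2)[OF range_Y]] DD1]])
    show "integrable P (\<lambda>\<omega>. z \<omega> * h (Y (T n i) \<omega>) * (DD n i \<omega>)\<^sup>2)"
      by (rule bounded_integrable[OF borel_measurable_times[OF borel_measurable_times[OF zP comp_P[OF h]] borel_measurable_power[OF DDP]]
          abs_mult_le[OF abs_mult_le[OF C H(2)[OF range_Y]], of _ _ 1]]) (simp_all add: DD2)
    show "integrable P (\<lambda>\<omega>. z \<omega> * h (Y (T n i) \<omega>) * ?I v n i \<omega>)"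
      by (rule bounded_integrable[OF borel_measurable_times[OF borel_measurable_times[OF zP comp_P[OF h]] integral_measurable[OF v]]
          abs_mult_le[OF abs_mult_le[OF C H(2)[OF range_Y]] VI]])
    show "integrable P (\<lambda>\<omega>. z \<omega> * r n i \<omega>)"
      by (rule bounded_integrable[OF borel_measurable_times[OF zP rP] abs_mult_le[OF C r1]])
    show "integrable P (\<lambda>\<omega>. \<bar>r n i \<omega>\<bar>)"
      by (rule bounded_integrable[of _ "2 * H"]) (simp_all add: r1 rP borel_measurable_abs)
    show "integrable P (\<lambda>\<omega>. (DD n i \<omega>)\<^sup>2)"
      by (rule bounded_integrable[of _ 1]) (simp_all add: DD2 DDP borel_measurable_power)
  qed
  have fdiff: "z \<omega> * (f (Y t \<omega>) - f (Y s \<omega>)) = (\<Sum>i<Suc n. z \<omega> * f' (Y (T n i) \<omega>) * DD n i \<omega> +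
      (z \<omega> * h (Y (T n i) \<omega>) * (DD n i \<omega>)\<^sup>2 / 2 + z \<omega> * r n i \<omega>))" for n \<omega>
  proof -
    have "f (Y t \<omega>) - f (Y s \<omega>) = (\<Sum>i<Suc n. f (Y (T n (Suc i)) \<omega>) - f (Y (T n i) \<omega>))"
      using sum_lessThan_telescope[of "\<lambda>i. f (Y (T n i) \<omega>)" "Suc n"] unfolding T0 TN by simp
    then have "z \<omega> * (f (Y t \<omega>) - f (Y s \<omega>)) = (\<Sum>i<Suc n. z \<omega> * (f (Y (T n (Suc i)) \<omega>) - f (Y (T n i) \<omega>)))"
      by (simp only: sum_distrib_left)
    then show ?thesis
      by (simp only: r_def) (simp add: algebra_simps)
  qed
  have key: "(\<integral>\<omega>. z \<omega> * (f (Y t \<omega>) - f (Y s \<omega>)) \<partial>P) -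
    (\<integral>\<omega>. z \<omega> * integral {s..t} (\<lambda>u. h (Y u \<omega>) * v (Y u \<omega>)) \<partial>P) / 2 =
    (\<integral>\<omega>. z \<omega> * R n \<omega> \<partial>P) / 2 + (\<Sum>i<Suc n. \<integral>\<omega>. z \<omega> * r n i \<omega> \<partial>P)" for n
  proof -
    have "(\<integral>\<omega>. z \<omega> * (f (Y t \<omega>) - f (Y s \<omega>)) \<partial>P) = (\<Sum>i<Suc n. \<integral>\<omega>. z \<omega> * f' (Y (T n i) \<omega>) * DD n i \<omega> +
      (z \<omega> * h (Y (T n i) \<omega>) * (DD n i \<omega>)\<^sup>2 / 2 + z \<omega> * r n i \<omega>) \<partial>P)"
      unfolding fdiff[of _ n] by (rule Bochner_Integration.integral_sum) (intro Bochner_Integration.integrable_add integrable_divide ints)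
    also have "\<dots> = (\<Sum>i<Suc n. (\<integral>\<omega>. z \<omega> * h (Y (T n i) \<omega>) * ?I v n i \<omega> \<partial>P) / 2 + (\<integral>\<omega>. z \<omega> * r n i \<omega> \<partial>P))"
      by (rule sum.cong[OF refl]) (simp add: ints zfD zhD)
    also have "\<dots> = (\<Sum>i<Suc n. \<integral>\<omega>. z \<omega> * h (Y (T n i) \<omega>) * ?I v n i \<omega> \<partial>P) / 2 + (\<Sum>i<Suc n. \<integral>\<omega>. z \<omega> * r n i \<omega> \<partial>P)"
      by (simp only: sum.distrib sum_divide_distrib)
    also have "(\<Sum>i<Suc n. \<integral>\<omega>. z \<omega> * h (Y (T n i) \<omega>) * ?I v n i \<omega> \<partial>P) =
       (\<integral>\<omega>. (\<Sum>i<Suc n. z \<omega> * h (Y (T n i) \<omega>) * ?I v n i \<omega>) \<partial>P)"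
      by (rule Bochner_Integration.integral_sum[symmetric]) (rule ints)
    also have "\<dots> = (\<integral>\<omega>. z \<omega> * R n \<omega> + z \<omega> * integral {s..t} (\<lambda>u. h (Y u \<omega>) * v (Y u \<omega>)) \<partial>P)"
    proof (rule Bochner_Integration.integral_cong[OF refl])
      fix \<omega>
      have "(\<Sum>i<Suc n. z \<omega> * h (Y (T n i) \<omega>) * ?I v n i \<omega>) = z \<omega> * (\<Sum>i<Suc n. h (Y (T n i) \<omega>) * ?I v n i \<omega>)"
        by (simp only: sum_distrib_left mult.assoc)
      then show "(\<Sum>i<Suc n. z \<omega> * h (Y (T n i) \<omega>) * ?I v n i \<omega>) = z \<omega> * R n \<omega> + z \<omega> * integral {s..t} (\<lambda>u. h (Y u \<omega>) * v (Y u \<omega>))"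
        unfolding R_def by (simp only: distrib_left[symmetric] diff_add_cancel)
    qed
    also have "\<dots> = (\<integral>\<omega>. z \<omega> * R n \<omega> \<partial>P) + (\<integral>\<omega>. z \<omega> * integral {s..t} (\<lambda>u. h (Y u \<omega>) * v (Y u \<omega>)) \<partial>P)"
      by (rule Bochner_Integration.integral_add[OF zR_int zh_int])
    finally show ?thesis by (simp add: add_divide_distrib)
  qed
  have \<Delta>_le: "\<Delta> \<le> C * (e * V * (t - s))" if e: "0 < e" for e
  proof -
    have "uniformly_continuous_on {0..1} h"
      by (rule compact_uniformly_continuous[OF h compact_Icc])
    then have "\<exists>d>0. \<forall>a\<in>{0..1}. \<forall>b\<in>{0..1}. dist b a < d \<longrightarrow> dist (h b) (h a) < e"
      unfolding uniformly_continuous_on_def by (elim allE[where x=e] mp) (rule e)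
    then obtain d where d: "d > 0" "\<forall>a\<in>{0..1}. \<forall>b\<in>{0..1}. dist b a < d \<longrightarrow> dist (h b) (h a) < e"
      by (elim exE conjE) (rule that)
    \<comment> \<open>Some increment before step i was large. Only indices j < i enter, so the event
      is known at \<open>T n i\<close>, and its indicator is an admissible weight for the squared
      increment of step i.\<close>
    define L where "L n i = {\<omega> \<in> space P. \<exists>j<i. d \<le> \<bar>DD n j \<omega>\<bar>}" for n i
    have L_F: "L n i \<in> sets (F (T n i))" for n i
    proof -
      have "DD n j \<in> borel_measurable (F (T n i))" if "j < i" for j
        unfolding DD_def[abs_def] using that T_mono[of j i n] T_mono[of "Suc j" i n]
        by (intro borel_measurable_diff measurable_F_mono[OF adapted[OF T_ge(2)]]) auto
      then have "{\<omega> \<in> space (F (T n i)). d \<le> \<bar>DD n j \<omega>\<bar>} \<in> sets (F (T n i))" if "j < i" for j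
        using that by (intro borel_measurable_le borel_measurable_const borel_measurable_abs)
      then have "(\<Union>j\<in>{..<i}. {\<omega> \<in> space (F (T n i)). d \<le> \<bar>DD n j \<omega>\<bar>}) \<in> sets (F (T n i))"
        by (intro sets.finite_UN) auto
      also have "(\<Union>j\<in>{..<i}. {\<omega> \<in> space (F (T n i)). d \<le> \<bar>DD n j \<omega>\<bar>}) = L n i"
        by (auto simp: L_def space_F)
      finally show ?thesis .
    qed
    have L_P: "L n i \<in> sets P" for n i using L_F[of n i] sets_F[of "T n i"] by (rule subsetD[rotated])
    have L_mono: "i \<le> j \<Longrightarrow> L n i \<subseteq> L n j" for n i j unfolding L_def by (auto dest: less_le_trans)
    have r_small: "\<bar>r n i \<omega>\<bar> \<le> e * (DD n i \<omega>)\<^sup>2" if "\<bar>DD n i \<omega>\<bar> < d" for n i \<omega>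
    proof (rule r_le)
      fix u assume u: "u \<in> closed_segment (Y (T n i) \<omega>) (Y (T n (Suc i)) \<omega>)"
      then have "\<bar>u - Y (T n i) \<omega>\<bar> \<le> \<bar>DD n i \<omega>\<bar>"
        by (auto simp: closed_segment_eq_real_ivl DD_def split: if_splits)
      then have "dist u (Y (T n i) \<omega>) < d" using that by (simp add: dist_real_def)
      then have "dist (h u) (h (Y (T n i) \<omega>)) < e"
        by (intro d(2)[rule_format] range_Y subsetD[OF seg u])
      then show "\<bar>h u - h (Y (T n i) \<omega>)\<bar> \<le> e" by (simp add: dist_real_def)
    qed
    \<comment> \<open>Each step is of one of three kinds: small, costing e times its square; later
      than a large one, paid by the indicator of \<open>L n m\<close>; or the first large one, which
      costs at most 2 H and is paid once by the jump of the indicator from \<open>L n m\<close> to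
      \<open>L n (Suc m)\<close>.\<close>
    have pw: "(\<Sum>i<m. \<bar>r n i \<omega>\<bar>) \<le> e * (\<Sum>i<m. (DD n i \<omega>)\<^sup>2) +
        2 * H * ((\<Sum>i<m. indicator (L n i) \<omega> * (DD n i \<omega>)\<^sup>2) + indicator (L n m) \<omega>)" if w: "\<omega> \<in> space P" for n m \<omega>
    proof (induction m)
      case (Suc m)
      have eD: "0 \<le> e * (DD n m \<omega>)\<^sup>2" using e by simp
      have "\<bar>r n m \<omega>\<bar> \<le> e * (DD n m \<omega>)\<^sup>2 + 2 * H * (indicator (L n m) \<omega> * (DD n m \<omega>)\<^sup>2) +
          2 * H * (indicator (L n (Suc m)) \<omega> - indicator (L n m) \<omega>)"
      proof (cases "\<omega> \<in> L n m")
        case True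
        then have "\<omega> \<in> L n (Suc m)" using L_mono[of m "Suc m" n] by auto
        then show ?thesis using True r_le2[of n m \<omega>] eD by simp
      next
        case False
        show ?thesis
        proof (cases "\<bar>DD n m \<omega>\<bar> < d")
          case True
          have "0 \<le> 2 * H * (indicator (L n (Suc m)) \<omega> :: real)" using H by simp
          then show ?thesis using False r_small[OF True] by simp
        next
          case nless: False
          then have "\<omega> \<in> L n (Suc m)" using w unfolding L_def by (intro CollectI conjI exI[of _ m]) auto
          moreover have "2 * H * (DD n m \<omega>)\<^sup>2 \<le> 2 * H" using DD2[of n m \<omega>] H mult_left_mono[of "(DD n m \<omega>)\<^sup>2" 1 "2 * H"] by simp
          ultimately show ?thesis using False r_le2[of n m \<omega>] eD by simp
        qed
      qed
      then show ?case using Suc by (simp add: algebra_simps)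
    qed (use H in simp)
    let ?p = "\<lambda>n. measure P (L n (Suc n))"
    \<comment> \<open>The variance identity, weighted by the indicator of \<open>L n i\<close>,
      makes the squares that follow a large increment proportional to the cell length times the
      probability that a large one occurs at all.\<close>
    have LD: "(\<integral>\<omega>. indicator (L n i) \<omega> * (DD n i \<omega>)\<^sup>2 \<partial>P) \<le> V * ((t - s) / real (Suc n)) * ?p n \<and>
      integrable P (\<lambda>\<omega>. indicator (L n i) \<omega> * (DD n i \<omega>)\<^sup>2)" if i: "i < Suc n" for n i
    proof
      have "(\<integral>\<omega>. indicator (L n i) \<omega> * (DD n i \<omega>)\<^sup>2 \<partial>P) = (\<integral>\<omega>. indicator (L n i) \<omega> * ?I v n i \<omega> \<partial>P)"
        by (rule varD[of _ n i 1]) (auto intro!: borel_measurable_indicator L_F split: split_indicator)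
      also have "\<dots> \<le> (\<integral>\<omega>. V * ((t - s) / real (Suc n)) * indicator (L n (Suc n)) \<omega> \<partial>P)"
      proof (rule integral_mono)
        show "integrable P (\<lambda>\<omega>. indicator (L n i) \<omega> * ?I v n i \<omega>)"
          by (rule bounded_integrable[OF borel_measurable_times[OF borel_measurable_indicator[OF L_P] integral_measurable[OF v]] abs_mult_le[OF _ VI], of _ _ 1])
            (auto split: split_indicator)
        show "integrable P (\<lambda>\<omega>. V * ((t - s) / real (Suc n)) * indicator (L n (Suc n)) \<omega>)"
          using L_P by (intro integrable_mult_right integrable_real_indicator) (auto simp: emeasure_eq_measure)
        fix \<omega> assume "\<omega> \<in> space P"
        have "\<omega> \<in> L n i \<Longrightarrow> \<omega> \<in> L n (Suc n)" using L_mono[of i "Suc n" n] i by auto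
        then show "indicator (L n i) \<omega> * ?I v n i \<omega> \<le> V * ((t - s) / real (Suc n)) * indicator (L n (Suc n)) \<omega>"
          using VI[of n i \<omega>] V(1) s by (auto split: split_indicator simp del: of_nat_Suc)
      qed
      also have "\<dots> = V * ((t - s) / real (Suc n)) * ?p n"
        using L_P[of n "Suc n"] sets.sets_into_space[OF L_P[of n "Suc n"]] by (simp add: Int_absorb2 del: of_nat_Suc)
      finally show "(\<integral>\<omega>. indicator (L n i) \<omega> * (DD n i \<omega>)\<^sup>2 \<partial>P) \<le> V * ((t - s) / real (Suc n)) * ?p n" .
      show "integrable P (\<lambda>\<omega>. indicator (L n i) \<omega> * (DD n i \<omega>)\<^sup>2)"
        by (rule bounded_integrable[of _ 1], rule borel_measurable_times[OF borel_measurable_indicator[OF L_P] borel_measurable_power[OF DDP]])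
          (auto split: split_indicator simp: DD2)
    qed
    have D2: "(\<integral>\<omega>. (DD n i \<omega>)\<^sup>2 \<partial>P) \<le> V * ((t - s) / real (Suc n))" for n i
    proof -
      have "(\<integral>\<omega>. 1 * (DD n i \<omega>)\<^sup>2 \<partial>P) = (\<integral>\<omega>. 1 * ?I v n i \<omega> \<partial>P)"
        by (rule varD[of _ n i 1]) auto
      also have "\<dots> \<le> (\<integral>\<omega>. V * ((t - s) / real (Suc n)) \<partial>P)"
      proof (rule integral_mono)
        show "integrable P (\<lambda>\<omega>. 1 * ?I v n i \<omega>)"
          unfolding mult_1 by (rule bounded_integrable[OF integral_measurable[OF v] VI])
        show "1 * ?I v n i \<omega> \<le> V * ((t - s) / real (Suc n))" for \<omega>
          using VI[of n i \<omega>] by (simp only: mult_1 abs_le_iff)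
      qed simp
      finally show ?thesis by (simp add: prob_space del: of_nat_Suc)
    qed
    have r_sum: "(\<Sum>i<Suc n. \<integral>\<omega>. \<bar>r n i \<omega>\<bar> \<partial>P) \<le> e * V * (t - s) + 2 * H * (V * (t - s) + 1) * ?p n" for n
    proof -
      have i1: "integrable P (\<lambda>\<omega>. indicator (L n (Suc n)) \<omega> :: real)"
        using L_P by (intro integrable_real_indicator) (auto simp: emeasure_eq_measure)
      have i2: "integrable P (\<lambda>\<omega>. \<Sum>i<Suc n. indicator (L n i) \<omega> * (DD n i \<omega>)\<^sup>2)"
        by (rule Bochner_Integration.integrable_sum) (use LD in auto)
      have i3: "integrable P (\<lambda>\<omega>. \<Sum>i<Suc n. (DD n i \<omega>)\<^sup>2)"
        by (rule Bochner_Integration.integrable_sum) (rule ints)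
      have "(\<Sum>i<Suc n. \<integral>\<omega>. \<bar>r n i \<omega>\<bar> \<partial>P) = (\<integral>\<omega>. (\<Sum>i<Suc n. \<bar>r n i \<omega>\<bar>) \<partial>P)"
        by (rule Bochner_Integration.integral_sum[symmetric]) (rule ints)
      also have "\<dots> \<le> (\<integral>\<omega>. e * (\<Sum>i<Suc n. (DD n i \<omega>)\<^sup>2) +
        2 * H * ((\<Sum>i<Suc n. indicator (L n i) \<omega> * (DD n i \<omega>)\<^sup>2) + indicator (L n (Suc n)) \<omega>) \<partial>P)"
      proof (rule integral_mono)
        show "integrable P (\<lambda>\<omega>. \<Sum>i<Suc n. \<bar>r n i \<omega>\<bar>)"
          by (rule Bochner_Integration.integrable_sum) (rule ints)
        show "integrable P (\<lambda>\<omega>. e * (\<Sum>i<Suc n. (DD n i \<omega>)\<^sup>2) +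
        2 * H * ((\<Sum>i<Suc n. indicator (L n i) \<omega> * (DD n i \<omega>)\<^sup>2) + indicator (L n (Suc n)) \<omega>))"
          by (intro Bochner_Integration.integrable_add integrable_mult_right i1 i2 i3)
      qed (rule pw)
      also have "\<dots> = e * (\<integral>\<omega>. (\<Sum>i<Suc n. (DD n i \<omega>)\<^sup>2) \<partial>P) +
        2 * H * ((\<integral>\<omega>. (\<Sum>i<Suc n. indicator (L n i) \<omega> * (DD n i \<omega>)\<^sup>2) \<partial>P) + (\<integral>\<omega>. indicator (L n (Suc n)) \<omega> \<partial>P))"
        by (simp only: Bochner_Integration.integral_add[OF integrable_mult_right[OF i3] integrable_mult_right[OF Bochner_Integration.integrable_add[OF i2 i1]]]
            Bochner_Integration.integral_add[OF i2 i1] integral_mult_right_zero)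
      also have "(\<integral>\<omega>. indicator (L n (Suc n)) \<omega> \<partial>P) = ?p n"
        using sets.sets_into_space[OF L_P[of n "Suc n"]] by (simp add: Int_absorb2)
      also have "(\<integral>\<omega>. (\<Sum>i<Suc n. (DD n i \<omega>)\<^sup>2) \<partial>P) = (\<Sum>i<Suc n. \<integral>\<omega>. (DD n i \<omega>)\<^sup>2 \<partial>P)"
        by (rule Bochner_Integration.integral_sum) (rule ints)
      also have "(\<integral>\<omega>. (\<Sum>i<Suc n. indicator (L n i) \<omega> * (DD n i \<omega>)\<^sup>2) \<partial>P) = (\<Sum>i<Suc n. \<integral>\<omega>. indicator (L n i) \<omega> * (DD n i \<omega>)\<^sup>2 \<partial>P)"
        by (rule Bochner_Integration.integral_sum) (use LD in auto)
      also have "e * (\<Sum>i<Suc n. \<integral>\<omega>. (DD n i \<omega>)\<^sup>2 \<partial>P) + 2 * H * ((\<Sum>i<Suc n. \<integral>\<omega>. indicator (L n i) \<omega> * (DD n i \<omega>)\<^sup>2 \<partial>P) + ?p n)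
        \<le> e * (\<Sum>i<Suc n. V * ((t - s) / real (Suc n))) + 2 * H * ((\<Sum>i<Suc n. V * ((t - s) / real (Suc n)) * ?p n) + ?p n)"
        using e H LD D2 by (intro add_mono mult_left_mono sum_mono) auto
      also have "\<dots> = e * (V * (t - s)) + 2 * H * (V * (t - s) * ?p n + ?p n)"
      proof -
        have "(\<Sum>i<Suc n. V * ((t - s) / real (Suc n))) = V * (t - s)" by (simp del: of_nat_Suc)
        then show ?thesis by (simp only: sum_distrib_right[symmetric])
      qed
      also have "\<dots> = e * V * (t - s) + 2 * H * (V * (t - s) + 1) * ?p n"
        by (simp add: algebra_simps)
      finally show ?thesis .
    qed
    have p_lim: "?p \<longlonglongrightarrow> 0"
    proof -
      have "(\<lambda>n. \<integral>\<omega>. indicator (L n (Suc n)) \<omega> \<partial>P) \<longlonglongrightarrow> (0::real)"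
      proof (rule dominated_to_zero)
        show "(\<lambda>\<omega>. indicator (L n (Suc n)) \<omega> :: real) \<in> borel_measurable P" for n
          by (rule borel_measurable_indicator[OF L_P])
        show "\<bar>indicator (L n (Suc n)) \<omega> :: real\<bar> \<le> 1" for n \<omega> by (simp split: split_indicator)
        fix \<omega>
        from unif[OF d(1) cont[of \<omega>]] obtain N where
          N: "\<forall>n\<ge>N. \<forall>i<Suc n. \<forall>u\<in>{T n i..T n (Suc i)}. \<bar>Y (T n i) \<omega> - Y u \<omega>\<bar> < d" ..
        have "indicator (L n (Suc n)) \<omega> = (0::real)" if n: "N \<le> n" for n
        proof -
          have "\<bar>DD n j \<omega>\<bar> < d" if "j < Suc n" for j
            using N[rule_format, OF n that, of "T n (Suc j)"] T_mono[of j "Suc j" n] by (simp add: DD_def abs_minus_commute)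
          then show ?thesis by (auto simp: L_def not_le)
        qed
        then show "(\<lambda>n. indicator (L n (Suc n)) \<omega> :: real) \<longlonglongrightarrow> 0"
          by (intro tendsto_eventually eventually_sequentiallyI[of N])
      qed
      moreover have "(\<integral>\<omega>. indicator (L n (Suc n)) \<omega> \<partial>P) = ?p n" for n
        using sets.sets_into_space[OF L_P[of n "Suc n"]] by (simp add: Int_absorb2)
      ultimately show ?thesis by simp
    qed
    \<comment> \<open>As n grows, the Riemann error and the probability of a large increment vanish,
      and only the term with e survives.\<close>
    let ?a = "\<lambda>n. \<bar>\<integral>\<omega>. z \<omega> * R n \<omega> \<partial>P\<bar> / 2 + C * (e * V * (t - s) + 2 * H * (V * (t - s) + 1) * ?p n)"
    have "\<Delta> \<le> ?a n" for n
    proof -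
      have zr: "\<bar>\<integral>\<omega>. z \<omega> * r n i \<omega> \<partial>P\<bar> \<le> C * (\<integral>\<omega>. \<bar>r n i \<omega>\<bar> \<partial>P)" for i
      proof -
        have "\<bar>\<integral>\<omega>. z \<omega> * r n i \<omega> \<partial>P\<bar> \<le> (\<integral>\<omega>. \<bar>z \<omega> * r n i \<omega>\<bar> \<partial>P)" by (rule integral_abs_bound)
        also have "\<dots> \<le> (\<integral>\<omega>. C * \<bar>r n i \<omega>\<bar> \<partial>P)"
        proof (rule integral_mono)
          show "integrable P (\<lambda>\<omega>. \<bar>z \<omega> * r n i \<omega>\<bar>)" by (rule integrable_abs[OF ints(4)])
          show "integrable P (\<lambda>\<omega>. C * \<bar>r n i \<omega>\<bar>)" by (rule integrable_mult_right[OF ints(5)])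
        qed (use C in \<open>auto simp: abs_mult intro!: mult_right_mono\<close>)
        finally show ?thesis by simp
      qed
      have "\<Delta> \<le> \<bar>\<integral>\<omega>. z \<omega> * R n \<omega> \<partial>P\<bar> / 2 + \<bar>\<Sum>i<Suc n. \<integral>\<omega>. z \<omega> * r n i \<omega> \<partial>P\<bar>"
        unfolding \<Delta>_def key[of n] by (rule order_trans[OF abs_triangle_ineq]) simp
      also have "\<bar>\<Sum>i<Suc n. \<integral>\<omega>. z \<omega> * r n i \<omega> \<partial>P\<bar> \<le> (\<Sum>i<Suc n. C * (\<integral>\<omega>. \<bar>r n i \<omega>\<bar> \<partial>P))"
        by (rule order_trans[OF sum_abs sum_mono[OF zr]])
      also have "\<dots> = C * (\<Sum>i<Suc n. \<integral>\<omega>. \<bar>r n i \<omega>\<bar> \<partial>P)" by (simp only: sum_distrib_left)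
      also have "\<dots> \<le> C * (e * V * (t - s) + 2 * H * (V * (t - s) + 1) * ?p n)"
        by (rule mult_left_mono[OF r_sum C0])
      finally show ?thesis by simp
    qed
    moreover have "?a \<longlonglongrightarrow> \<bar>0\<bar> / 2 + C * (e * V * (t - s) + 2 * H * (V * (t - s) + 1) * 0)"
      by (intro tendsto_intros zR_lim p_lim) simp
    ultimately have "\<Delta> \<le> \<bar>0\<bar> / 2 + C * (e * V * (t - s) + 2 * H * (V * (t - s) + 1) * 0)"
      by (intro LIMSEQ_le_const) auto
    then show ?thesis by simp
  qed
  have "\<Delta> = 0"
  proof (rule ccontr)
    assume "\<Delta> \<noteq> 0"
    then have pos: "0 < \<Delta>" by (simp add: \<Delta>_def)
    \<comment> \<open>With e = \<Delta> / (2 q) the bound becomes \<Delta> \<le> \<Delta> / 2; the 1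
      in q guards against division by zero.\<close>
    define q where "q = C * V * (t - s) + 1"
    have q: "0 < q" using C0 V s by (simp add: q_def add_nonneg_pos)
    have "\<Delta> \<le> C * (\<Delta> / (2 * q) * V * (t - s))" by (rule \<Delta>_le) (use pos q in simp)
    also have "\<dots> = (q - 1) * (\<Delta> / (2 * q))" by (simp add: q_def)
    also have "\<dots> \<le> q * (\<Delta> / (2 * q))" using pos q by (intro mult_right_mono) auto
    also have "\<dots> = \<Delta> / 2" using q by simp
    finally show False using pos by simp
  qed
  then show ?thesis by (simp add: \<Delta>_def)
qed

end

section \<open>Optional stopping and exit times\<close>

lemma sum_indicator_initial_segment:
  fixes d :: "nat \<Rightarrow> real"
  shows "(\<Sum>i<m. (if i < k then d i else 0)) = (\<Sum>i<min m k. d i)"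
proof -
  have "{..<m} \<inter> {i. i < k} = {..<min m k}" by auto
  then show ?thesis by (simp add: sum.If_cases)
qed

context bounded_diffusion
begin

text \<open>\<open>N\<close> is f(Y) minus its compensator, a martingale by Dynkin's formula with
  indicator weights. \<tau> is rounded up to a grid, within a growing horizon, and \<open>N\<close>
  at the rounded time is a sum of increments over the events that \<tau> exceeds a grid point, each
  of mean zero. As f is bounded and the compensator grows at most linearly, integrability of \<tau>
  supplies the majorant for the limit.\<close>

lemma optional_stopping:
  fixes \<tau> :: "'a \<Rightarrow> ennreal"
  assumes f: "\<And>u. u \<in> {0..1} \<Longrightarrow> (f has_real_derivative f' u) (at u within {0..1})"
    and f': "\<And>u. u \<in> {0..1} \<Longrightarrow> (f' has_real_derivative h u) (at u within {0..1})"
    and h: "continuous_on {0..1} h"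
    and \<tau>: "\<tau> \<in> borel_measurable P" and stop: "\<And>t. 0 \<le> t \<Longrightarrow> {\<omega> \<in> space P. \<tau> \<omega> \<le> ennreal t} \<in> sets (F t)"
    and fin: "(\<integral>\<^sup>+\<omega>. \<tau> \<omega> \<partial>P) < \<infinity>"
  shows "integrable P (\<lambda>\<omega>. enn2real (\<tau> \<omega>))"
    and "(\<lambda>\<omega>. Y (enn2real (\<tau> \<omega>)) \<omega>) \<in> borel_measurable P"
    and "integrable P (\<lambda>\<omega>. integral {0..enn2real (\<tau> \<omega>)} (\<lambda>u. h (Y u \<omega>) * v (Y u \<omega>) / 2))"
    and "(\<integral>\<omega>. f (Y (enn2real (\<tau> \<omega>)) \<omega>) \<partial>P) =
      f x + (\<integral>\<omega>. integral {0..enn2real (\<tau> \<omega>)} (\<lambda>u. h (Y u \<omega>) * v (Y u \<omega>) / 2) \<partial>P)"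
proof -
  let ?T = "\<lambda>\<omega>. enn2real (\<tau> \<omega>)"
  define k where "k y = h y * v y / 2" for y
  have k: "continuous_on {0..1} k" unfolding k_def using h v by (intro continuous_intros) auto
  have fc: "continuous_on {0..1} f" by (rule DERIV_continuous_on[OF f])
  obtain D where "0 \<le> D" "\<forall>y\<in>{0..1}. \<bar>f y\<bar> \<le> D" using continuous_bounded[OF fc] by blast
  then have D: "0 \<le> D" "\<And>y. y \<in> {0..1} \<Longrightarrow> \<bar>f y\<bar> \<le> D" by auto
  obtain C where "0 \<le> C" "\<forall>y\<in>{0..1}. \<bar>k y\<bar> \<le> C" using continuous_bounded[OF k] by blast
  then have C: "0 \<le> C" "\<And>y. y \<in> {0..1} \<Longrightarrow> \<bar>k y\<bar> \<le> C" by auto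
  have Tm: "?T \<in> borel_measurable P" using \<tau> by measurable
  have AEfin: "AE \<omega> in P. \<tau> \<omega> \<noteq> \<infinity>"
    by (rule nn_integral_PInf_AE[OF \<tau>]) (use fin in auto)
  show Ti: "integrable P ?T"
  proof (rule integrableI_nonneg[OF Tm])
    have "(\<integral>\<^sup>+\<omega>. ennreal (?T \<omega>) \<partial>P) \<le> (\<integral>\<^sup>+\<omega>. \<tau> \<omega> \<partial>P)"
      by (rule nn_integral_mono) (simp add: ennreal_enn2real_if)
    then show "(\<integral>\<^sup>+\<omega>. ennreal (?T \<omega>) \<partial>P) < \<infinity>" using fin by (rule le_less_trans)
  qed simp
  \<comment> \<open>With \<open>max 0 t\<close> the compensator is continuous on the whole line, as
    \<open>continuous_process_measurable\<close> expects; evaluation at the random time is then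
    measurable.\<close>
  define A where "A t \<omega> = integral {0..max 0 t} (\<lambda>u. k (Y u \<omega>))" for t \<omega>
  have A_diff: "A t \<omega> - A s \<omega> = integral {s..t} (\<lambda>u. k (Y u \<omega>))" if "0 \<le> s" "s \<le> t" for s t \<omega>
  proof -
    have "(\<lambda>u. k (Y u \<omega>)) integrable_on {0..t}"
      by (intro integrable_continuous_interval comp_continuous[OF k])
    then have "integral {0..s} (\<lambda>u. k (Y u \<omega>)) + integral {s..t} (\<lambda>u. k (Y u \<omega>)) = integral {0..t} (\<lambda>u. k (Y u \<omega>))"
      using that by (intro Henstock_Kurzweil_Integration.integral_combine) auto
    then show ?thesis using that by (simp add: A_def max_absorb2)
  qed
  have A_lip0: "\<bar>A t \<omega> - A s \<omega>\<bar> \<le> C * \<bar>t - s\<bar>" if "s \<le> t" for s t \<omega>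
  proof -
    have "A t \<omega> - A s \<omega> = A (max 0 t) \<omega> - A (max 0 s) \<omega>" by (simp add: A_def)
    also have "\<dots> = integral {max 0 s..max 0 t} (\<lambda>u. k (Y u \<omega>))" using that by (intro A_diff) auto
    finally have "\<bar>A t \<omega> - A s \<omega>\<bar> \<le> C * (max 0 t - max 0 s)"
      using integral_bound[OF k C(2), of "max 0 s" "max 0 t" \<omega>] that by simp
    also have "\<dots> \<le> C * \<bar>t - s\<bar>" using C(1) that by (intro mult_left_mono) auto
    finally show ?thesis .
  qed
  have A_cont: "continuous_on UNIV (\<lambda>t. A t \<omega>)" for \<omega>
  proof (rule lipschitz_on_continuous_on[of C], rule lipschitz_onI)
    show "dist (A t \<omega>) (A s \<omega>) \<le> C * dist t s" for t s
      using A_lip0[of s t \<omega>] A_lip0[of t s \<omega>] by (cases "s \<le> t") (auto simp: dist_real_def abs_minus_commute)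
  qed (rule C)
  have A_bd: "\<bar>A t \<omega>\<bar> \<le> C * t" if "0 \<le> t" for t \<omega>
    using A_lip0[of 0 t \<omega>] that by (simp add: A_def)
  have AP: "A t \<in> borel_measurable P" for t
    unfolding A_def[abs_def] by (rule integral_measurable[OF k])
  have pairm: "(\<lambda>\<omega>. (\<omega>, ?T \<omega>)) \<in> measurable P (P \<Otimes>\<^sub>M lborel)" using Tm by measurable
  show YT: "(\<lambda>\<omega>. Y (?T \<omega>) \<omega>) \<in> borel_measurable P"
    using measurable_compose[OF pairm continuous_process_measurable[OF Y_measurable cont]] by simp
  have AT: "(\<lambda>\<omega>. A (?T \<omega>) \<omega>) \<in> borel_measurable P"
    using measurable_compose[OF pairm continuous_process_measurable[OF AP A_cont]] by simp
  have A_eq: "A (?T \<omega>) \<omega> = integral {0..?T \<omega>} (\<lambda>u. h (Y u \<omega>) * v (Y u \<omega>) / 2)" for \<omega>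
    by (simp add: A_def k_def max_absorb2)
  have ATi: "integrable P (\<lambda>\<omega>. A (?T \<omega>) \<omega>)"
  proof (rule Bochner_Integration.integrable_bound[OF _ AT])
    show "integrable P (\<lambda>\<omega>. C * ?T \<omega>)" using Ti by simp
    show "AE \<omega> in P. norm (A (?T \<omega>) \<omega>) \<le> norm (C * ?T \<omega>)"
      using A_bd[OF enn2real_nonneg] C(1) by (simp add: abs_mult)
  qed
  then show "integrable P (\<lambda>\<omega>. integral {0..enn2real (\<tau> \<omega>)} (\<lambda>u. h (Y u \<omega>) * v (Y u \<omega>) / 2))"
    by (simp only: A_eq)
  define N where "N t \<omega> = f (Y t \<omega>) - A t \<omega>" for t \<omega>
  have NP: "N t \<in> borel_measurable P" for t
    unfolding N_def[abs_def] by (rule borel_measurable_diff[OF comp_P[OF fc] AP])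
  have N_cont: "continuous_on UNIV (\<lambda>t. N t \<omega>)" for \<omega>
    unfolding N_def by (intro continuous_intros comp_continuous[OF fc] A_cont)
  have N_bd: "\<bar>N t \<omega>\<bar> \<le> D + C * t" if "0 \<le> t" for t \<omega>
    using D(2)[OF range_Y[of t \<omega>]] A_bd[OF that, of \<omega>] unfolding N_def by linarith
  have Ni: "integrable P (N t)" if "0 \<le> t" for t
    by (rule bounded_integrable[OF NP N_bd[OF that]])
  have N_mart: "(\<integral>\<omega>. indicator L \<omega> * (N t \<omega> - N s \<omega>) \<partial>P) = 0 \<and> integrable P (\<lambda>\<omega>. indicator L \<omega> * (N t \<omega> - N s \<omega>))"
    if "0 \<le> s" "s \<le> t" "L \<in> sets (F s)" for s t L
  proof -
    have L: "L \<in> sets P" using that(3) sets_F[of s] by blast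
    have Lm: "(indicator L :: 'a \<Rightarrow> real) \<in> borel_measurable (F s)" by (rule borel_measurable_indicator[OF that(3)])
    have L1: "\<bar>indicator L \<omega> :: real\<bar> \<le> 1" for \<omega> by (simp split: split_indicator)
    have 1: "(\<integral>\<omega>. indicator L \<omega> * (f (Y t \<omega>) - f (Y s \<omega>)) \<partial>P) = (\<integral>\<omega>. indicator L \<omega> * integral {s..t} (\<lambda>u. k (Y u \<omega>)) \<partial>P)"
      unfolding k_def by (rule dynkin[OF f f' h that(1,2) Lm L1])
    have i1: "integrable P (\<lambda>\<omega>. indicator L \<omega> * (f (Y t \<omega>) - f (Y s \<omega>)))"
    proof (rule bounded_integrable)
      show "(\<lambda>\<omega>. indicator L \<omega> * (f (Y t \<omega>) - f (Y s \<omega>))) \<in> borel_measurable P"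
        by (intro borel_measurable_times borel_measurable_diff borel_measurable_indicator L comp_P fc)
      show "\<bar>indicator L \<omega> * (f (Y t \<omega>) - f (Y s \<omega>))\<bar> \<le> 1 * (2 * D)" for \<omega>
        using D(2)[OF range_Y[of t \<omega>]] D(2)[OF range_Y[of s \<omega>]] by (intro abs_mult_le L1) linarith
    qed
    have i2: "integrable P (\<lambda>\<omega>. indicator L \<omega> * integral {s..t} (\<lambda>u. k (Y u \<omega>)))"
    proof (rule bounded_integrable)
      show "(\<lambda>\<omega>. indicator L \<omega> * integral {s..t} (\<lambda>u. k (Y u \<omega>))) \<in> borel_measurable P"
        by (intro borel_measurable_times borel_measurable_indicator L integral_measurable k)
      show "\<bar>indicator L \<omega> * integral {s..t} (\<lambda>u. k (Y u \<omega>))\<bar> \<le> 1 * (C * (t - s))" for \<omega>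
        by (intro abs_mult_le L1 integral_bound k C(2) that(2))
    qed
    have "indicator L \<omega> * (N t \<omega> - N s \<omega>) = indicator L \<omega> * (f (Y t \<omega>) - f (Y s \<omega>)) - indicator L \<omega> * integral {s..t} (\<lambda>u. k (Y u \<omega>))" for \<omega>
      unfolding N_def A_diff[OF that(1,2), symmetric] by (simp add: algebra_simps)
    then show ?thesis using 1 i1 i2 by simp
  qed
  define t where "t n i = real i / real (Suc n)" for n i :: nat
  have t0: "0 \<le> t n i" and t_step: "t n i \<le> t n (Suc i)" for n i by (auto simp: t_def divide_right_mono)
  \<comment> \<open>(n + 1)^2 cells of length 1/(n + 1) reach time n + 1: the mesh shrinks and the
    horizon grows together.\<close>
  define m where "m n = Suc n * Suc n" for n
  define L where "L n i = {\<omega> \<in> space P. \<not> \<tau> \<omega> \<le> ennreal (t n i)}" for n i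
  have LF: "L n i \<in> sets (F (t n i))" for n i
  proof -
    have "space (F (t n i)) - {\<omega> \<in> space P. \<tau> \<omega> \<le> ennreal (t n i)} \<in> sets (F (t n i))"
      by (intro sets.compl_sets stop t0)
    moreover have "space (F (t n i)) - {\<omega> \<in> space P. \<tau> \<omega> \<le> ennreal (t n i)} = L n i"
      by (auto simp: L_def space_F)
    ultimately show ?thesis by simp
  qed
  define S where "S n \<omega> = N 0 \<omega> + (\<Sum>i<m n. indicator (L n i) \<omega> * (N (t n (Suc i)) \<omega> - N (t n i) \<omega>))" for n \<omega>
  note mart = N_mart[OF t0 t_step LF]
  have ES: "(\<integral>\<omega>. S n \<omega> \<partial>P) = f x" for n
  proof -
    have "(\<integral>\<omega>. S n \<omega> \<partial>P) = (\<integral>\<omega>. N 0 \<omega> \<partial>P) + (\<Sum>i<m n. \<integral>\<omega>. indicator (L n i) \<omega> * (N (t n (Suc i)) \<omega> - N (t n i) \<omega>) \<partial>P)"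
    proof -
      have "integrable P (\<lambda>\<omega>. \<Sum>i<m n. indicator (L n i) \<omega> * (N (t n (Suc i)) \<omega> - N (t n i) \<omega>))"
        by (rule Bochner_Integration.integrable_sum) (rule conjunct2[OF mart])
      then show ?thesis
        unfolding S_def Bochner_Integration.integral_sum[OF conjunct2[OF mart], symmetric]
        by (rule Bochner_Integration.integral_add[OF Ni[OF order_refl]])
    qed
    also have "\<dots> = (\<integral>\<omega>. N 0 \<omega> \<partial>P)" using mart by simp
    also have "\<dots> = f x" by (simp add: N_def A_def Y_0 prob_space)
    finally show ?thesis .
  qed
  \<comment> \<open>Index of the first grid point not before \<tau>, capped at the horizon.\<close>
  define K where "K n \<omega> = min (m n) (nat \<lceil>real (Suc n) * ?T \<omega>\<rceil>)" for n \<omega>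
  have S_eq: "S n \<omega> = N (t n (K n \<omega>)) \<omega>" if w: "\<omega> \<in> space P" "\<tau> \<omega> \<noteq> \<infinity>" for n \<omega>
  proof -
    have tau: "\<tau> \<omega> = ennreal (?T \<omega>)" using w(2) by (simp add: ennreal_enn2real_if)
    have "\<omega> \<in> L n i \<longleftrightarrow> i < nat \<lceil>real (Suc n) * ?T \<omega>\<rceil>" for i
    proof -
      have "\<tau> \<omega> \<le> ennreal (t n i) \<longleftrightarrow> ?T \<omega> \<le> t n i"
        using arg_cong[OF tau, of "\<lambda>y. y \<le> ennreal (t n i)"] unfolding ennreal_le_iff[OF t0] .
      then have "\<omega> \<in> L n i \<longleftrightarrow> \<not> ?T \<omega> \<le> t n i" using w(1) unfolding L_def mem_Collect_eq by blast
      also have "\<dots> \<longleftrightarrow> t n i < ?T \<omega>" by (rule not_le)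
      finally have "\<omega> \<in> L n i \<longleftrightarrow> t n i < ?T \<omega>" .
      also have "\<dots> \<longleftrightarrow> real i < real (Suc n) * ?T \<omega>" unfolding t_def by (simp add: pos_divide_less_eq mult.commute del: of_nat_Suc)
      also have "\<dots> \<longleftrightarrow> int i < \<lceil>real (Suc n) * ?T \<omega>\<rceil>" by (simp add: less_ceiling_iff)
      also have "\<dots> \<longleftrightarrow> i < nat \<lceil>real (Suc n) * ?T \<omega>\<rceil>" by linarith
      finally show ?thesis .
    qed
    then have "(\<Sum>i<m n. indicator (L n i) \<omega> * (N (t n (Suc i)) \<omega> - N (t n i) \<omega>)) =
      (\<Sum>i<m n. if i < nat \<lceil>real (Suc n) * ?T \<omega>\<rceil> then N (t n (Suc i)) \<omega> - N (t n i) \<omega> else 0)"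
      by (intro sum.cong) (auto split: split_indicator)
    also have "\<dots> = (\<Sum>i<K n \<omega>. N (t n (Suc i)) \<omega> - N (t n i) \<omega>)"
      unfolding K_def by (rule sum_indicator_initial_segment)
    also have "\<dots> = N (t n (K n \<omega>)) \<omega> - N (t n 0) \<omega>" by (rule sum_lessThan_telescope)
    finally show ?thesis by (simp add: S_def t_def)
  qed
  have tK_le: "t n (K n \<omega>) \<le> ?T \<omega> + 1 / real (Suc n)" for n \<omega>
  proof -
    have ceil: "real (nat \<lceil>p\<rceil>) \<le> p + 1" if "0 \<le> p" for p :: real using that by linarith
    have "real (K n \<omega>) \<le> real (nat \<lceil>real (Suc n) * ?T \<omega>\<rceil>)"
      unfolding K_def by (simp only: of_nat_le_iff min.cobounded2)
    also have "\<dots> \<le> real (Suc n) * ?T \<omega> + 1" by (rule ceil) simp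
    finally have "real (K n \<omega>) / real (Suc n) \<le> (real (Suc n) * ?T \<omega> + 1) / real (Suc n)" by (rule divide_right_mono) simp
    also have "\<dots> = ?T \<omega> + 1 / real (Suc n)" by (simp add: add_divide_distrib del: of_nat_Suc)
    finally show ?thesis by (simp add: t_def)
  qed
  have tK_ge: "?T \<omega> \<le> t n (K n \<omega>)" if n: "?T \<omega> \<le> real (Suc n)" for n \<omega>
  proof -
    have "real (Suc n) * ?T \<omega> \<le> real (m n)" using n unfolding m_def of_nat_mult by (intro mult_left_mono) auto
    moreover have "real (Suc n) * ?T \<omega> \<le> real (nat \<lceil>real (Suc n) * ?T \<omega>\<rceil>)" by (rule of_nat_ceiling)
    ultimately have "real (Suc n) * ?T \<omega> \<le> real (K n \<omega>)"
      unfolding K_def of_nat_min by (rule min.boundedI)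
    then show ?thesis by (simp add: t_def pos_le_divide_eq mult.commute del: of_nat_Suc)
  qed
  have tK_lim: "(\<lambda>n. t n (K n \<omega>)) \<longlonglongrightarrow> ?T \<omega>" for \<omega>
  proof (rule tendsto_sandwich[OF _ _ tendsto_const])
    obtain n0 :: nat where n0: "?T \<omega> \<le> real n0" using real_arch_simple by blast
    show "\<forall>\<^sub>F n in sequentially. ?T \<omega> \<le> t n (K n \<omega>)"
    proof (rule eventually_sequentiallyI[of n0])
      fix n assume "n0 \<le> n"
      then have "real n0 \<le> real (Suc n)" by simp
      with n0 show "?T \<omega> \<le> t n (K n \<omega>)" by (intro tK_ge) linarith
    qed
    show "\<forall>\<^sub>F n in sequentially. t n (K n \<omega>) \<le> ?T \<omega> + 1 / real (Suc n)" using tK_le by simp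
    show "(\<lambda>n. ?T \<omega> + 1 / real (Suc n)) \<longlonglongrightarrow> ?T \<omega>"
      using tendsto_add[OF tendsto_const lim_1_over_n[THEN LIMSEQ_Suc], of "?T \<omega>"] by simp
  qed
  have "(\<lambda>n. \<integral>\<omega>. S n \<omega> \<partial>P) \<longlonglongrightarrow> (\<integral>\<omega>. N (?T \<omega>) \<omega> \<partial>P)"
  \<comment> \<open>The grid time exceeds \<tau> by at most 1/(n + 1), hence the + 1 in the
    majorant.\<close>
  proof (rule integral_dominated_convergence[where w="\<lambda>\<omega>. D + C * (?T \<omega> + 1)"])
    show "(\<lambda>\<omega>. N (?T \<omega>) \<omega>) \<in> borel_measurable P"
      unfolding N_def using comp_measurable[OF fc YT] range_Y AT by (intro borel_measurable_diff) auto
    show "S n \<in> borel_measurable P" for n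
      unfolding S_def[abs_def]
      by (intro borel_measurable_add NP borel_measurable_sum borel_measurable_integrable[OF conjunct2[OF mart]])
    show "integrable P (\<lambda>\<omega>. D + C * (?T \<omega> + 1))" using Ti by simp
    show "AE \<omega> in P. (\<lambda>n. S n \<omega>) \<longlonglongrightarrow> N (?T \<omega>) \<omega>"
      using AEfin AE_space
    proof eventually_elim
      case (elim \<omega>)
      have "isCont (\<lambda>t. N t \<omega>) (?T \<omega>)" using N_cont[of \<omega>] by (simp add: continuous_on_eq_continuous_at)
      then have "(\<lambda>n. N (t n (K n \<omega>)) \<omega>) \<longlonglongrightarrow> N (?T \<omega>) \<omega>" by (rule isCont_tendsto_compose[OF _ tK_lim])
      then show ?case using S_eq[of \<omega>] elim by simp
    qed
    show "AE \<omega> in P. norm (S n \<omega>) \<le> D + C * (?T \<omega> + 1)" for n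
      using AEfin AE_space
    proof eventually_elim
      case (elim \<omega>)
      have "\<bar>S n \<omega>\<bar> \<le> D + C * t n (K n \<omega>)" using S_eq[of \<omega> n] N_bd[OF t0, of n "K n \<omega>" \<omega>] elim by simp
      also have "\<dots> \<le> D + C * (?T \<omega> + 1)"
      proof -
        have "1 / real (Suc n) \<le> 1" by simp
        then have "t n (K n \<omega>) \<le> ?T \<omega> + 1" using tK_le[of n \<omega>] by linarith
        then show ?thesis using C(1) by (simp add: mult_left_mono)
      qed
      finally show ?case by simp
    qed
  qed
  then have "(\<integral>\<omega>. N (?T \<omega>) \<omega> \<partial>P) = f x" unfolding ES by (simp add: LIMSEQ_const_iff)
  moreover have "integrable P (\<lambda>\<omega>. f (Y (?T \<omega>) \<omega>))"
    by (rule bounded_integrable[OF comp_measurable[OF fc YT range_Y] D(2)[OF range_Y]])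
  ultimately show "(\<integral>\<omega>. f (Y (enn2real (\<tau> \<omega>)) \<omega>) \<partial>P) =
      f x + (\<integral>\<omega>. integral {0..enn2real (\<tau> \<omega>)} (\<lambda>u. h (Y u \<omega>) * v (Y u \<omega>) / 2) \<partial>P)"
    using ATi unfolding A_eq[symmetric] N_def by simp
qed

text \<open>The function \<open>d\<close> is positive exactly on (a, b). The path has left the
  interval by time t iff \<open>d\<close> gets below every 1/(k + 1) at some rational parameter:
  continuity gives one direction, attainment of the minimum on [0, t] the other. Only values up to t
  are inspected, so the event is known at t itself.\<close>

lemma exit_event:
  assumes t: "0 \<le> t"
  shows "{\<omega> \<in> space P. \<exists>s\<in>{0..t}. Y s \<omega> \<notin> {a<..<b}} \<in> sets (F t)"
proof -
  define d where "d y = min (y - a) (b - y)" for y :: real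
  \<comment> \<open>Maps the whole line onto [0, t], so that rational parameters suffice even if t
    is 0 or irrational.\<close>
  define q where "q r = t * max 0 (min 1 r)" for r :: real
  have d: "continuous_on UNIV d" unfolding d_def by (intro continuous_intros)
  have q: "continuous_on UNIV q" unfolding q_def by (intro continuous_intros)
  have q01: "q r \<in> {0..t}" for r
    using t mult_left_mono[of "max 0 (min 1 r)" 1 t] by (auto simp: q_def)
  have q_surj: "\<exists>r. q r = s" if "s \<in> {0..t}" for s
  proof (cases "t = 0")
    case False
    then show ?thesis using that t by (intro exI[of _ "s / t"]) (auto simp: q_def)
  qed (use that in \<open>auto simp: q_def\<close>)
  have dYq: "continuous_on UNIV (\<lambda>r. d (Y (q r) \<omega>))" for \<omega>
    by (rule continuous_on_compose2[OF d continuous_on_compose2[OF cont q]]) auto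
  have eq: "(\<exists>s\<in>{0..t}. Y s \<omega> \<notin> {a<..<b}) \<longleftrightarrow> (\<forall>k::nat. \<exists>r::rat. d (Y (q (of_rat r)) \<omega>) < 1 / real (Suc k))" for \<omega>
  proof
    assume "\<exists>s\<in>{0..t}. Y s \<omega> \<notin> {a<..<b}"
    then obtain s where s: "s \<in> {0..t}" "Y s \<omega> \<notin> {a<..<b}" by blast
    obtain r0 where "q r0 = s" using q_surj[OF s(1)] by blast
    then have r0: "d (Y (q r0) \<omega>) \<le> 0" using s(2) by (auto simp: d_def min_def)
    show "\<forall>k::nat. \<exists>r::rat. d (Y (q (of_rat r)) \<omega>) < 1 / real (Suc k)"
    proof
      fix k :: nat
      have "isCont (\<lambda>r. d (Y (q r) \<omega>)) r0" using dYq[of \<omega>] by (simp add: continuous_on_eq_continuous_at)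
      then have "\<forall>\<^sub>F r in at_right r0. d (Y (q r) \<omega>) < 1 / real (Suc k)"
      proof (rule order_tendstoD(2)[OF tendsto_mono[OF at_le[OF subset_UNIV] isContD]])
        show "d (Y (q r0) \<omega>) < 1 / real (Suc k)" using r0 by (rule le_less_trans) simp
      qed
      then obtain b where b: "b > r0" "\<forall>r>r0. r < b \<longrightarrow> d (Y (q r) \<omega>) < 1 / real (Suc k)"
        unfolding eventually_at_right_field by blast
      obtain r where "r0 < of_rat r" "of_rat r < b" using of_rat_dense[OF b(1)] by blast
      then show "\<exists>r::rat. d (Y (q (of_rat r)) \<omega>) < 1 / real (Suc k)" using b(2) by blast
    qed
  next
    assume *: "\<forall>k::nat. \<exists>r::rat. d (Y (q (of_rat r)) \<omega>) < 1 / real (Suc k)"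
    have "continuous_on {0..t} (\<lambda>s. d (Y s \<omega>))"
      by (rule continuous_on_compose2[OF d path_continuous]) simp
    then obtain s where s: "s \<in> {0..t}" "\<forall>u\<in>{0..t}. d (Y s \<omega>) \<le> d (Y u \<omega>)"
      using continuous_attains_inf[of "{0..t}" "\<lambda>s. d (Y s \<omega>)"] t by auto
    have "d (Y s \<omega>) \<le> 1 / real (Suc k)" for k
      using *[rule_format, of k] s(2) q01 by (meson less_imp_le order_trans)
    then have "d (Y s \<omega>) \<le> 0"
      using LIMSEQ_le_const[OF lim_1_over_n[THEN LIMSEQ_Suc], of "d (Y s \<omega>)"] by blast
    then show "\<exists>s\<in>{0..t}. Y s \<omega> \<notin> {a<..<b}" using s(1) by (intro bexI[of _ s]) (auto simp: d_def)
  qed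
  have dm: "(\<lambda>\<omega>. d (Y (q r) \<omega>)) \<in> borel_measurable (F t)" for r
    using q01[of r] by (intro comp_F continuous_on_subset[OF d]) auto
  have "Measurable.pred (F t) (\<lambda>\<omega>. \<forall>k::nat. \<exists>r::rat. d (Y (q (of_rat r)) \<omega>) < 1 / real (Suc k))"
    using dm by (intro pred_intros_countable borel_measurable_pred_less borel_measurable_const)
  then show ?thesis unfolding eq by (simp add: pred_def space_F)
qed

text \<open>Capping at N makes the time integrable at once. The set of exit instants is closed, so
  its infimum is attained, and continuity places the path exactly on a or b there.\<close>

lemma exit_time:
  assumes N: "0 \<le> N" and x: "a < x" "x < b"
  obtains T where "\<And>\<omega>. 0 \<le> T \<omega>" "\<And>\<omega>. T \<omega> \<le> N" "\<And>t. 0 \<le> t \<Longrightarrow> {\<omega> \<in> space P. T \<omega> \<le> t} \<in> sets (F t)"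
    "\<And>\<omega> u. u \<in> {0..T \<omega>} \<Longrightarrow> Y u \<omega> \<in> {a..b}" "\<And>\<omega>. T \<omega> < N \<Longrightarrow> Y (T \<omega>) \<omega> \<in> {a, b}"
proof
  define E where "E \<omega> = {s \<in> {0..N}. Y s \<omega> \<in> - {a<..<b}}" for \<omega>
  \<comment> \<open>Inserting N caps the time and keeps the set nonempty when there is no exit up to
    N.\<close>
  define T where "T \<omega> = Inf (insert N (E \<omega>))" for \<omega>
  have clE: "closed (insert N (E \<omega>))" for \<omega>
  proof -
    have "closed ((\<lambda>s. Y s \<omega>) -` (- {a<..<b}) \<inter> {0..N})"
      by (intro closed_Int continuous_closed_vimage) (use cont[of \<omega>] in \<open>auto simp: continuous_on_eq_continuous_at\<close>)
    also have "(\<lambda>s. Y s \<omega>) -` (- {a<..<b}) \<inter> {0..N} = E \<omega>" by (auto simp: E_def)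
    finally show ?thesis by (rule closed_insert)
  qed
  have bdd: "bdd_below (insert N (E \<omega>))" for \<omega>
    by (rule bdd_belowI[of _ 0]) (use N in \<open>auto simp: E_def\<close>)
  have T_in: "T \<omega> \<in> insert N (E \<omega>)" for \<omega>
    unfolding T_def by (rule closed_contains_Inf[OF _ bdd clE]) simp
  have T_le: "T \<omega> \<le> s" if "s \<in> insert N (E \<omega>)" for s \<omega>
    unfolding T_def by (rule cInf_lower[OF that bdd])
  show T0: "0 \<le> T \<omega>" for \<omega> using T_in[of \<omega>] N by (auto simp: E_def)
  show TN: "T \<omega> \<le> N" for \<omega> by (rule T_le) simp
  have before: "Y u \<omega> \<in> {a<..<b}" if "0 \<le> u" "u < T \<omega>" for u \<omega>
    using T_le[of u \<omega>] that TN[of \<omega>] by (auto simp: E_def not_le[symmetric])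
  show closed: "Y u \<omega> \<in> {a..b}" if u: "u \<in> {0..T \<omega>}" for u \<omega>
  proof (cases "T \<omega> = 0")
    case True
    then show ?thesis using u x Y_0 by auto
  next
    case False
    have "continuous_on (closure {0..<T \<omega>}) (\<lambda>s. Y s \<omega>)" by (rule path_continuous)
    then have "(\<lambda>s. Y s \<omega>) ` closure {0..<T \<omega>} \<subseteq> {a..b}"
    proof (rule image_closure_subset)
      show "(\<lambda>s. Y s \<omega>) ` {0..<T \<omega>} \<subseteq> {a..b}" using before[of _ \<omega>] by fastforce
    qed simp
    moreover have "u \<in> closure {0..<T \<omega>}" using False T0[of \<omega>] u by simp
    ultimately show ?thesis by blast
  qed
  show "Y (T \<omega>) \<omega> \<in> {a, b}" if "T \<omega> < N" for \<omega>
    using T_in[of \<omega>] that closed[of "T \<omega>" \<omega>] T0[of \<omega>] by (auto simp: E_def)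
  show "{\<omega> \<in> space P. T \<omega> \<le> t} \<in> sets (F t)" if t: "0 \<le> t" for t
  proof (cases "N \<le> t")
    case True
    then have "{\<omega> \<in> space P. T \<omega> \<le> t} = space (F t)" using TN order_trans by (auto simp: space_F)
    then show ?thesis by simp
  next
    case False
    have "T \<omega> \<le> t \<longleftrightarrow> (\<exists>s\<in>{0..t}. Y s \<omega> \<notin> {a<..<b})" for \<omega>
    proof
      assume "T \<omega> \<le> t"
      then show "\<exists>s\<in>{0..t}. Y s \<omega> \<notin> {a<..<b}" using T_in[of \<omega>] False T0[of \<omega>] by (auto simp: E_def)
    next
      assume "\<exists>s\<in>{0..t}. Y s \<omega> \<notin> {a<..<b}"
      then obtain s where s: "s \<in> {0..t}" "Y s \<omega> \<notin> {a<..<b}" by blast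
      then have "s \<in> E \<omega>" using False by (auto simp: E_def)
      then show "T \<omega> \<le> t" using T_le[of s \<omega>] s by auto
    qed
    then show ?thesis using exit_event[OF t] by simp
  qed
qed

end

section \<open>Bitangents and test functions\<close>

text \<open>Strict monotonicity of \<open>H1\<close> on three consecutive intervals stands in for
  the signs of a second derivative; the geometry below rests on it, the mean value theorem and the
  blow-up at 0 and 1.\<close>

locale convex_concave_convex =
  fixes H H1 :: "real \<Rightarrow> real" and a b :: real
  assumes ab: "0 < a" "a < b" "b < 1"
    and DH: "x \<in> {0<..<1} \<Longrightarrow> (H has_real_derivative H1 x) (at x)"
    and inc_left: "0 < x \<Longrightarrow> x < y \<Longrightarrow> y \<le> a \<Longrightarrow> H1 x < H1 y"
    and dec_mid: "a \<le> x \<Longrightarrow> x < y \<Longrightarrow> y \<le> b \<Longrightarrow> H1 y < H1 x"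
    and inc_right: "b \<le> x \<Longrightarrow> x < y \<Longrightarrow> y < 1 \<Longrightarrow> H1 x < H1 y"
    and lim_0: "filterlim H at_top (at_right 0)"
    and lim_1: "filterlim H at_top (at_left 1)"
begin

lemma mvt:
  assumes "0 < x" "x < y" "y < 1"
  obtains z where "x < z" "z < y" "H y - H x = (y - x) * H1 z"
proof -
  have "\<exists>z. x < z \<and> z < y \<and> H y - H x = (y - x) * H1 z"
  proof (rule MVT2[OF assms(2)])
    show "(H has_real_derivative H1 w) (at w)" if "x \<le> w" "w \<le> y" for w
      by (rule DH) (use that assms in simp)
  qed
  then show ?thesis using that by blast
qed

definition bitangent :: "real \<Rightarrow> real \<Rightarrow> bool" where
  "bitangent A B \<longleftrightarrow> 0 < A \<and> A < B \<and> B < 1 \<and> H1 A = H1 B \<and> H1 B = (H B - H A) / (B - A)"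

text \<open>The mean value theorem provides a third point C between A and B with the same slope.
  \<open>H1\<close> is injective on each of the three pieces, so A, C and B lie on different ones,
  in this order.\<close>

lemma bitangent_location:
  assumes "bitangent A B"
  obtains C where "A < a" "b < B" "a < C" "C < b" "H1 C = H1 A"
proof -
  have AB: "0 < A" "A < B" "B < 1" "H1 A = H1 B" "H1 B = (H B - H A) / (B - A)"
    using assms by (auto simp: bitangent_def)
  obtain C where C: "A < C" "C < B" "H B - H A = (B - A) * H1 C" using mvt AB by metis
  have "H1 B = (B - A) * H1 C / (B - A)" using AB(5) unfolding C(3) .
  then have C1: "H1 C = H1 A" using AB(2,4) by simp
  note C = C(1,2) and AB = AB(1-4)
  have "A < a"
  proof (rule ccontr)
    assume "\<not> A < a"
    then show False
      using dec_mid[of A C] inc_right[of C B] C C1 AB by (cases "C \<le> b") auto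
  qed
  moreover have "b < B"
  proof (rule ccontr)
    assume "\<not> b < B"
    then show False
      using dec_mid[of C B] inc_left[of A C] C C1 AB by (cases "a \<le> C") auto
  qed
  moreover have "a < C" using inc_left[of A C] C C1 AB by (cases "C \<le> a") auto
  moreover have "C < b" using inc_right[of C B] C C1 AB by (cases "b \<le> C") auto
  ultimately show ?thesis using that C1 by blast
qed

text \<open>\<open>H1 - H1 A\<close> is negative on (0, A), positive on (A, C), negative on (C, B)
  and positive on (B, 1). Hence on either side of C the gap between H and the line is smallest at
  the nearer contact point, where it is zero.\<close>

lemma bitangent_support:
  assumes "bitangent A B" and y: "0 < y" "y < 1"
  shows "H A + H1 A * (y - A) \<le> H y"
proof -
  have AB: "0 < A" "A < B" "B < 1" "H1 A = H1 B" "H1 B = (H B - H A) / (B - A)"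
    using assms by (auto simp: bitangent_def)
  have HB: "H B = H A + H1 A * (B - A)" using AB(2) unfolding AB(4,5) by simp
  note AB = AB(1-4)
  obtain C where C: "A < a" "b < B" "a < C" "C < b" "H1 C = H1 A" using bitangent_location[OF assms(1)] .
  consider "y < A" | "y = A" | "A < y" "y \<le> C" | "C < y" "y < B" | "y = B" | "B < y" by linarith
  then show ?thesis
  proof cases
    case 1
    obtain z where z: "y < z" "z < A" "H A - H y = (A - y) * H1 z" using mvt 1 y AB by (metis less_trans)
    have "H1 z < H1 A" using inc_left[of z A] z y C by auto
    then have "(A - y) * H1 z \<le> (A - y) * H1 A" using 1 by (intro mult_left_mono) auto
    then show ?thesis using z(3) by (simp add: algebra_simps)
  next
    case 3
    obtain z where z: "A < z" "z < y" "H y - H A = (y - A) * H1 z" using mvt 3 y AB by metis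
    have "H1 A < H1 z" using inc_left[of A z] dec_mid[of z C] z 3 AB C by (cases "z \<le> a") auto
    then have "(y - A) * H1 A \<le> (y - A) * H1 z" using 3 by (intro mult_left_mono) auto
    then show ?thesis using z(3) by (simp add: algebra_simps)
  next
    case 4
    obtain z where z: "y < z" "z < B" "H B - H y = (B - y) * H1 z" using mvt 4 y AB by metis
    have "H1 z < H1 A" using inc_right[of z B] dec_mid[of C z] z 4 AB C by (cases "z \<le> b") auto
    then have "(B - y) * H1 z \<le> (B - y) * H1 A" using 4 by (intro mult_left_mono) auto
    then show ?thesis using z(3) HB by (simp add: algebra_simps)
  next
    case 6
    obtain z where z: "B < z" "z < y" "H y - H B = (y - B) * H1 z" using mvt 6 y AB by (metis less_trans)
    have "H1 A < H1 z" using inc_right[of B z] z 6 AB C y by auto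
    then have "(y - B) * H1 A \<le> (y - B) * H1 z" using 6 by (intro mult_left_mono) auto
    then show ?thesis using z(3) HB by (simp add: algebra_simps)
  qed (use HB in auto)
qed

text \<open>The first line touches H at B1 and lies below it at A2; the second touches it at A2 and
  lies below it at B1. The chord of H from A2 to B1 therefore has slope between \<open>H1 A2\<close>
  and \<open>H1 A1\<close>.\<close>

lemma bitangent_slope_le:
  assumes "bitangent A1 B1" "bitangent A2 B2"
  shows "H1 A2 \<le> H1 A1"
proof (rule ccontr)
  assume "\<not> H1 A2 \<le> H1 A1"
  then have lt: "H1 A1 < H1 A2" by simp
  have AB1: "0 < A1" "A1 < B1" "B1 < 1" "H1 A1 = H1 B1" "H1 B1 = (H B1 - H A1) / (B1 - A1)"
    using assms by (auto simp: bitangent_def)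
  have AB2: "0 < A2" "A2 < B2" "B2 < 1" using assms by (auto simp: bitangent_def)
  have "A2 < B1" using bitangent_location[OF assms(1)] bitangent_location[OF assms(2)] ab by (metis less_trans)
  have "H A2 + H1 A2 * (B1 - A2) \<le> H B1" by (rule bitangent_support[OF assms(2)]) (use AB1(1-3) in linarith)+
  moreover have "H A1 + H1 A1 * (A2 - A1) \<le> H A2" by (rule bitangent_support[OF assms(1)]) (use AB2 in linarith)+
  moreover have "H B1 = H A1 + H1 A1 * (B1 - A1)" using AB1(2) unfolding AB1(4,5) by simp
  ultimately have "H1 A2 * (B1 - A2) \<le> H1 A1 * (B1 - A2)" by (simp add: algebra_simps)
  then show False using lt \<open>A2 < B1\<close> by simp
qed

text \<open>Slopes agree by symmetry of the previous comparison, and \<open>H1\<close> is injective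
  on each outer piece.\<close>

lemma bitangent_unique:
  assumes "bitangent A1 B1" "bitangent A2 B2"
  shows "A1 = A2 \<and> B1 = B2"
proof -
  have m: "H1 A1 = H1 A2" using bitangent_slope_le assms by (meson order_antisym)
  have AB: "0 < A1" "B1 < 1" "H1 A1 = H1 B1" "0 < A2" "B2 < 1" "H1 A2 = H1 B2"
    using assms by (auto simp: bitangent_def)
  have "A1 < a" "b < B1" "A2 < a" "b < B2"
    using bitangent_location[OF assms(1)] bitangent_location[OF assms(2)] by metis+
  then show ?thesis
    using inc_left[of A1 A2] inc_left[of A2 A1] inc_right[of B1 B2] inc_right[of B2 B1] AB m
    by (metis less_irrefl less_imp_le linorder_neqE_linordered_idom)
qed

lemma H_continuous: "S \<subseteq> {0<..<1} \<Longrightarrow> continuous_on S H"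
  by (intro continuous_at_imp_continuous_on ballI DERIV_isCont[OF DH]) blast

text \<open>Blow-up reduces the minimisation to a compact interval: close to 0 or 1, H exceeds
  \<open>H x0 + \<bar>m\<bar>\<close>, while the linear term is at most \<open>\<bar>m\<bar>\<close>
  on (0, 1).\<close>

lemma attains:
  assumes x0: "0 < x0" "x0 < 1"
  shows "\<exists>A\<in>{0<..x0}. \<forall>y\<in>{0<..x0}. H A - m * (A - x0) \<le> H y - m * (y - x0)"
    and "\<exists>A\<in>{x0..<1}. \<forall>y\<in>{x0..<1}. H A - m * (A - x0) \<le> H y - m * (y - x0)"
proof -
  have lin: "m * (y - x0) \<le> \<bar>m\<bar>" if "0 < y" "y < 1" for y
  proof -
    have "\<bar>m * (y - x0)\<bar> \<le> \<bar>m\<bar> * 1" unfolding abs_mult using that x0 by (intro mult_left_mono) auto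
    then show ?thesis by linarith
  qed
  have "\<forall>\<^sub>F y in at_right 0. H x0 + \<bar>m\<bar> \<le> H y" using lim_0 by (simp add: filterlim_at_top)
  then obtain r where r: "0 < r" "\<And>y. 0 < y \<Longrightarrow> y < r \<Longrightarrow> H x0 + \<bar>m\<bar> \<le> H y"
    unfolding eventually_at_right_field by auto
  let ?r = "min (r / 2) x0"
  have "continuous_on {?r..x0} (\<lambda>y. H y - m * (y - x0))"
    by (intro continuous_intros H_continuous) (use r x0 in auto)
  then obtain A where A: "A \<in> {?r..x0}" "\<forall>y\<in>{?r..x0}. H A - m * (A - x0) \<le> H y - m * (y - x0)"
    using continuous_attains_inf[of "{?r..x0}" "\<lambda>y. H y - m * (y - x0)"] by auto
  have "H A - m * (A - x0) \<le> H y - m * (y - x0)" if y: "y \<in> {0<..x0}" for y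
  proof (cases "y < ?r")
    case True
    have "H A - m * (A - x0) \<le> H x0" using A(2)[rule_format, of x0] by simp
    also have "\<dots> \<le> H y - m * (y - x0)" using r(2)[of y] lin[of y] True y x0 by simp
    finally show ?thesis .
  qed (use A y in auto)
  then show "\<exists>A\<in>{0<..x0}. \<forall>y\<in>{0<..x0}. H A - m * (A - x0) \<le> H y - m * (y - x0)"
    using A(1) r x0 by (intro bexI[of _ A]) auto
  have "\<forall>\<^sub>F y in at_left 1. H x0 + \<bar>m\<bar> \<le> H y" using lim_1 by (simp add: filterlim_at_top)
  then obtain s where s: "s < 1" "\<And>y. s < y \<Longrightarrow> y < 1 \<Longrightarrow> H x0 + \<bar>m\<bar> \<le> H y"
    unfolding eventually_at_left_field by auto
  define t where "t = max ((s + 1) / 2) x0"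
  have t: "s < t" "t < 1" "x0 \<le> t" using s(1) x0 by (simp_all add: t_def less_max_iff_disj)
  have "continuous_on {x0..t} (\<lambda>y. H y - m * (y - x0))"
    by (intro continuous_intros H_continuous) (use t x0 in auto)
  then obtain B where B: "B \<in> {x0..t}" "\<forall>y\<in>{x0..t}. H B - m * (B - x0) \<le> H y - m * (y - x0)"
    using continuous_attains_inf[of "{x0..t}" "\<lambda>y. H y - m * (y - x0)"] t(3) by auto
  have "H B - m * (B - x0) \<le> H y - m * (y - x0)" if y: "y \<in> {x0..<1}" for y
  proof (cases "t < y")
    case True
    have "H B - m * (B - x0) \<le> H x0" using B(2)[rule_format, of x0] t by simp
    also have "\<dots> \<le> H y - m * (y - x0)" using t lin[of y] s(2)[of y] True y x0 by simp
    finally show ?thesis .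
  qed (use B y in auto)
  then show "\<exists>A\<in>{x0..<1}. \<forall>y\<in>{x0..<1}. H A - m * (A - x0) \<le> H y - m * (y - x0)"
    using B(1) t x0 by (intro bexI[of _ B]) auto
qed

text \<open>The two tangency points minimise \<open>H - m * id\<close> on either side of a point of the concave part;
  the slope \<open>m\<close> is the one for which both minima agree.\<close>

lemma bitangent_exists: "\<exists>A B. bitangent A B"
proof -
  define x0 where "x0 = (a + b) / 2"
  have x0: "0 < x0" "x0 < 1" "a < x0" "x0 < b" using ab by (auto simp: x0_def)
  obtain A where A: "\<And>m. A m \<in> {0<..x0}" "\<And>m y. y \<in> {0<..x0} \<Longrightarrow> H (A m) - m * (A m - x0) \<le> H y - m * (y - x0)"
    using attains(1)[OF x0(1,2)] by metis
  obtain B where B: "\<And>m. B m \<in> {x0..<1}" "\<And>m y. y \<in> {x0..<1} \<Longrightarrow> H (B m) - m * (B m - x0) \<le> H y - m * (y - x0)"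
    using attains(2)[OF x0(1,2)] by metis
  define e1 where "e1 m = H (A m) - m * (A m - x0)" for m
  define e2 where "e2 m = H (B m) - m * (B m - x0)" for m
  have lip: "\<bar>m * (y - x0) - m' * (y - x0)\<bar> \<le> \<bar>m - m'\<bar>" if "0 < y" "y < 1" for m m' y
  proof -
    have "\<bar>(m - m') * (y - x0)\<bar> \<le> \<bar>m - m'\<bar> * 1" unfolding abs_mult using that x0 by (intro mult_left_mono) auto
    then show ?thesis by (simp add: left_diff_distrib)
  qed
  have l1: "e1 m \<le> e1 m' + \<bar>m - m'\<bar>" for m m'
    using A(2)[of "A m'" m] A(1)[of m'] lip[of "A m'" m m'] x0 unfolding e1_def by (auto simp: abs_le_iff)
  have l2: "e2 m \<le> e2 m' + \<bar>m - m'\<bar>" for m m'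
    using B(2)[of "B m'" m] B(1)[of m'] lip[of "B m'" m m'] x0 unfolding e2_def by (auto simp: abs_le_iff)
  \<comment> \<open>Each minimum is 1-Lipschitz in the slope because |y - x0| \<le> 1; so the
    minimal values are continuous even though the minimisers may jump.\<close>
  have cont: "continuous_on UNIV (\<lambda>m. e1 m - e2 m)"
  proof (rule lipschitz_on_continuous_on[of 2], rule lipschitz_onI)
    show "dist (e1 m - e2 m) (e1 m' - e2 m') \<le> 2 * dist m m'" for m m'
      using l1[of m m'] l1[of m' m] l2[of m m'] l2[of m' m] by (simp add: dist_real_def abs_le_iff abs_minus_commute)
  qed simp
  define y1 where "y1 = (x0 + 1) / 2"
  define y2 where "y2 = x0 / 2"
  have y: "x0 < y1" "y1 < 1" "0 < y2" "y2 < x0" using x0 by (auto simp: y1_def y2_def)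
  \<comment> \<open>Steep enough for the tilt at y1 to outweigh the gap between \<open>H y1\<close>
    and the minimum \<open>H (A 0)\<close> of H on the left, which forces
    \<open>e2 m1 \<le> e1 m1\<close>. The slope \<open>m2\<close> below is the mirror image.\<close>
  define m1 where "m1 = \<bar>H y1 - H (A 0)\<bar> / (y1 - x0)"
  have m1: "0 \<le> m1" "m1 * (y1 - x0) = \<bar>H y1 - H (A 0)\<bar>" using y by (auto simp: m1_def)
  have "e2 m1 \<le> H y1 - m1 * (y1 - x0)" unfolding e2_def using y by (intro B(2)) auto
  moreover have "H (A 0) \<le> e1 m1"
  proof -
    have "H (A 0) \<le> H (A m1)" using A(2)[of "A m1" 0] A(1)[of m1] by simp
    moreover have "m1 * (A m1 - x0) \<le> 0" using m1 A(1)[of m1] by (simp add: mult_nonneg_nonpos)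
    ultimately show ?thesis by (simp add: e1_def)
  qed
  ultimately have p1: "0 \<le> e1 m1 - e2 m1" using m1(2) by linarith
  define m2 where "m2 = - (\<bar>H y2 - H (B 0)\<bar> / (x0 - y2))"
  have m2: "m2 \<le> 0" "m2 * (y2 - x0) = \<bar>H y2 - H (B 0)\<bar>" 
  proof -
    have "\<bar>H y2 - H (B 0)\<bar> / (x0 - y2) * (x0 - y2) = \<bar>H y2 - H (B 0)\<bar>" using y by simp
    then show "m2 * (y2 - x0) = \<bar>H y2 - H (B 0)\<bar>" unfolding m2_def by (simp only: algebra_simps)
  qed (use y in \<open>simp add: m2_def\<close>)
  have "e1 m2 \<le> H y2 - m2 * (y2 - x0)" unfolding e1_def using y by (intro A(2)) auto
  moreover have "H (B 0) \<le> e2 m2"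
  proof -
    have "H (B 0) \<le> H (B m2)" using B(2)[of "B m2" 0] B(1)[of m2] by simp
    moreover have "m2 * (B m2 - x0) \<le> 0" using m2 B(1)[of m2] by (simp add: mult_nonpos_nonneg)
    ultimately show ?thesis by (simp add: e2_def)
  qed
  ultimately have p2: "e1 m2 - e2 m2 \<le> 0" using m2(2) by linarith
  have "m2 \<le> m1" using m1 m2 by linarith
  then obtain m where m: "e1 m - e2 m = 0"
    using IVT'[of "\<lambda>m. e1 m - e2 m" m2 0 m1] p1 p2 continuous_on_subset[OF cont] by auto
  define F where "F y = H y - m * (y - x0)" for y
  have DF: "(F has_real_derivative H1 y - m) (at y)" if "y \<in> {0<..<1}" for y
    unfolding F_def[abs_def] using DH[OF that] by (auto intro!: derivative_eq_intros)
  have FAB: "F (B m) = F (A m)" using m by (simp add: F_def e1_def e2_def)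
  have min: "F (A m) \<le> F y" if "0 < y" "y < 1" for y
    using A(2)[of y m] B(2)[of y m] that FAB by (cases "y \<le> x0") (auto simp: F_def)
  have crit: "H1 z = m" if z: "0 < z" "z < 1" "F z = F (A m)" for z
  proof -
    have "H1 z - m = 0"
    proof (rule DERIV_local_min[OF DF])
      show "\<forall>y. \<bar>z - y\<bar> < min z (1 - z) \<longrightarrow> F z \<le> F y" using min z by auto
    qed (use z in auto)
    then show ?thesis by simp
  qed
  \<comment> \<open>If the common minimum were attained at x0, the slope there would be m, and
    strict concavity would push F below it on the way to b.\<close>
  have nx0: "F x0 \<noteq> F (A m)"
  proof
    assume eq: "F x0 = F (A m)"
    then have mx: "H1 x0 = m" using crit x0 by blast
    obtain z where z: "x0 < z" "z < b" "H b - H x0 = (b - x0) * H1 z" using mvt x0 ab by metis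
    have "H1 z < m" using dec_mid[of x0 z] z x0 mx by auto
    then have "(b - x0) * H1 z < (b - x0) * m" using x0 by (intro mult_strict_left_mono) auto
    then have "F b < F x0" using z(3) by (simp add: F_def algebra_simps)
    then show False using min[of b] eq ab by simp
  qed
  have Ax: "A m < x0" using A(1)[of m] nx0 by (cases "A m = x0") auto
  have Bx: "x0 < B m" using B(1)[of m] nx0 FAB by (cases "B m = x0") auto
  have HA: "H1 (A m) = m" using crit[of "A m"] A(1)[of m] x0 by auto
  have HB: "H1 (B m) = m" using crit[of "B m"] B(1)[of m] x0 FAB by auto
  have "m * (B m - A m) = H (B m) - H (A m)" using FAB by (simp add: F_def algebra_simps)
  then have "bitangent (A m) (B m)"
    unfolding bitangent_def using A(1)[of m] B(1)[of m] Ax Bx HA HB by (auto simp: field_simps)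
  then show ?thesis by blast
qed

text \<open>For x < A, convexity handles the points up to A. Beyond A the tangent at x starts below
  H and is flatter than the bitangent, so it stays below the bitangent and hence below H. The side x
  > B is symmetric, and at A and B the tangent is the bitangent.\<close>

lemma outer_support:
  assumes "bitangent A B" and x: "0 < x" "x < 1" "x \<notin> {A<..<B}" and y: "0 < y" "y < 1"
  shows "H x + H1 x * (y - x) \<le> H y"
proof -
  have AB: "0 < A" "A < B" "B < 1" "H1 A = H1 B" "H1 B = (H B - H A) / (B - A)"
    using assms by (auto simp: bitangent_def)
  have HB: "H B = H A + H1 A * (B - A)" using AB(2) unfolding AB(4,5) by simp
  note AB = AB(1-4)
  have loc: "A < a" "b < B" using bitangent_location[OF assms(1)] by metis+
  note sup = bitangent_support[OF assms(1) y]
  have "x = A \<or> x = B \<or> x < A \<or> B < x" using x(3) unfolding greaterThanLessThan_iff by linarith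
  then show ?thesis
  proof (elim disjE)
    assume "x = A"
    then show ?thesis using sup by simp
  next
    assume "x = B"
    then show ?thesis using sup HB AB(4) by (simp add: algebra_simps)
  next
    assume 3: "x < A"
    have left: "H x + H1 x * (w - x) \<le> H w" if w: "0 < w" "w \<le> A" for w
    proof -
      consider "w < x" | "w = x" | "x < w" by linarith
      then show ?thesis
      proof cases
        case 1
        obtain z where z: "w < z" "z < x" "H x - H w = (x - w) * H1 z" using mvt 1 w x by metis
        have "(x - w) * H1 z \<le> (x - w) * H1 x"
          using inc_left[of z x] z 1 w 3 loc by (intro mult_left_mono) auto
        then show ?thesis using z(3) by (simp add: algebra_simps)
      next
        case wx: 3
        obtain z where z: "x < z" "z < w" "H w - H x = (w - x) * H1 z" using mvt wx w x AB by (metis le_less_trans less_trans)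
        have "(w - x) * H1 x \<le> (w - x) * H1 z"
          using inc_left[of x z] z wx w x loc by (intro mult_left_mono) auto
        then show ?thesis using z(3) by (simp add: algebra_simps)
      qed simp
    qed
    show ?thesis
    proof (cases "y \<le> A")
      case True then show ?thesis using left y by simp
    next
      case False
      have "H1 x \<le> H1 A" using inc_left[of x A] 3 x loc by simp
      then have "H1 x * (y - A) \<le> H1 A * (y - A)" using False by (intro mult_right_mono) auto
      then show ?thesis using left[of A] sup AB by (simp add: algebra_simps)
    qed
  next
    assume 4: "B < x"
    have right: "H x + H1 x * (w - x) \<le> H w" if w: "B \<le> w" "w < 1" for w
    proof -
      consider "w < x" | "w = x" | "x < w" by linarith
      then show ?thesis
      proof cases
        case 1
        obtain z where z: "w < z" "z < x" "H x - H w = (x - w) * H1 z" using mvt 1 w x AB by (metis less_le_trans less_trans)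
        have "(x - w) * H1 z \<le> (x - w) * H1 x"
          using inc_right[of z x] z 1 w 4 loc x by (intro mult_left_mono) auto
        then show ?thesis using z(3) by (simp add: algebra_simps)
      next
        case wx: 3
        obtain z where z: "x < z" "z < w" "H w - H x = (w - x) * H1 z" using mvt wx w x by metis
        have "(w - x) * H1 x \<le> (w - x) * H1 z"
          using inc_right[of x z] z wx w x loc 4 by (intro mult_left_mono) auto
        then show ?thesis using z(3) by (simp add: algebra_simps)
      qed simp
    qed
    show ?thesis
    proof (cases "B \<le> y")
      case True then show ?thesis using right y by simp
    next
      case False
      have "H1 B \<le> H1 x" using inc_right[of B x] 4 x loc by simp
      then have "H1 x * (y - B) \<le> H1 B * (y - B)" using False by (intro mult_right_mono_neg) auto
      then show ?thesis using right[of B] sup AB HB by (simp add: algebra_simps)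
    qed
  qed
qed

end

text \<open>The reciprocal of \<open>(\<sigma> y)\<^sup>2\<close> is cut off at 1 / \<epsilon>, with
  \<epsilon> the minimum of the square on [d, 1 - d]: nothing changes there, and closer to the
  boundary the generator applied to \<Psi> stays in [-c, 0]. Vanishing to first order at x lets
  \<Psi> be compared with any u minus its tangent at x.\<close>

lemma ex_second_antiderivative:
  fixes \<sigma> :: "real \<Rightarrow> real"
  assumes \<sigma>: "continuous_on {0..1} \<sigma>" "\<And>x. x \<in> {0<..<1} \<Longrightarrow> \<sigma> x \<noteq> 0"
    and c: "0 < c" and d: "0 < d" and x: "x \<in> {d..1 - d}"
  obtains \<Psi> \<Psi>' q :: "real \<Rightarrow> real" where
    "\<And>y. y \<in> {0..1} \<Longrightarrow> (\<Psi> has_real_derivative \<Psi>' y) (at y)"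
    "\<And>y. y \<in> {0..1} \<Longrightarrow> (\<Psi>' has_real_derivative q y) (at y)"
    "continuous_on {0..1} q" "\<And>y. q y \<le> 0"
    "\<And>y. y \<in> {0..1} \<Longrightarrow> - c \<le> q y * (\<sigma> y)\<^sup>2 / 2"
    "\<And>y. y \<in> {d..1 - d} \<Longrightarrow> q y = - 2 * c / (\<sigma> y)\<^sup>2" "\<Psi> x = 0" "\<Psi>' x = 0"
proof -
  have "continuous_on {d..1 - d} (\<lambda>y. (\<sigma> y)\<^sup>2)"
    using d by (intro continuous_intros continuous_on_subset[OF \<sigma>(1)]) auto
  then obtain z where z: "z \<in> {d..1 - d}" "\<forall>y\<in>{d..1 - d}. (\<sigma> z)\<^sup>2 \<le> (\<sigma> y)\<^sup>2"
    using continuous_attains_inf[of "{d..1 - d}" "\<lambda>y. (\<sigma> y)\<^sup>2"] x by auto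
  define \<epsilon> where "\<epsilon> = (\<sigma> z)\<^sup>2"
  have \<epsilon>: "0 < \<epsilon>" using \<sigma>(2)[of z] z d by (simp add: \<epsilon>_def)
  define q where "q y = - 2 * c / max ((\<sigma> (max 0 (min 1 y)))\<^sup>2) \<epsilon>" for y
  have q_cont: "continuous_on UNIV q"
  proof -
    have "continuous_on UNIV (\<lambda>y. \<sigma> (max 0 (min 1 y)))"
      by (rule continuous_on_compose2[OF \<sigma>(1)]) (auto intro!: continuous_intros)
    then show ?thesis unfolding q_def[abs_def] using \<epsilon> by (intro continuous_intros) (auto simp: max_def)
  qed
  \<comment> \<open>The nested intervals [-2, 3], [-1, 2] and [0, 1] make each derivative two-sided
    at the ends of the next smaller one.\<close>
  have ex: "\<exists>G. \<forall>y\<in>{0..1}. (G has_real_derivative f y) (at y)" if cf: "continuous_on {-1..2} f" for f :: "real \<Rightarrow> real"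
  proof -
    obtain G where G: "\<And>y. y \<in> {-1..2} \<Longrightarrow> (G has_vector_derivative f y) (at y within {-1..2})"
      using antiderivative_continuous[OF cf] by blast
    have "(G has_real_derivative f y) (at y)" if "y \<in> {0..1}" for y
      using G[of y] that by (simp add: has_real_derivative_iff_has_vector_derivative at_within_Icc_at)
    then show ?thesis by blast
  qed
  have ex': "\<exists>G. \<forall>y\<in>{-1..2}. (G has_real_derivative q y) (at y)"
  proof -
    obtain G where G: "\<And>y. y \<in> {-2..3} \<Longrightarrow> (G has_vector_derivative q y) (at y within {-2..3})"
      using antiderivative_continuous[OF continuous_on_subset[OF q_cont], of "-2" 3] by blast
    have "(G has_real_derivative q y) (at y)" if "y \<in> {-1..2}" for y
      using G[of y] that by (simp add: has_real_derivative_iff_has_vector_derivative at_within_Icc_at)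
    then show ?thesis by blast
  qed
  then obtain G1 where G1: "\<And>y. y \<in> {-1..2} \<Longrightarrow> (G1 has_real_derivative q y) (at y)" by blast
  define \<Psi>' where "\<Psi>' y = G1 y - G1 x" for y
  have d1: "(\<Psi>' has_real_derivative q y) (at y)" if "y \<in> {-1..2}" for y
    unfolding \<Psi>'_def[abs_def] using G1[OF that] by (auto intro!: derivative_eq_intros)
  have "continuous_on {-1..2} \<Psi>'"
    using d1 by (meson DERIV_isCont continuous_at_imp_continuous_on)
  then obtain G2 where G2: "\<And>y. y \<in> {0..1} \<Longrightarrow> (G2 has_real_derivative \<Psi>' y) (at y)" using ex by blast
  define \<Psi> where "\<Psi> y = G2 y - G2 x" for y
  show ?thesis
  proof
    show "(\<Psi> has_real_derivative \<Psi>' y) (at y)" if "y \<in> {0..1}" for y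
      unfolding \<Psi>_def[abs_def] using G2[OF that] by (auto intro!: derivative_eq_intros)
    show "(\<Psi>' has_real_derivative q y) (at y)" if "y \<in> {0..1}" for y
      using that by (intro d1) auto
    show "continuous_on {0..1} q" by (rule continuous_on_subset[OF q_cont]) simp
    show "q y \<le> 0" for y unfolding q_def using c \<epsilon> by (simp add: divide_nonpos_nonneg max_def)
    show "- c \<le> q y * (\<sigma> y)\<^sup>2 / 2" if "y \<in> {0..1}" for y
    proof -
      let ?m = "max ((\<sigma> y)\<^sup>2) \<epsilon>"
      have m: "0 < ?m" "(\<sigma> y)\<^sup>2 \<le> ?m" using \<epsilon> by auto
      have "q y * (\<sigma> y)\<^sup>2 / 2 = - (c * ((\<sigma> y)\<^sup>2 / ?m))"
        unfolding q_def using that by (simp add: max_absorb2 min_absorb2)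
      moreover have "c * ((\<sigma> y)\<^sup>2 / ?m) \<le> c * 1" using m c by (intro mult_left_mono) (auto simp: divide_le_eq_1)
      ultimately show ?thesis by simp
    qed
    show "q y = - 2 * c / (\<sigma> y)\<^sup>2" if "y \<in> {d..1 - d}" for y
    proof -
      have "max 0 (min 1 y) = y" using that d by auto
      moreover have "max ((\<sigma> y)\<^sup>2) \<epsilon> = (\<sigma> y)\<^sup>2"
        unfolding \<epsilon>_def by (rule max_absorb1) (rule z(2)[rule_format, OF that])
      ultimately show ?thesis unfolding q_def by simp
    qed
    show "\<Psi> x = 0" "\<Psi>' x = 0" unfolding \<Psi>_def \<Psi>'_def by (rule diff_self)+
  qed
qed

text \<open>u - \<Psi> is convex, hence above its tangent at x.\<close>

lemma second_derivative_comparison: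
  fixes u \<Psi> :: "real \<Rightarrow> real"
  assumes u: "\<And>y. y \<in> {l..r} \<Longrightarrow> (u has_real_derivative u' y) (at y)"
      "\<And>y. y \<in> {l..r} \<Longrightarrow> (u' has_real_derivative u2 y) (at y)"
    and \<Psi>: "\<And>y. y \<in> {l..r} \<Longrightarrow> (\<Psi> has_real_derivative \<Psi>' y) (at y)"
      "\<And>y. y \<in> {l..r} \<Longrightarrow> (\<Psi>' has_real_derivative q y) (at y)"
    and le: "\<And>y. y \<in> {l..r} \<Longrightarrow> q y \<le> u2 y"
    and xy: "x \<in> {l..r}" "y \<in> {l..r}"
  shows "\<Psi> y - \<Psi> x - \<Psi>' x * (y - x) \<le> u y - u x - u' x * (y - x)"
proof -
  have "(u' x - \<Psi>' x) * (y - x) \<le> (u y - \<Psi> y) - (u x - \<Psi> x)"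
  proof (rule f''_imp_f'[where C="{l..r}" and f="\<lambda>y. u y - \<Psi> y" and f'="\<lambda>y. u' y - \<Psi>' y" and f''="\<lambda>y. u2 y - q y"])
    show "convex {l..r}" "x \<in> {l..r}" "y \<in> {l..r}" using xy by auto
    fix v assume v: "v \<in> {l..r}"
    show "((\<lambda>y. u y - \<Psi> y) has_real_derivative u' v - \<Psi>' v) (at v)" by (rule DERIV_diff[OF u(1)[OF v] \<Psi>(1)[OF v]])
    show "((\<lambda>y. u' y - \<Psi>' y) has_real_derivative u2 v - q v) (at v)" by (rule DERIV_diff[OF u(2)[OF v] \<Psi>(2)[OF v]])
    show "0 \<le> u2 v - q v" using le[OF v] by simp
  qed
  then show ?thesis by (simp add: algebra_simps)
qed

text \<open>Regularised lower test function: near the boundary \<open>\<sigma>\<^sup>-\<^sup>2\<close> is truncated, and concavity together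
  with smallness of \<open>g\<close> there keeps the function below \<open>g + \<eta>\<close>.\<close>

lemma ex_lower_test_function:
  fixes \<sigma> g u :: "real \<Rightarrow> real"
  assumes \<sigma>: "continuous_on {0..1} \<sigma>" "\<And>x. x \<in> {0<..<1} \<Longrightarrow> \<sigma> x \<noteq> 0" and c: "0 < c"
    and g: "continuous_on {0..1} g" "\<And>y. y \<in> {0..1} \<Longrightarrow> 0 \<le> g y" "g 0 = 0" "g 1 = 0"
    and u: "\<And>y. y \<in> {0<..<1} \<Longrightarrow> (u has_real_derivative u' y) (at y)"
      "\<And>y. y \<in> {0<..<1} \<Longrightarrow> (u' has_real_derivative u2 y) (at y)"
      "\<And>y. y \<in> {0<..<1} \<Longrightarrow> - 2 * c / (\<sigma> y)\<^sup>2 \<le> u2 y"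
    and x: "x \<in> {0<..<1}" and line: "\<And>y. y \<in> {0<..<1} \<Longrightarrow> w - u x + k * (y - x) \<le> g y - u y"
    and \<eta>: "0 < \<eta>" "\<eta> < w"
  obtains f f' h where
    "\<And>y. y \<in> {0..1} \<Longrightarrow> (f has_real_derivative f' y) (at y within {0..1})"
    "\<And>y. y \<in> {0..1} \<Longrightarrow> (f' has_real_derivative h y) (at y within {0..1})"
    "continuous_on {0..1} h" "\<And>y. y \<in> {0..1} \<Longrightarrow> - c \<le> h y * (\<sigma> y)\<^sup>2 / 2"
    "f x = w" "\<And>y. y \<in> {0..1} \<Longrightarrow> f y \<le> g y + \<eta>"
proof -
  \<comment> \<open>The width d of the truncated zone is dictated by g: it vanishes continuously at
    0 and 1, so it is below \<eta> at d and at 1 - d.\<close>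
  have "\<exists>d>0. d \<le> x \<and> d \<le> 1 - x \<and> g d < \<eta> \<and> g (1 - d) < \<eta>"
  proof -
    have near: "\<exists>e>0. \<forall>y\<in>{0..1}. dist y z < e \<longrightarrow> dist (g y) (g z) < \<eta>" if "z \<in> {0..1}" for z
      using g(1)[unfolded continuous_on_iff] that \<eta>(1) by (simp only: Ball_def)
    obtain e0 where e0: "e0 > 0" "\<forall>y\<in>{0..1}. dist y 0 < e0 \<longrightarrow> dist (g y) (g 0) < \<eta>"
      using near[of 0] by auto
    obtain e1 where e1: "e1 > 0" "\<forall>y\<in>{0..1}. dist y 1 < e1 \<longrightarrow> dist (g y) (g 1) < \<eta>"
      using near[of 1] by auto
    define d where "d = min (min x (1 - x)) (min (e0 / 2) (e1 / 2))"
    have d: "0 < d" "d \<le> x" "d \<le> 1 - x" "d < e0" "d < e1"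
      using x e0(1) e1(1) by (simp_all add: d_def min_less_iff_disj min_le_iff_disj)
    have "dist (g d) (g 0) < \<eta>" by (rule e0(2)[rule_format]) (use d x in \<open>simp_all add: dist_real_def\<close>)
    moreover have "dist (g (1 - d)) (g 1) < \<eta>" by (rule e1(2)[rule_format]) (use d x in \<open>simp_all add: dist_real_def\<close>)
    ultimately have "g d < \<eta>" "g (1 - d) < \<eta>" unfolding dist_real_def g(3,4) by simp_all
    with d show ?thesis by blast
  qed
  then obtain d where d: "0 < d" "d \<le> x" "d \<le> 1 - x" "g d < \<eta>" "g (1 - d) < \<eta>" by blast
  have xd: "x \<in> {d..1 - d}" using d by auto
  obtain \<Psi> \<Psi>' q where \<Psi>: "\<And>y. y \<in> {0..1} \<Longrightarrow> (\<Psi> has_real_derivative \<Psi>' y) (at y)"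
    "\<And>y. y \<in> {0..1} \<Longrightarrow> (\<Psi>' has_real_derivative q y) (at y)"
    and q: "continuous_on {0..1} q" "\<And>y. q y \<le> 0"
    "\<And>y. y \<in> {0..1} \<Longrightarrow> - c \<le> q y * (\<sigma> y)\<^sup>2 / 2"
    "\<And>y. y \<in> {d..1 - d} \<Longrightarrow> q y = - 2 * c / (\<sigma> y)\<^sup>2" and \<Psi>0: "\<Psi> x = 0" "\<Psi>' x = 0"
    using ex_second_antiderivative[OF \<sigma> c d(1) xd] by blast
  \<comment> \<open>f has the value and the slope at x of
    \<open>w - u x + k * (y - x) + u y\<close>, which lies below g by \<open>line\<close>. On
    [d, 1 - d] its second derivative is the smaller one, so f stays below that function
    there.\<close>
  define f where "f y = w + (k + u' x) * (y - x) + \<Psi> y" for y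
  define f' where "f' y = k + u' x + \<Psi>' y" for y
  have df: "(f has_real_derivative f' y) (at y)" "(f' has_real_derivative q y) (at y)" if "y \<in> {0..1}" for y
    unfolding f_def[abs_def] f'_def[abs_def] using \<Psi>(1,2)[OF that] by (auto intro!: derivative_eq_intros)
  have tangent: "f y \<le> f z + f' z * (y - z)" if "y \<in> {0..1}" "z \<in> {0..1}" for y z
  proof -
    have "(- f' z) * (y - z) \<le> (- f y) - (- f z)"
    proof (rule f''_imp_f'[where C="{0..1}" and f="\<lambda>y. - f y" and f'="\<lambda>y. - f' y" and f''="\<lambda>y. - q y"])
      show "convex {0..1::real}" "z \<in> {0..1}" "y \<in> {0..1}" using that by auto
      fix v :: real assume v: "v \<in> {0..1}"
      show "((\<lambda>y. - f y) has_real_derivative - f' v) (at v)" by (rule DERIV_minus[OF df(1)[OF v]])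
      show "((\<lambda>y. - f' y) has_real_derivative - q v) (at v)" by (rule DERIV_minus[OF df(2)[OF v]])
      show "0 \<le> - q v" using q(2)[of v] by simp
    qed
    then show ?thesis by simp
  qed
  have mid: "f y \<le> g y" if y: "y \<in> {d..1 - d}" for y
  proof -
    have "\<Psi> y - \<Psi> x - \<Psi>' x * (y - x) \<le> u y - u x - u' x * (y - x)"
    proof (rule second_derivative_comparison[where l=d and r="1 - d" and q=q and ?u2.0=u2])
      show "q y \<le> u2 y" if "y \<in> {d..1 - d}" for y using u(3)[of y] q(4)[OF that] d that by simp
      show "x \<in> {d..1 - d}" "y \<in> {d..1 - d}" by (fact xd, fact y)
      fix v assume "v \<in> {d..1 - d}"
      then have v: "v \<in> {0<..<1}" "v \<in> {0..1}" using d by auto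
      show "(u has_real_derivative u' v) (at v)" "(u' has_real_derivative u2 v) (at v)" by (rule u[OF v(1)])+
      show "(\<Psi> has_real_derivative \<Psi>' v) (at v)" "(\<Psi>' has_real_derivative q v) (at v)" by (rule \<Psi>[OF v(2)])+
    qed
    then show ?thesis using line[of y] y d \<Psi>0 by (simp add: f_def algebra_simps)
  qed
  have fx: "f x = w" by (simp add: f_def \<Psi>0)
  show ?thesis
  proof
    show "f y \<le> g y + \<eta>" if y: "y \<in> {0..1}" for y
    proof -
      consider "y \<in> {d..1 - d}" | "y < d" | "1 - d < y" by fastforce
      then show ?thesis
      proof cases
        case 1 then show ?thesis using mid[of y] \<eta> by simp
      next
        case 2
        \<comment> \<open>f d < \<eta> < w = f x forces the concave f to increase at d, so it
          remains below \<eta> on [0, d]. The other end is symmetric.\<close>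
        have fd: "f d < \<eta>" using mid[of d] d by auto
        then have "d \<noteq> x" using fx \<eta> by auto
        then have "d < x" using d by simp
        have "f x \<le> f d + f' d * (x - d)" using d x by (intro tangent) auto
        then have "0 < f' d * (x - d)" using fd fx \<eta> by simp
        then have "0 < f' d" using \<open>d < x\<close> by (simp add: zero_less_mult_iff)
        then have "f' d * (y - d) \<le> 0" using 2 by (simp add: mult_nonneg_nonpos)
        moreover have "f y \<le> f d + f' d * (y - d)" using d x y by (intro tangent) auto
        ultimately show ?thesis using fd g(2)[OF y] by simp
      next
        case 3
        let ?e = "1 - d"
        have fd: "f ?e < \<eta>" using mid[of ?e] d by auto
        then have "?e \<noteq> x" using fx \<eta> by auto
        then have "x < ?e" using d by simp
        have "f x \<le> f ?e + f' ?e * (x - ?e)" using d x by (intro tangent) auto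
        then have "0 < f' ?e * (x - ?e)" using fd fx \<eta> by simp
        then have "f' ?e < 0" using \<open>x < ?e\<close> by (simp add: zero_less_mult_iff)
        then have "f' ?e * (y - ?e) \<le> 0" using 3 by (simp add: mult_nonpos_nonneg)
        moreover have "f y \<le> f ?e + f' ?e * (y - ?e)" using d x y by (intro tangent) auto
        ultimately show ?thesis using fd g(2)[OF y] by simp
      qed
    qed
    show "(f has_real_derivative f' y) (at y within {0..1})" "(f' has_real_derivative q y) (at y within {0..1})"
      if "y \<in> {0..1}" for y
      by (rule has_field_derivative_at_within[OF df(1)[OF that]], rule has_field_derivative_at_within[OF df(2)[OF that]])
    show "continuous_on {0..1} q" by (rule q(1))
    show "- c \<le> q y * (\<sigma> y)\<^sup>2 / 2" if "y \<in> {0..1}" for y by (rule q(3)[OF that])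
    show "f x = w" by (rule fx)
  qed
qed

text \<open>Truncation is inactive on [A, B], so u and \<Psi> have the same second derivative there;
  comparison in both directions identifies \<Psi> with u minus its tangent at A.\<close>

lemma ex_interior_test_function:
  fixes \<sigma> u :: "real \<Rightarrow> real"
  assumes \<sigma>: "continuous_on {0..1} \<sigma>" "\<And>x. x \<in> {0<..<1} \<Longrightarrow> \<sigma> x \<noteq> 0" and c: "0 < c"
    and u: "\<And>y. y \<in> {0<..<1} \<Longrightarrow> (u has_real_derivative u' y) (at y)"
      "\<And>y. y \<in> {0<..<1} \<Longrightarrow> (u' has_real_derivative - 2 * c / (\<sigma> y)\<^sup>2) (at y)"
    and AB: "0 < A" "A < B" "B < 1"
  obtains f f' h where
    "\<And>y. y \<in> {0..1} \<Longrightarrow> (f has_real_derivative f' y) (at y within {0..1})"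
    "\<And>y. y \<in> {0..1} \<Longrightarrow> (f' has_real_derivative h y) (at y within {0..1})"
    "continuous_on {0..1} h" "\<And>y. y \<in> {A..B} \<Longrightarrow> h y * (\<sigma> y)\<^sup>2 / 2 = - c"
    "\<And>y. y \<in> {A..B} \<Longrightarrow> f y = u y"
proof -
  define d where "d = min A (1 - B)"
  have d: "0 < d" "{A..B} \<subseteq> {d..1 - d}" using AB by (auto simp: d_def)
  have Ad: "A \<in> {d..1 - d}" using d AB by auto
  obtain \<Psi> \<Psi>' q where \<Psi>: "\<And>y. y \<in> {0..1} \<Longrightarrow> (\<Psi> has_real_derivative \<Psi>' y) (at y)"
    "\<And>y. y \<in> {0..1} \<Longrightarrow> (\<Psi>' has_real_derivative q y) (at y)"
    and qc: "continuous_on {0..1} q" and "\<And>y. q y \<le> 0"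
    "\<And>y. y \<in> {0..1} \<Longrightarrow> - c \<le> q y * (\<sigma> y)\<^sup>2 / 2"
    and q: "\<And>y. y \<in> {d..1 - d} \<Longrightarrow> q y = - 2 * c / (\<sigma> y)\<^sup>2" and \<Psi>0: "\<Psi> A = 0" "\<Psi>' A = 0"
    using ex_second_antiderivative[OF \<sigma> c d(1) Ad] by blast
  define f where "f y = u A + u' A * (y - A) + \<Psi> y" for y
  define f' where "f' y = u' A + \<Psi>' y" for y
  have df: "(f has_real_derivative f' y) (at y)" "(f' has_real_derivative q y) (at y)" if "y \<in> {0..1}" for y
    unfolding f_def[abs_def] f'_def[abs_def] using \<Psi>(1,2)[OF that] by (auto intro!: derivative_eq_intros)
  show ?thesis
  proof
    have in01: "v \<in> {0<..<1}" if "v \<in> {d..1 - d}" for v using that d(1) by auto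
    have less_imp_le_01: "v \<in> {0..1}" if "v \<in> {0<..<1}" for v :: real using that by auto
    show "f y = u y" if y: "y \<in> {A..B}" for y
    proof -
      note D = u(1)[OF in01] u(2)[OF in01] \<Psi>(1)[OF less_imp_le_01[OF in01]] \<Psi>(2)[OF less_imp_le_01[OF in01]]
      have yd: "y \<in> {d..1 - d}" using d y by auto
      have "\<Psi> y - \<Psi> A - \<Psi>' A * (y - A) \<le> u y - u A - u' A * (y - A)"
        by (rule second_derivative_comparison[where l=d and r="1 - d", OF D _ Ad yd]) (simp_all add: q)
      moreover have "u y - u A - u' A * (y - A) \<le> \<Psi> y - \<Psi> A - \<Psi>' A * (y - A)"
        by (rule second_derivative_comparison[where l=d and r="1 - d", OF D(3,4,1,2) _ Ad yd]) (simp_all add: q)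
      ultimately show ?thesis by (simp add: f_def \<Psi>0)
    qed
    show "q y * (\<sigma> y)\<^sup>2 / 2 = - c" if y: "y \<in> {A..B}" for y
    proof -
      have "q y = - 2 * c / (\<sigma> y)\<^sup>2" by (rule q[OF subsetD[OF d(2) y]])
      moreover have "\<sigma> y \<noteq> 0" using \<sigma>(2)[of y] y AB by simp
      ultimately show ?thesis by simp
    qed
    show "(f has_real_derivative f' y) (at y within {0..1})" "(f' has_real_derivative q y) (at y within {0..1})"
      if "y \<in> {0..1}" for y
      by (rule has_field_derivative_at_within[OF df(1)[OF that]], rule has_field_derivative_at_within[OF df(2)[OF that]])
  qed (rule qc)
qed

section \<open>The value function\<close>

lemma FTC_unit_interval:
  fixes F f :: "real \<Rightarrow> real"
  assumes F: "\<And>y. y \<in> {0<..<1} \<Longrightarrow> (F has_real_derivative f y) (at y)"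
    and f: "continuous_on {0<..<1} f" and ab: "a \<in> {0<..<1}" "b \<in> {0<..<1}"
  shows "(LBINT y=ereal a..ereal b. f y) = F b - F a"
proof (rule interval_integral_FTC_finite)
  have sub: "{min a b..max a b} \<subseteq> {0<..<1}" using ab by (auto simp: min_def max_def split: if_splits)
  show "continuous_on {min a b..max a b} f" by (rule continuous_on_subset[OF f sub])
  fix y assume "min a b \<le> y" "y \<le> max a b"
  then have "y \<in> {min a b..max a b}" by simp
  then have "y \<in> {0<..<1}" by (rule subsetD[OF sub])
  from has_field_derivative_at_within[OF F[OF this]]
  show "(F has_vector_derivative f y) (at y within {min a b..max a b})"
    by (simp add: has_real_derivative_iff_has_vector_derivative)
qed

lemma psi_solution_derivs:
  assumes "psi_solution \<sigma> c \<psi>" "x \<in> {0<..<1}"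
  shows "(\<psi> has_real_derivative deriv \<psi> x) (at x)"
    and "(deriv \<psi> has_real_derivative - 2 * c / (\<sigma> x)\<^sup>2) (at x)"
  using assms unfolding psi_solution_def by (auto simp: DERIV_deriv_iff_real_differentiable)

lemma C2_on_derivs:
  assumes "C2_on S f" "x \<in> S"
  shows "(f has_real_derivative deriv f x) (at x)" and "(deriv f has_real_derivative deriv (deriv f) x) (at x)"
  using assms unfolding C2_on_def by (auto simp: DERIV_deriv_iff_real_differentiable)

lemma cond_sigma_nonzero: "cond_sigma \<sigma> \<Longrightarrow> x \<in> {0<..<1} \<Longrightarrow> \<sigma> x \<noteq> 0"
  unfolding cond_sigma_def by (auto dest: bspec[of _ _ x])

lemma cond_sigma_continuous: "cond_sigma \<sigma> \<Longrightarrow> continuous_on {0..1} \<sigma>"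
  unfolding cond_sigma_def by blast

text \<open>By two applications of the fundamental theorem, -\<psi> is 2 c times the double integral
  in \<open>cond_sigma\<close> plus an affine function. The affine part is bounded by
  \<open>K\<close> on (0, 1), and g \<ge> 0 cannot spoil the divergence.\<close>

lemma psi_solution_at_top:
  assumes \<sigma>: "cond_sigma \<sigma>" and \<psi>: "psi_solution \<sigma> c \<psi>" and c: "0 < c"
    and g: "\<And>x. x \<in> {0<..<1} \<Longrightarrow> 0 \<le> g x"
  shows "filterlim (\<lambda>x. g x - \<psi> x) at_top (at_right 0)" "filterlim (\<lambda>x. g x - \<psi> x) at_top (at_left 1)"
proof -
  define a :: real where "a = 1 / 2"
  have a: "a \<in> {0<..<1}" by (simp add: a_def)
  note nz = cond_sigma_nonzero[OF \<sigma>]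
  have inv_cont: "continuous_on {0<..<1} (\<lambda>z. 1 / (\<sigma> z)\<^sup>2)"
    using nz by (intro continuous_intros continuous_on_subset[OF cond_sigma_continuous[OF \<sigma>]]) auto
  have inner: "(LBINT z=ereal a..ereal y. 1 / (\<sigma> z)\<^sup>2) = (deriv \<psi> a - deriv \<psi> y) / (2 * c)" if y: "y \<in> {0<..<1}" for y
  proof -
    have "(LBINT z=ereal a..ereal y. 1 / (\<sigma> z)\<^sup>2) = (\<lambda>z. - deriv \<psi> z / (2 * c)) y - (\<lambda>z. - deriv \<psi> z / (2 * c)) a"
    proof (rule FTC_unit_interval[OF _ inv_cont a y])
      fix z :: real assume "z \<in> {0<..<1}"
      from DERIV_cdivide[OF DERIV_minus[OF psi_solution_derivs(2)[OF \<psi> this]], of "2 * c"]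
      show "((\<lambda>z. - deriv \<psi> z / (2 * c)) has_real_derivative 1 / (\<sigma> z)\<^sup>2) (at z)" using c by simp
    qed
    then show ?thesis by (simp add: diff_divide_distrib)
  qed
  have outer: "(LBINT y=ereal a..ereal x. (LBINT z=ereal a..ereal y. 1 / (\<sigma> z)\<^sup>2)) =
    (deriv \<psi> a * (x - a) - (\<psi> x - \<psi> a)) / (2 * c)" if x: "x \<in> {0<..<1}" for x
  proof -
    have "(LBINT y=ereal a..ereal x. (LBINT z=ereal a..ereal y. 1 / (\<sigma> z)\<^sup>2)) =
      (LBINT y=ereal a..ereal x. (deriv \<psi> a - deriv \<psi> y) / (2 * c))"
    proof (rule interval_integral_cong)
      fix y assume "y \<in> einterval (min (ereal a) (ereal x)) (max (ereal a) (ereal x))"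
      then have "y \<in> {0<..<1}" using a x by (auto simp: einterval_iff min_def max_def split: if_splits)
      then show "(LBINT z=ereal a..ereal y. 1 / (\<sigma> z)\<^sup>2) = (deriv \<psi> a - deriv \<psi> y) / (2 * c)" by (rule inner)
    qed
    also have "\<dots> = (\<lambda>y. (deriv \<psi> a * y - \<psi> y) / (2 * c)) x - (\<lambda>y. (deriv \<psi> a * y - \<psi> y) / (2 * c)) a"
    proof (rule FTC_unit_interval[OF _ _ a x])
      show "continuous_on {0<..<1} (\<lambda>y. (deriv \<psi> a - deriv \<psi> y) / (2 * c))"
        using c by (intro continuous_intros continuous_at_imp_continuous_on ballI DERIV_isCont[OF psi_solution_derivs(2)[OF \<psi>]]) auto
      fix y :: real assume y: "y \<in> {0<..<1}"
      show "((\<lambda>y. (deriv \<psi> a * y - \<psi> y) / (2 * c)) has_real_derivative (deriv \<psi> a - deriv \<psi> y) / (2 * c)) (at y)"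
        by (intro DERIV_cdivide DERIV_diff psi_solution_derivs(1)[OF \<psi> y]) (auto intro!: derivative_eq_intros)
    qed
    finally show ?thesis by (simp add: diff_divide_distrib right_diff_distrib)
  qed
  define K where "K = \<bar>\<psi> a\<bar> + \<bar>deriv \<psi> a\<bar>"
  let ?I = "\<lambda>x. (LBINT y=ereal a..ereal x. (LBINT z=ereal a..ereal y. 1 / (\<sigma> z)\<^sup>2))"
  have lower: "- K + 2 * c * ?I x \<le> g x - \<psi> x" if x: "x \<in> {0<..<1}" for x
  proof -
    have "\<bar>deriv \<psi> a * (x - a)\<bar> \<le> \<bar>deriv \<psi> a\<bar> * 1"
      unfolding abs_mult using x a by (intro mult_left_mono) auto
    moreover have "2 * c * ?I x = deriv \<psi> a * (x - a) - (\<psi> x - \<psi> a)"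
      unfolding outer[OF x] using c by simp
    ultimately show ?thesis using g[OF x] unfolding K_def by linarith
  qed
  have lims: "filterlim ?I at_top (at_right 0)" "filterlim ?I at_top (at_left 1)"
    using \<sigma> a unfolding cond_sigma_def by blast+
  have top: "filterlim (\<lambda>x. - K + 2 * c * ?I x) at_top G" if "filterlim ?I at_top G" for G
    using c that by (intro filterlim_tendsto_add_at_top[OF tendsto_const] filterlim_tendsto_pos_mult_at_top[OF tendsto_const]) auto
  show "filterlim (\<lambda>x. g x - \<psi> x) at_top (at_right 0)"
  proof (rule filterlim_at_top_mono[OF top[OF lims(1)]])
    show "\<forall>\<^sub>F x in at_right 0. - K + 2 * c * ?I x \<le> g x - \<psi> x"
      by (rule eventually_mono[OF eventually_at_right_real[OF zero_less_one]]) (rule lower)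
  qed
  show "filterlim (\<lambda>x. g x - \<psi> x) at_top (at_left 1)"
  proof (rule filterlim_at_top_mono[OF top[OF lims(2)]])
    show "\<forall>\<^sub>F x in at_left 1. - K + 2 * c * ?I x \<le> g x - \<psi> x"
      by (rule eventually_mono[OF eventually_at_left_real[OF zero_less_one]]) (rule lower)
  qed
qed

lemma generator_continuous:
  assumes "cond_sigma \<sigma>" "cond_g g"
  shows "continuous_on {0<..<1} (generator \<sigma> g)"
proof -
  have "continuous_on {0<..<1} (deriv (deriv g))" using assms(2) by (simp add: cond_g_def C2_on_def)
  moreover have "continuous_on {0<..<1} \<sigma>"
    by (rule continuous_on_subset[OF cond_sigma_continuous[OF assms(1)]]) auto
  ultimately show ?thesis unfolding generator_def[abs_def] by (intro continuous_intros)
qed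

lemma second_derivative_generator:
  assumes "cond_sigma \<sigma>" "x \<in> {0<..<1}"
  shows "deriv (deriv g) x - - 2 * c / (\<sigma> x)\<^sup>2 = 2 / (\<sigma> x)\<^sup>2 * (generator \<sigma> g x + c)"
  using cond_sigma_nonzero[OF assms] by (simp add: generator_def field_simps)

text \<open>Monotonicity is given on the open intervals on either side of x0; continuity of the
  generator at x0 extends the comparison to the point itself.\<close>

lemma generator_ge_min:
  assumes \<sigma>: "cond_sigma \<sigma>" and g: "cond_g g" and sh: "cond_shape \<sigma> g x0" and x: "x \<in> {0<..<1}"
  shows "generator \<sigma> g x0 \<le> generator \<sigma> g x"
proof -
  let ?L = "generator \<sigma> g"
  have x0: "0 < x0" "x0 < 1" and dec: "\<And>y z. 0 < y \<Longrightarrow> y < z \<Longrightarrow> z < x0 \<Longrightarrow> ?L z < ?L y"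
    and inc: "\<And>y z. x0 < y \<Longrightarrow> y < z \<Longrightarrow> z < 1 \<Longrightarrow> ?L y < ?L z"
    using sh by (auto simp: cond_shape_def monotone_on_def)
  have cont: "isCont ?L x0"
    using generator_continuous[OF \<sigma> g] x0 by (simp add: continuous_on_eq_continuous_at)
  consider "x < x0" | "x = x0" | "x0 < x" by linarith
  then show ?thesis
  proof cases
    case 1
    have "(?L \<longlongrightarrow> ?L x0) (at_left x0)" using cont by (auto simp: isCont_def intro: tendsto_mono[OF at_le])
    moreover have "\<forall>\<^sub>F y in at_left x0. ?L y \<le> ?L x"
      using eventually_at_left_real[OF 1] x by (auto elim!: eventually_mono intro: less_imp_le[OF dec])
    ultimately show ?thesis by (rule tendsto_upperbound) simp
  next
    case 3
    have "(?L \<longlongrightarrow> ?L x0) (at_right x0)" using cont by (auto simp: isCont_def intro: tendsto_mono[OF at_le])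
    moreover have "\<forall>\<^sub>F y in at_right x0. ?L y \<le> ?L x"
      using eventually_at_right_real[OF 3] x by (auto elim!: eventually_mono intro: less_imp_le[OF inc])
    ultimately show ?thesis by (rule tendsto_upperbound) simp
  qed simp
qed

text \<open>The inflection points are the zeros of \<phi>, which is negative at x0 and strictly
  monotone on either side. There is a zero on each side: otherwise H would be concave there, hence
  bounded above by its tangent at x0, against the blow-up at the end of that side.\<close>

lemma convex_concave_convex_difference:
  assumes \<sigma>: "cond_sigma \<sigma>" and g: "cond_g g" and g0: "\<And>x. x \<in> {0..1} \<Longrightarrow> 0 \<le> g x"
    and sh: "cond_shape \<sigma> g x0" and c: "0 < c"
    and \<psi>: "psi_solution \<sigma> c \<psi>" and neg: "generator \<sigma> g x0 < - c"
  obtains a b where "convex_concave_convex (\<lambda>y. g y - \<psi> y) (\<lambda>y. deriv g y - deriv \<psi> y) a b"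
proof -
  define \<phi> where "\<phi> x = generator \<sigma> g x + c" for x
  have x0: "0 < x0" "x0 < 1" and dec: "\<And>y z. 0 < y \<Longrightarrow> y < z \<Longrightarrow> z < x0 \<Longrightarrow> \<phi> z < \<phi> y"
    and inc: "\<And>y z. x0 < y \<Longrightarrow> y < z \<Longrightarrow> z < 1 \<Longrightarrow> \<phi> y < \<phi> z"
    using sh by (auto simp: cond_shape_def monotone_on_def \<phi>_def)
  have \<phi>_cont: "continuous_on {0<..<1} \<phi>"
    unfolding \<phi>_def[abs_def] by (intro continuous_intros generator_continuous[OF \<sigma> g])
  have \<phi>0: "\<phi> x0 < 0" using neg by (simp add: \<phi>_def)
  let ?H = "\<lambda>y. g y - \<psi> y" and ?H1 = "\<lambda>y. deriv g y - deriv \<psi> y"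
  have C2: "C2_on {0<..<1} g" using g by (simp add: cond_g_def)
  have DH: "(?H has_real_derivative ?H1 x) (at x)" if "x \<in> {0<..<1}" for x
    by (rule DERIV_diff[OF C2_on_derivs(1)[OF C2 that] psi_solution_derivs(1)[OF \<psi> that]])
  have DH1: "(?H1 has_real_derivative 2 / (\<sigma> x)\<^sup>2 * \<phi> x) (at x)" if "x \<in> {0<..<1}" for x
    using DERIV_diff[OF C2_on_derivs(2)[OF C2 that] psi_solution_derivs(2)[OF \<psi> that]]
    unfolding second_derivative_generator[OF \<sigma> that] \<phi>_def .
  have sq: "0 < 2 / (\<sigma> x)\<^sup>2" if "x \<in> {0<..<1}" for x using cond_sigma_nonzero[OF \<sigma> that] by simp
  have mvt1: "\<exists>z. x < z \<and> z < y \<and> ?H1 y - ?H1 x = (y - x) * (2 / (\<sigma> z)\<^sup>2 * \<phi> z)" if "0 < x" "x < y" "y < 1" for x y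
  proof (rule MVT2[OF that(2)])
    show "(?H1 has_real_derivative 2 / (\<sigma> w)\<^sup>2 * \<phi> w) (at w)" if "x \<le> w" "w \<le> y" for w
      by (rule DH1) (use that \<open>0 < x\<close> \<open>y < 1\<close> in simp)
  qed
  have mvt0: "\<exists>z. x < z \<and> z < y \<and> ?H y - ?H x = (y - x) * ?H1 z" if "0 < x" "x < y" "y < 1" for x y
  proof (rule MVT2[OF that(2)])
    show "(?H has_real_derivative ?H1 w) (at w)" if "x \<le> w" "w \<le> y" for w
      by (rule DH) (use that \<open>0 < x\<close> \<open>y < 1\<close> in simp)
  qed
  have gpos: "0 \<le> g x" if "x \<in> {0<..<1}" for x using g0 that by simp
  have lims: "filterlim ?H at_top (at_right 0)" "filterlim ?H at_top (at_left 1)"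
    by (rule psi_solution_at_top[OF \<sigma> \<psi> c gpos]; assumption)+
  have H1_strict: "?H1 x < ?H1 y" if xy: "0 < x" "x < y" "y < 1" and "\<And>z. x < z \<Longrightarrow> z < y \<Longrightarrow> 0 < \<phi> z" for x y
  proof -
    obtain z where z: "x < z" "z < y" "?H1 y - ?H1 x = (y - x) * (2 / (\<sigma> z)\<^sup>2 * \<phi> z)" using mvt1[OF xy] by blast
    have "0 < (y - x) * (2 / (\<sigma> z)\<^sup>2 * \<phi> z)"
      by (intro mult_pos_pos sq that(4)) (use z xy in auto)
    then show ?thesis using z(3) by linarith
  qed
  have H1_strict': "?H1 y < ?H1 x" if xy: "0 < x" "x < y" "y < 1" and "\<And>z. x < z \<Longrightarrow> z < y \<Longrightarrow> \<phi> z < 0" for x y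
  proof -
    obtain z where z: "x < z" "z < y" "?H1 y - ?H1 x = (y - x) * (2 / (\<sigma> z)\<^sup>2 * \<phi> z)" using mvt1[OF xy] by blast
    have "(y - x) * (2 / (\<sigma> z)\<^sup>2 * \<phi> z) < 0"
      by (intro mult_pos_neg sq that(4)) (use z xy in auto)
    then show ?thesis using z(3) by linarith
  qed
  have ex_l: "\<exists>s. 0 < s \<and> s < x0 \<and> 0 < \<phi> s"
  proof (rule ccontr)
    assume no: "\<not> ?thesis"
    \<comment> \<open>\<phi> \<le> 0 at z / 2 and strict decrease give strict negativity at
      z.\<close>
    have neg': "\<phi> z < 0" if "0 < z" "z < x0" for z
    proof -
      have "\<not> (0 < z / 2 \<and> z / 2 < x0 \<and> 0 < \<phi> (z / 2))" using no by blast
      then have "\<phi> (z / 2) \<le> 0" using that by auto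
      then show ?thesis using dec[of "z / 2" z] that by simp
    qed
    have bd: "?H y \<le> ?H x0 + \<bar>?H1 x0\<bar>" if y: "0 < y" "y < x0" for y
    proof -
      obtain z where z: "y < z" "z < x0" "?H x0 - ?H y = (x0 - y) * ?H1 z" using mvt0[of y x0] y x0 by blast
      have "?H1 x0 < ?H1 z" by (rule H1_strict') (use z y x0 neg' in auto)
      then have "(x0 - y) * ?H1 x0 \<le> (x0 - y) * ?H1 z" using y by (intro mult_left_mono) auto
      moreover have "\<bar>(x0 - y) * ?H1 x0\<bar> \<le> 1 * \<bar>?H1 x0\<bar>" unfolding abs_mult using y x0 by (intro mult_right_mono) auto
      then have "- ((x0 - y) * ?H1 x0) \<le> 1 * \<bar>?H1 x0\<bar>" by (rule abs_le_D2)
      moreover have "h \<le> h' + r" if "p \<le> q" "- p \<le> 1 * r" "h' - h = q" for p q r h h' :: real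
        using that by linarith
      ultimately show ?thesis using z(3) by blast
    qed
    have "\<forall>\<^sub>F y in at_right 0. ?H x0 + \<bar>?H1 x0\<bar> < ?H y" using lims(1) by (simp add: filterlim_at_top_dense)
    moreover have "\<forall>\<^sub>F y in at_right 0. y \<in> {0<..<x0}" using x0 by (intro eventually_at_right_real)
    ultimately have "\<forall>\<^sub>F y in at_right (0::real). False" by eventually_elim (use bd in fastforce)
    then show False by simp
  qed
  have ex_r: "\<exists>s. x0 < s \<and> s < 1 \<and> 0 < \<phi> s"
  proof (rule ccontr)
    assume no: "\<not> ?thesis"
    have neg': "\<phi> z < 0" if "x0 < z" "z < 1" for z
    proof -
      have "\<not> (x0 < (z + 1) / 2 \<and> (z + 1) / 2 < 1 \<and> 0 < \<phi> ((z + 1) / 2))" using no by blast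
      then have "\<phi> ((z + 1) / 2) \<le> 0" using that by auto
      then show ?thesis using inc[of z "(z + 1) / 2"] that by simp
    qed
    have bd: "?H y \<le> ?H x0 + \<bar>?H1 x0\<bar>" if y: "x0 < y" "y < 1" for y
    proof -
      obtain z where z: "x0 < z" "z < y" "?H y - ?H x0 = (y - x0) * ?H1 z" using mvt0[of x0 y] y x0 by blast
      have "?H1 z < ?H1 x0" by (rule H1_strict') (use z y x0 neg' in auto)
      then have "(y - x0) * ?H1 z \<le> (y - x0) * ?H1 x0" using y by (intro mult_left_mono) auto
      moreover have "\<bar>(y - x0) * ?H1 x0\<bar> \<le> 1 * \<bar>?H1 x0\<bar>" unfolding abs_mult using y x0 by (intro mult_right_mono) auto
      then have "(y - x0) * ?H1 x0 \<le> 1 * \<bar>?H1 x0\<bar>" by (rule abs_le_D1)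
      moreover have "h \<le> h' + r" if "q \<le> p" "p \<le> 1 * r" "h - h' = q" for p q r h h' :: real
        using that by linarith
      ultimately show ?thesis using z(3) by blast
    qed
    have "\<forall>\<^sub>F y in at_left 1. ?H x0 + \<bar>?H1 x0\<bar> < ?H y" using lims(2) by (simp add: filterlim_at_top_dense)
    moreover have "\<forall>\<^sub>F y in at_left 1. y \<in> {x0<..<1}" using x0 by (intro eventually_at_left_real)
    ultimately have "\<forall>\<^sub>F y in at_left (1::real). False" by eventually_elim (use bd in fastforce)
    then show False by simp
  qed
  obtain s where s: "0 < s" "s < x0" "0 < \<phi> s" using ex_l by blast
  have "continuous_on {s..x0} \<phi>"
    by (rule continuous_on_subset[OF \<phi>_cont]) (use s x0 in auto)
  then obtain a where a: "s \<le> a" "a \<le> x0" "\<phi> a = 0"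
    using IVT2'[of \<phi> x0 0 s] s \<phi>0 by auto
  obtain r where r: "x0 < r" "r < 1" "0 < \<phi> r" using ex_r by blast
  have "continuous_on {x0..r} \<phi>"
    by (rule continuous_on_subset[OF \<phi>_cont]) (use r x0 in auto)
  then obtain b where b: "x0 \<le> b" "b \<le> r" "\<phi> b = 0"
    using IVT'[of \<phi> x0 0 r] r \<phi>0 by auto
  have ax: "0 < a" "a < x0" using a s \<phi>0 by (auto simp: le_less)
  have bx: "x0 < b" "b < 1" using b r \<phi>0 by (auto simp: le_less)
  have pl: "0 < \<phi> z" if "0 < z" "z < a" for z using dec[of z a] that ax a by simp
  have pr: "0 < \<phi> z" if "b < z" "z < 1" for z using inc[of b z] that bx b by simp
  have pm: "\<phi> z < 0" if "a < z" "z < b" for z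
  proof -
    consider "z < x0" | "z = x0" | "x0 < z" by linarith
    then show ?thesis
      by cases (use dec[of a z] inc[of z b] that ax bx a b \<phi>0 in auto)
  qed
  have "convex_concave_convex ?H ?H1 a b"
  proof
    show "0 < a" "a < b" "b < 1" using ax bx by auto
    show "?H1 x < ?H1 y" if "0 < x" "x < y" "y \<le> a" for x y
      by (rule H1_strict) (use that ax x0 pl in auto)
    show "?H1 y < ?H1 x" if "a \<le> x" "x < y" "y \<le> b" for x y
      by (rule H1_strict') (use that ax bx pm in auto)
    show "?H1 x < ?H1 y" if "b \<le> x" "x < y" "y < 1" for x y
      by (rule H1_strict) (use that bx x0 pr in auto)
    show "(?H has_real_derivative ?H1 x) (at x)" if "x \<in> {0<..<1}" for x by (rule DH[OF that])
    show "filterlim ?H at_top (at_right 0)" "filterlim ?H at_top (at_left 1)" by (fact lims)+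
  qed
  then show ?thesis by (rule that)
qed

text \<open>Costs are written with \<open>X\<close>, whose paths are regular only almost surely;
  completeness transfers measurability of stopped values from the version that is regular
  everywhere.\<close>

lemma (in complete_measure) borel_measurable_AE_eq:
  assumes f: "f \<in> borel_measurable M" and eq: "AE x in M. f x = g x"
  shows "g \<in> borel_measurable M"
proof (rule measurableI)
  fix A :: "'b set" assume A: "A \<in> sets borel"
  show "g -` A \<inter> space M \<in> sets M"
  proof (rule in_sets_AE)
    show "f -` A \<inter> space M \<in> sets M" using f A by (rule measurable_sets)
    show "AE x in M. x \<in> f -` A \<inter> space M \<longleftrightarrow> x \<in> g -` A \<inter> space M" using eq by eventually_elim auto
  qed auto
qed auto

lemma set_integral_const_initial: "0 \<le> r \<Longrightarrow> (LINT u:{0..r}|lborel. c) = c * (r :: real)"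
  by (simp add: set_lebesgue_integral_def)

section \<open>Costs of admissible stopping times\<close>

context brownian
begin

lemma admissible_timeD:
  assumes "\<tau> \<in> admissible_times M B"
  shows "\<tau> \<in> borel_measurable P" "\<And>t. 0 \<le> t \<Longrightarrow> {\<omega> \<in> space P. \<tau> \<omega> \<le> ennreal t} \<in> sets (F t)"
    "(\<integral>\<^sup>+\<omega>. \<tau> \<omega> \<partial>P) < \<infinity>"
proof -
  have st: "stopping_time (usual_augmentation M B) \<tau>" and "(\<integral>\<^sup>+\<omega>. \<tau> \<omega> \<partial>P) < \<infinity>"
    using assms by (auto simp: admissible_times_def)
  then show "(\<integral>\<^sup>+\<omega>. \<tau> \<omega> \<partial>P) < \<infinity>" by simp
  show "\<tau> \<in> borel_measurable P"
    by (rule measurable_stopping_time[OF st sets_usual_augmentation_subset]) simp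
  show "{\<omega> \<in> space P. \<tau> \<omega> \<le> ennreal t} \<in> sets (F t)" if "0 \<le> t" for t
    using stopping_timeD[OF st, of "ennreal t"] by (simp add: pred_def)
qed

lemma zero_admissible: "(\<lambda>_. 0) \<in> admissible_times M B"
  by (simp add: admissible_times_def stopping_time_def)

definition cost :: "(real \<Rightarrow> 'a \<Rightarrow> real) \<Rightarrow> real \<Rightarrow> (real \<Rightarrow> real) \<Rightarrow> ('a \<Rightarrow> ennreal) \<Rightarrow> real" where
  "cost Z c g \<tau> = (\<integral>\<omega>. c * enn2real (\<tau> \<omega>) + g (Z (enn2real (\<tau> \<omega>)) \<omega>) \<partial>P)"

lemma value_function_eq: "value_function M B X c g x = (INF \<tau>\<in>admissible_times M B. cost (X x) c g \<tau>)"
  unfolding value_function_def cost_def by (simp add: set_integral_const_initial)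

lemma cost_zero:
  assumes "AE \<omega> in P. Z 0 \<omega> = x"
  shows "cost Z c g (\<lambda>_. 0) = g x"
proof -
  have eq: "AE \<omega> in P. g x = c * enn2real 0 + g (Z (enn2real 0) \<omega>)" using assms by auto
  have "(\<lambda>\<omega>. c * enn2real 0 + g (Z (enn2real 0) \<omega>)) \<in> borel_measurable P"
    by (rule P.borel_measurable_AE_eq[OF _ eq]) simp
  then have "cost Z c g (\<lambda>_. 0) = (\<integral>\<omega>. g x \<partial>P)"
    unfolding cost_def using eq by (intro integral_cong_AE) auto
  then show ?thesis by (simp add: prob_space)
qed

lemma cost_cong:
  assumes "AE \<omega> in P. \<forall>t\<ge>0. Y t \<omega> = Z t \<omega>"
    and m: "(\<lambda>\<omega>. c * enn2real (\<tau> \<omega>) + g (Y (enn2real (\<tau> \<omega>)) \<omega>)) \<in> borel_measurable P"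
  shows "cost Z c g \<tau> = cost Y c g \<tau>"
proof -
  have eq: "AE \<omega> in P. c * enn2real (\<tau> \<omega>) + g (Y (enn2real (\<tau> \<omega>)) \<omega>) = c * enn2real (\<tau> \<omega>) + g (Z (enn2real (\<tau> \<omega>)) \<omega>)"
    using assms(1) by eventually_elim simp
  show ?thesis unfolding cost_def
    using P.borel_measurable_AE_eq[OF m eq] m eq by (intro integral_cong_AE) auto
qed

end

text \<open>An interior starting point, with the given solution \<open>X\<close> and its everywhere
  regular version \<open>Y\<close>. Both have the same costs, so estimates are made for
  \<open>Y\<close> and stated for \<open>X\<close>.\<close>

locale optimal_stopping = brownian M B for M :: "'a measure" and B :: "real \<Rightarrow> 'a \<Rightarrow> real" +
  fixes \<sigma> g :: "real \<Rightarrow> real" and x :: real and X Y :: "real \<Rightarrow> 'a \<Rightarrow> real" and c :: real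
  assumes diff: "bounded_diffusion P F Y (\<lambda>y. (\<sigma> y)\<^sup>2) x"
    and YX: "AE \<omega> in P. \<forall>t\<ge>0. Y t \<omega> = X t \<omega>"
    and x: "x \<in> {0<..<1}" and c: "0 < c"
    and g: "continuous_on {0..1} g" "\<And>y. y \<in> {0..1} \<Longrightarrow> 0 \<le> g y"
begin

sublocale D: bounded_diffusion P F Y "\<lambda>y. (\<sigma> y)\<^sup>2" x
  by (rule diff)

lemma stopped:
  assumes f: "\<And>u. u \<in> {0..1} \<Longrightarrow> (f has_real_derivative f' u) (at u within {0..1})"
    and f': "\<And>u. u \<in> {0..1} \<Longrightarrow> (f' has_real_derivative h u) (at u within {0..1})"
    and h: "continuous_on {0..1} h" and \<tau>: "\<tau> \<in> admissible_times M B"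
  shows "integrable P (\<lambda>\<omega>. enn2real (\<tau> \<omega>))"
    and "(\<lambda>\<omega>. Y (enn2real (\<tau> \<omega>)) \<omega>) \<in> borel_measurable P"
    and "integrable P (\<lambda>\<omega>. integral {0..enn2real (\<tau> \<omega>)} (\<lambda>u. h (Y u \<omega>) * (\<sigma> (Y u \<omega>))\<^sup>2 / 2))"
    and "(\<integral>\<omega>. f (Y (enn2real (\<tau> \<omega>)) \<omega>) \<partial>P) =
      f x + (\<integral>\<omega>. integral {0..enn2real (\<tau> \<omega>)} (\<lambda>u. h (Y u \<omega>) * (\<sigma> (Y u \<omega>))\<^sup>2 / 2) \<partial>P)"
  using D.optional_stopping[OF f f' h admissible_timeD[OF \<tau>]] by blast+

lemma payoff_measurable:
  fixes \<phi> :: "real \<Rightarrow> real"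
  assumes \<tau>: "\<tau> \<in> admissible_times M B" and \<phi>: "continuous_on {0..1} \<phi>"
  shows "integrable P (\<lambda>\<omega>. enn2real (\<tau> \<omega>))" "integrable P (\<lambda>\<omega>. \<phi> (Y (enn2real (\<tau> \<omega>)) \<omega>))"
proof -
  note s = stopped[of "\<lambda>_. 0" "\<lambda>_. 0" "\<lambda>_. 0" \<tau>]
  show "integrable P (\<lambda>\<omega>. enn2real (\<tau> \<omega>))" by (rule s(1)) (auto intro: \<tau>)
  have m: "(\<lambda>\<omega>. Y (enn2real (\<tau> \<omega>)) \<omega>) \<in> borel_measurable P" by (rule s(2)) (auto intro: \<tau>)
  obtain C where "0 \<le> C" "\<forall>y\<in>{0..1}. \<bar>\<phi> y\<bar> \<le> C" using D.continuous_bounded[OF \<phi>] by blast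
  then show "integrable P (\<lambda>\<omega>. \<phi> (Y (enn2real (\<tau> \<omega>)) \<omega>))"
    using D.range_Y by (intro D.bounded_integrable[of _ C] D.comp_measurable[OF \<phi> m]) blast+
qed

lemma cost_eq:
  assumes \<tau>: "\<tau> \<in> admissible_times M B"
  shows "cost X c g \<tau> = cost Y c g \<tau>"
  using YX payoff_measurable[OF \<tau> g(1)] by (intro cost_cong) auto

lemma cost_nonneg:
  assumes \<tau>: "\<tau> \<in> admissible_times M B"
  shows "0 \<le> cost X c g \<tau>"
  unfolding cost_eq[OF \<tau>] unfolding cost_def
  using c g(2) D.range_Y by (intro Bochner_Integration.integral_nonneg add_nonneg_nonneg mult_nonneg_nonneg) auto

lemma value_le_cost:
  assumes "\<tau> \<in> admissible_times M B"
  shows "(INF \<tau>\<in>admissible_times M B. cost X c g \<tau>) \<le> cost X c g \<tau>"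
  by (rule cINF_lower[OF bdd_belowI2[of _ 0] assms]) (rule cost_nonneg)

lemma value_le_g: "(INF \<tau>\<in>admissible_times M B. cost X c g \<tau>) \<le> g x"
  using value_le_cost[OF zero_admissible] cost_eq[OF zero_admissible] cost_zero[of Y x c g] D.Y_0 by simp

lemma value_nonneg: "0 \<le> (INF \<tau>\<in>admissible_times M B. cost X c g \<tau>)"
  using zero_admissible by (intro cINF_greatest cost_nonneg) auto

text \<open>Verification inequality: as the generator of f is at least -c, optional stopping bounds
  \<open>f x\<close> by c times the mean of \<tau> plus the mean of f at the stopped position, where
  f \<le> g + \<eta>.\<close>

lemma cost_ge:
  assumes f: "\<And>u. u \<in> {0..1} \<Longrightarrow> (f has_real_derivative f' u) (at u within {0..1})"
    and f': "\<And>u. u \<in> {0..1} \<Longrightarrow> (f' has_real_derivative h u) (at u within {0..1})"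
    and h: "continuous_on {0..1} h" and \<tau>: "\<tau> \<in> admissible_times M B"
    and hc: "\<And>y. y \<in> {0..1} \<Longrightarrow> - c \<le> h y * (\<sigma> y)\<^sup>2 / 2"
    and le: "\<And>y. y \<in> {0..1} \<Longrightarrow> f y \<le> g y + \<eta>"
  shows "f x - \<eta> \<le> cost X c g \<tau>"
proof -
  let ?T = "\<lambda>\<omega>. enn2real (\<tau> \<omega>)"
  let ?A = "\<lambda>\<omega>. integral {0..?T \<omega>} (\<lambda>u. h (Y u \<omega>) * (\<sigma> (Y u \<omega>))\<^sup>2 / 2)"
  note s = stopped[OF f f' h \<tau>]
  have fc: "continuous_on {0..1} f" by (rule DERIV_continuous_on[OF f])
  note ig = payoff_measurable(2)[OF \<tau> g(1)] and if' = payoff_measurable(2)[OF \<tau> fc]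
  have A_ge: "- c * ?T \<omega> \<le> ?A \<omega>" for \<omega>
  proof -
    have "integral {0..?T \<omega>} (\<lambda>u. - c) \<le> ?A \<omega>"
    proof (rule integral_le)
      show "(\<lambda>u. h (Y u \<omega>) * (\<sigma> (Y u \<omega>))\<^sup>2 / 2) integrable_on {0..?T \<omega>}"
        by (intro integrable_continuous_interval continuous_intros D.comp_continuous[OF h] D.comp_continuous[OF D.v]) simp
    qed (use hc D.range_Y in auto)
    moreover have "integral {0..?T \<omega>} (\<lambda>u. - c) = - c * ?T \<omega>" by simp
    ultimately show ?thesis by (simp only:)
  qed
  have "- c * (\<integral>\<omega>. ?T \<omega> \<partial>P) = (\<integral>\<omega>. - c * ?T \<omega> \<partial>P)" using s(1) by simp
  also have "\<dots> \<le> (\<integral>\<omega>. ?A \<omega> \<partial>P)" by (rule integral_mono) (use s A_ge in auto)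
  also have "\<dots> = (\<integral>\<omega>. f (Y (?T \<omega>) \<omega>) \<partial>P) - f x" using s(4) by simp
  also have "(\<integral>\<omega>. f (Y (?T \<omega>) \<omega>) \<partial>P) \<le> (\<integral>\<omega>. g (Y (?T \<omega>) \<omega>) + \<eta> \<partial>P)"
    by (rule integral_mono) (use if' ig le D.range_Y in auto)
  also have "\<dots> = (\<integral>\<omega>. g (Y (?T \<omega>) \<omega>) \<partial>P) + \<eta>" using ig by (simp add: prob_space)
  finally have "f x - \<eta> \<le> c * (\<integral>\<omega>. ?T \<omega> \<partial>P) + (\<integral>\<omega>. g (Y (?T \<omega>) \<omega>) \<partial>P)" by simp
  also have "\<dots> = cost Y c g \<tau>" unfolding cost_def using s(1) ig by simp
  finally show ?thesis unfolding cost_eq[OF \<tau>] .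
qed

text \<open>The lower test function is available for 0 < \<eta> < w, and \<eta> is then sent to 0.
  For w \<le> 0 the bound is immediate, because costs are nonnegative.\<close>

lemma value_ge:
  assumes \<sigma>: "continuous_on {0..1} \<sigma>" "\<And>x. x \<in> {0<..<1} \<Longrightarrow> \<sigma> x \<noteq> 0" and g01: "g 0 = 0" "g 1 = 0"
    and u: "\<And>y. y \<in> {0<..<1} \<Longrightarrow> (u has_real_derivative u' y) (at y)"
      "\<And>y. y \<in> {0<..<1} \<Longrightarrow> (u' has_real_derivative u2 y) (at y)"
      "\<And>y. y \<in> {0<..<1} \<Longrightarrow> - 2 * c / (\<sigma> y)\<^sup>2 \<le> u2 y"
    and line: "\<And>y. y \<in> {0<..<1} \<Longrightarrow> w - u x + k * (y - x) \<le> g y - u y"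
  shows "w \<le> (INF \<tau>\<in>admissible_times M B. cost X c g \<tau>)" (is "w \<le> ?V")
proof (cases "w \<le> 0")
  case True
  then show ?thesis using value_nonneg by linarith
next
  case False
  have "w - \<eta> \<le> ?V" if \<eta>: "0 < \<eta>" "\<eta> < w" for \<eta>
  proof -
    obtain f f' h where f: "\<And>y. y \<in> {0..1} \<Longrightarrow> (f has_real_derivative f' y) (at y within {0..1})"
      "\<And>y. y \<in> {0..1} \<Longrightarrow> (f' has_real_derivative h y) (at y within {0..1})"
      "continuous_on {0..1} h" "\<And>y. y \<in> {0..1} \<Longrightarrow> - c \<le> h y * (\<sigma> y)\<^sup>2 / 2"
      "f x = w" "\<And>y. y \<in> {0..1} \<Longrightarrow> f y \<le> g y + \<eta>"
      using ex_lower_test_function[OF \<sigma> c g g01 u x line \<eta>] by blast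
    show ?thesis
    proof (rule cINF_greatest)
      show "admissible_times M B \<noteq> {}" using zero_admissible by blast
      show "w - \<eta> \<le> cost X c g \<tau>" if "\<tau> \<in> admissible_times M B" for \<tau>
        using cost_ge[OF f(1-3) that f(4,6)] f(5) by simp
    qed
  qed
  note bound = this
  show ?thesis
  proof (rule ccontr)
    assume "\<not> w \<le> ?V"
    \<comment> \<open>Half of w keeps \<eta> admissible, and half of the gap to the value makes the
      bound contradictory.\<close>
    then have "w - min (w / 2) ((w - ?V) / 2) \<le> ?V" using False by (intro bound) auto
    then show False using \<open>\<not> w \<le> ?V\<close> False by (auto simp: min_def field_simps split: if_splits)
  qed
qed

text \<open>Stop on leaving (A', B'), capped at time N. On that interval the generator of f equals
  -c, so optional stopping bounds the mean of the capped time by 2 C1 / c independently of N. The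
  exit is therefore missed with probability O(1/N), and the error \<open>K / N\<close> disappears as
  N grows.\<close>

lemma value_le:
  assumes \<sigma>: "continuous_on {0..1} \<sigma>" "\<And>x. x \<in> {0<..<1} \<Longrightarrow> \<sigma> x \<noteq> 0"
    and u: "\<And>y. y \<in> {0<..<1} \<Longrightarrow> (u has_real_derivative u' y) (at y)"
      "\<And>y. y \<in> {0<..<1} \<Longrightarrow> (u' has_real_derivative - 2 * c / (\<sigma> y)\<^sup>2) (at y)"
    and AB: "0 < A'" "A' < x" "x < B'" "B' < 1" and uAB: "u A' = g A'" "u B' = g B'"
  shows "(INF \<tau>\<in>admissible_times M B. cost X c g \<tau>) \<le> u x" (is "?V \<le> _")
proof -
  have AB': "A' < B'" using AB by simp
  obtain f f' h where f: "\<And>y. y \<in> {0..1} \<Longrightarrow> (f has_real_derivative f' y) (at y within {0..1})"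
      "\<And>y. y \<in> {0..1} \<Longrightarrow> (f' has_real_derivative h y) (at y within {0..1})"
      "continuous_on {0..1} h" "\<And>y. y \<in> {A'..B'} \<Longrightarrow> h y * (\<sigma> y)\<^sup>2 / 2 = - c"
      "\<And>y. y \<in> {A'..B'} \<Longrightarrow> f y = u y"
    using ex_interior_test_function[OF \<sigma> c u AB(1) AB' AB(4)] by blast
  have fc: "continuous_on {0..1} f" by (rule DERIV_continuous_on[OF f(1)])
  obtain C1 where "0 \<le> C1" "\<forall>y\<in>{0..1}. \<bar>f y\<bar> \<le> C1" using D.continuous_bounded[OF fc] by blast
  then have C1: "0 \<le> C1" "\<And>y. y \<in> {0..1} \<Longrightarrow> \<bar>f y\<bar> \<le> C1" by auto
  obtain C2 where "0 \<le> C2" "\<forall>y\<in>{0..1}. \<bar>g y\<bar> \<le> C2" using D.continuous_bounded[OF g(1)] by blast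
  then have C2: "0 \<le> C2" "\<And>y. y \<in> {0..1} \<Longrightarrow> \<bar>g y\<bar> \<le> C2" by auto
  define K where "K = (C1 + C2) * (2 * C1 / c)"
  have fx: "f x = u x" using f(5) AB by simp
  have main: "?V \<le> u x + K / N" if N: "0 < N" for N :: real
  proof -
    obtain T where T: "\<And>\<omega>. 0 \<le> T \<omega>" "\<And>\<omega>. T \<omega> \<le> N" "\<And>t. 0 \<le> t \<Longrightarrow> {\<omega> \<in> space P. T \<omega> \<le> t} \<in> sets (F t)"
      "\<And>\<omega> u. u \<in> {0..T \<omega>} \<Longrightarrow> Y u \<omega> \<in> {A'..B'}" "\<And>\<omega>. T \<omega> < N \<Longrightarrow> Y (T \<omega>) \<omega> \<in> {A', B'}"
      using D.exit_time[OF less_imp_le[OF N] AB(2,3)] by blast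
    define \<tau> where "\<tau> \<omega> = ennreal (T \<omega>)" for \<omega>
    have eT: "enn2real (\<tau> \<omega>) = T \<omega>" for \<omega> using T(1) by (simp add: \<tau>_def)
    have adm: "\<tau> \<in> admissible_times M B"
      unfolding admissible_times_def
    proof (intro CollectI conjI)
      show "stopping_time (usual_augmentation M B) \<tau>"
      proof (rule stopping_timeI)
        fix t :: ennreal
        show "Measurable.pred (usual_augmentation M B t) (\<lambda>\<omega>. \<tau> \<omega> \<le> t)"
        proof (cases t)
          case (real r)
          then have "{\<omega> \<in> space (F r). \<tau> \<omega> \<le> t} = {\<omega> \<in> space P. T \<omega> \<le> r}"
            by (simp add: \<tau>_def ennreal_le_iff)
          then show ?thesis using T(3)[of r] real by (simp add: pred_def)
        qed simp
      qed
      have "(\<integral>\<^sup>+\<omega>. \<tau> \<omega> \<partial>P) \<le> (\<integral>\<^sup>+\<omega>. ennreal N \<partial>P)"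
        by (rule nn_integral_mono) (simp add: \<tau>_def T(2) ennreal_leI)
      also have "\<dots> < \<infinity>" by (simp add: emeasure_space_1)
      finally show "(\<integral>\<^sup>+\<omega>. \<tau> \<omega> \<partial>P) < \<infinity>" .
    qed
    note s = stopped[OF f(1-3) adm, unfolded eT]
    note ig = payoff_measurable(2)[OF adm g(1), unfolded eT] and if' = payoff_measurable(2)[OF adm fc, unfolded eT]
    have A_eq: "integral {0..T \<omega>} (\<lambda>u. h (Y u \<omega>) * (\<sigma> (Y u \<omega>))\<^sup>2 / 2) = - c * T \<omega>" for \<omega>
    proof -
      have "integral {0..T \<omega>} (\<lambda>u. h (Y u \<omega>) * (\<sigma> (Y u \<omega>))\<^sup>2 / 2) = integral {0..T \<omega>} (\<lambda>u. - c)"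
        by (rule Henstock_Kurzweil_Integration.integral_cong) (rule f(4)[OF T(4)])
      then show ?thesis using T(1)[of \<omega>] by simp
    qed
    have Ef: "(\<integral>\<omega>. f (Y (T \<omega>) \<omega>) \<partial>P) = f x - c * (\<integral>\<omega>. T \<omega> \<partial>P)"
      using s(4) unfolding A_eq using s(1) by simp
    have "\<bar>\<integral>\<omega>. f (Y (T \<omega>) \<omega>) \<partial>P\<bar> \<le> (\<integral>\<omega>. C1 \<partial>P)"
      by (rule order_trans[OF integral_abs_bound integral_mono]) (use if' C1 D.range_Y in auto)
    then have "c * (\<integral>\<omega>. T \<omega> \<partial>P) \<le> 2 * C1" using Ef C1(2)[of x] x by (simp add: prob_space)
    then have ET: "(\<integral>\<omega>. T \<omega> \<partial>P) \<le> 2 * C1 / c" using c by (simp add: field_simps)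
    \<comment> \<open>Markov's inequality in pointwise form: f and g agree at an exit, and where the
      cap N is hit the extra term equals C1 + C2, which bounds g - f.\<close>
    have pw: "g (Y (T \<omega>) \<omega>) \<le> f (Y (T \<omega>) \<omega>) + (C1 + C2) / N * T \<omega>" for \<omega>
    proof (cases "T \<omega> < N")
      case True
      then have "g (Y (T \<omega>) \<omega>) = f (Y (T \<omega>) \<omega>)" using T(5)[OF True] f(5)[of A'] f(5)[of B'] uAB AB' by auto
      moreover have "0 \<le> (C1 + C2) / N * T \<omega>" using C1 C2 N T(1) by simp
      ultimately show ?thesis by simp
    next
      case False
      then have "T \<omega> = N" using T(2)[of \<omega>] by simp
      then have "(C1 + C2) / N * T \<omega> = C1 + C2" using N by simp
      then show ?thesis using C1(2)[OF D.range_Y[of "T \<omega>" \<omega>]] C2(2)[OF D.range_Y[of "T \<omega>" \<omega>]] by linarith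
    qed
    have "?V \<le> cost X c g \<tau>" by (rule value_le_cost[OF adm])
    also have "\<dots> = c * (\<integral>\<omega>. T \<omega> \<partial>P) + (\<integral>\<omega>. g (Y (T \<omega>) \<omega>) \<partial>P)"
      unfolding cost_eq[OF adm] unfolding cost_def eT using s(1) ig by simp
    also have "(\<integral>\<omega>. g (Y (T \<omega>) \<omega>) \<partial>P) \<le> (\<integral>\<omega>. f (Y (T \<omega>) \<omega>) + (C1 + C2) / N * T \<omega> \<partial>P)"
      by (rule integral_mono) (use ig if' s(1) pw in auto)
    also have "\<dots> = f x - c * (\<integral>\<omega>. T \<omega> \<partial>P) + (C1 + C2) / N * (\<integral>\<omega>. T \<omega> \<partial>P)"
      using if' s(1) Ef by simp
    also have "(C1 + C2) / N * (\<integral>\<omega>. T \<omega> \<partial>P) \<le> (C1 + C2) / N * (2 * C1 / c)"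
      using ET C1 C2 N by (intro mult_left_mono) auto
    finally show ?thesis unfolding fx K_def by (simp add: field_simps)
  qed
  have "(\<lambda>n. u x + K / real (Suc n)) \<longlonglongrightarrow> u x + 0"
    using tendsto_mult_left[OF lim_1_over_n[THEN LIMSEQ_Suc], of K] by (intro tendsto_intros) simp
  then have "?V \<le> u x + 0"
    by (rule LIMSEQ_le_const) (use main in auto)
  then show ?thesis by simp
qed

end

theorem theorem5p2:
  fixes M :: "'a measure"
    and B :: "real \<Rightarrow> 'a \<Rightarrow> real"
    and X :: "real \<Rightarrow> real \<Rightarrow> 'a \<Rightarrow> real"
    and \<sigma> g :: "real \<Rightarrow> real"
    and c x0 :: real
  assumes "prob_space M"
    and "brownian_motion M B"
    and "\<And>x. x \<in> {0..1} \<Longrightarrow> 0 \<le> \<sigma> x"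
    and "\<And>x. x \<in> {0..1} \<Longrightarrow> 0 \<le> g x"
    and "\<And>x. x \<in> {0<..<1} \<Longrightarrow> strong_solution M B \<sigma> x (X x)"
    and "\<And>x t \<omega>. x \<in> {0, 1} \<Longrightarrow> 0 \<le> t \<Longrightarrow> \<omega> \<in> space M \<Longrightarrow> X x t \<omega> = x"
    and "cond_sigma \<sigma>"
    and "0 < c"
    and "cond_g g"
    and "cond_shape \<sigma> g x0"
  shows "(generator \<sigma> g x0 \<ge> - c \<longrightarrow> (\<forall>x\<in>{0..1}. value_function M B X c g x = g x)) \<and>
    (generator \<sigma> g x0 < - c \<longrightarrow>
      (\<forall>\<psi>. psi_solution \<sigma> c \<psi> \<longrightarrow>
        (\<exists>!(p :: real \<times> real). double_tangent (\<lambda>y. g y - \<psi> y) (fst p) (snd p)) \<and>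
        (\<forall>A0 B0. double_tangent (\<lambda>y. g y - \<psi> y) A0 B0 \<longrightarrow>
          (\<forall>x\<in>{0..1}. value_function M B X c g x =
            (if x \<in> {A0<..<B0} then V_hat g \<psi> A0 x else g x)))))"
proof -
  interpret brownian M B using assms(1,2) by (simp add: brownian_def brownian_axioms_def)
  note \<sigma> = assms(7) and c = \<open>0 < c\<close> and cg = \<open>cond_g g\<close> and sh = \<open>cond_shape \<sigma> g x0\<close> and g0 = assms(4)
  note \<sigma>c = cond_sigma_continuous[OF \<sigma>] and nz = cond_sigma_nonzero[OF \<sigma>]
  have gc: "continuous_on {0..1} g" and C2: "C2_on {0<..<1} g" and g01: "g 0 = 0" "g 1 = 0"
    using cg by (auto simp: cond_g_def)
  \<comment> \<open>At 0 and 1 the process stands still and g vanishes, so stopping at once costs 0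
    and no cost is negative.\<close>
  have boundary: "value_function M B X c g x = g x" if x: "x \<in> {0, 1}" for x
  proof -
    have gx: "g x = 0" using x g01 by auto
    have cost_ge0: "0 \<le> cost (X x) c g \<tau>" for \<tau>
      unfolding cost_def
    proof (rule Bochner_Integration.integral_nonneg)
      fix \<omega> assume "\<omega> \<in> space P"
      then have "X x (enn2real (\<tau> \<omega>)) \<omega> = x" using assms(6)[OF x] by simp
      then show "0 \<le> c * enn2real (\<tau> \<omega>) + g (X x (enn2real (\<tau> \<omega>)) \<omega>)" using gx c by simp
    qed
    have "AE \<omega> in P. X x 0 \<omega> = x" using assms(6)[OF x] by (intro AE_I2) simp
    then have z: "cost (X x) c g (\<lambda>_. 0) = 0" using cost_zero[of "X x" x c g] gx by simp
    have "(INF \<tau>\<in>admissible_times M B. cost (X x) c g \<tau>) \<le> 0"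
      using cINF_lower[OF bdd_belowI2[of _ 0] zero_admissible, of "cost (X x) c g"] cost_ge0 z by simp
    moreover have "0 \<le> (INF \<tau>\<in>admissible_times M B. cost (X x) c g \<tau>)"
      using zero_admissible cost_ge0 by (intro cINF_greatest) auto
    ultimately show ?thesis unfolding value_function_eq gx by simp
  qed
  have OS: "\<exists>Y. optimal_stopping M B \<sigma> g x (X x) Y c" if x: "x \<in> {0<..<1}" for x
  proof -
    have x01: "x \<in> {0..1}" using x by simp
    obtain Y where Y: "bounded_diffusion P F Y (\<lambda>y. (\<sigma> y)\<^sup>2) x" "AE \<omega> in P. \<forall>t\<ge>0. Y t \<omega> = X x t \<omega>"
      using strong_solution_bounded_diffusion[OF assms(5)[OF x] \<sigma>c x01] by blast
    have "optimal_stopping_axioms M B \<sigma> g x (X x) Y c"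
      unfolding optimal_stopping_axioms_def using Y x c gc g0 by blast
    then show ?thesis unfolding optimal_stopping_def using brownian_axioms by blast
  qed
  have part1: "value_function M B X c g x = g x" if ge: "generator \<sigma> g x0 \<ge> - c" and x: "x \<in> {0..1}" for x
  proof (cases "x \<in> {0, 1}")
    case False
    then have x': "x \<in> {0<..<1}" using x by auto
    obtain Y where "optimal_stopping M B \<sigma> g x (X x) Y c" using OS[OF x'] by blast
    then interpret O: optimal_stopping M B \<sigma> g x "X x" Y c .
    \<comment> \<open>With u = g, w = g x and k = 0 the line condition reads 0 \<le> 0; all the
      content is that the generator of g is nowhere below its value at x0, hence nowhere below
      -c.\<close>
    have "g x \<le> (INF \<tau>\<in>admissible_times M B. cost (X x) c g \<tau>)"
    proof (rule O.value_ge[OF \<sigma>c nz g01 C2_on_derivs(1)[OF C2] C2_on_derivs(2)[OF C2], where k=0])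
      fix y :: real assume y: "y \<in> {0<..<1}"
      have "0 \<le> 2 / (\<sigma> y)\<^sup>2 * (generator \<sigma> g y + c)"
        using generator_ge_min[OF \<sigma> cg sh y] ge by simp
      then show "- 2 * c / (\<sigma> y)\<^sup>2 \<le> deriv (deriv g) y"
        unfolding second_derivative_generator[OF \<sigma> y, symmetric] by simp
    qed simp_all
    then show ?thesis unfolding value_function_eq using O.value_le_g by simp
  qed (rule boundary)
  have part2: "(\<exists>!(p :: real \<times> real). double_tangent (\<lambda>y. g y - \<psi> y) (fst p) (snd p)) \<and>
        (\<forall>A0 B0. double_tangent (\<lambda>y. g y - \<psi> y) A0 B0 \<longrightarrow>
          (\<forall>x\<in>{0..1}. value_function M B X c g x =
            (if x \<in> {A0<..<B0} then V_hat g \<psi> A0 x else g x)))"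
    if neg: "generator \<sigma> g x0 < - c" and \<psi>: "psi_solution \<sigma> c \<psi>" for \<psi>
  proof -
    let ?H = "\<lambda>y. g y - \<psi> y" and ?H1 = "\<lambda>y. deriv g y - deriv \<psi> y"
    obtain a b where "convex_concave_convex ?H ?H1 a b"
      using convex_concave_convex_difference[OF \<sigma> cg g0 sh c \<psi> neg] by blast
    then interpret L: convex_concave_convex ?H ?H1 a b .
    have dH: "deriv ?H y = ?H1 y" if "y \<in> {0<..<1}" for y by (rule DERIV_imp_deriv[OF L.DH[OF that]])
    \<comment> \<open>\<open>deriv\<close> of the difference is known to split only inside (0, 1);
      unless 0 < A0 < B0 < 1, both sides are false.\<close>
    have dt: "double_tangent ?H A0 B0 \<longleftrightarrow> L.bitangent A0 B0" for A0 B0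
    proof (cases "0 < A0 \<and> A0 < B0 \<and> B0 < 1")
      case True
      then have "deriv ?H A0 = ?H1 A0" "deriv ?H B0 = ?H1 B0" by (auto intro!: dH)
      then show ?thesis unfolding double_tangent_def L.bitangent_def by simp
    qed (auto simp: double_tangent_def L.bitangent_def)
    have "\<exists>!(p :: real \<times> real). double_tangent ?H (fst p) (snd p)"
    proof -
      obtain A0 B0 where AB: "L.bitangent A0 B0" using L.bitangent_exists by blast
      show ?thesis unfolding dt
      proof (rule ex1I[of _ "(A0, B0)"])
        show "L.bitangent (fst (A0, B0)) (snd (A0, B0))" using AB by simp
        show "p = (A0, B0)" if "L.bitangent (fst p) (snd p)" for p
          using L.bitangent_unique[OF that AB] by (simp add: prod_eq_iff)
      qed
    qed
    moreover have "value_function M B X c g x = (if x \<in> {A0<..<B0} then V_hat g \<psi> A0 x else g x)"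
      if "double_tangent ?H A0 B0" and x: "x \<in> {0..1}" for A0 B0 x
    proof -
      have bt: "L.bitangent A0 B0" using that(1) by (simp only: dt)
      then have AB: "0 < A0" "A0 < B0" "B0 < 1" "?H1 A0 = ?H1 B0" "?H1 B0 = (?H B0 - ?H A0) / (B0 - A0)"
        by (auto simp: L.bitangent_def)
      show ?thesis
      proof (cases "x \<in> {0, 1}")
        case True
        then show ?thesis using boundary[OF True] AB(1-3) by auto
      next
        case False
        then have x': "x \<in> {0<..<1}" using x by auto
        obtain Y where "optimal_stopping M B \<sigma> g x (X x) Y c" using OS[OF x'] by blast
        then interpret O: optimal_stopping M B \<sigma> g x "X x" Y c .
        \<comment> \<open>With u = \<psi> the generator condition is an equality, so every line
          below g - \<psi> bounds the value at x by its height there plus \<psi> x.\<close>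
        note ge = O.value_ge[OF \<sigma>c nz g01 psi_solution_derivs(1)[OF \<psi>] psi_solution_derivs(2)[OF \<psi>] order_refl]
        show ?thesis
        proof (cases "x \<in> {A0<..<B0}")
          case False
          \<comment> \<open>Outside (A0, B0) the line is the tangent of g - \<psi> at x
            itself.\<close>
          have "g x \<le> (INF \<tau>\<in>admissible_times M B. cost (X x) c g \<tau>)"
          proof (rule ge[where k="?H1 x"])
            show "g x - \<psi> x + ?H1 x * (y - x) \<le> g y - \<psi> y" if "y \<in> {0<..<1}" for y
              using L.outer_support[OF bt _ _ False, of y] that x' by simp
          qed
          then show ?thesis
            unfolding value_function_eq if_not_P[OF False] by (rule antisym[OF O.value_le_g])
        next
          case True
          \<comment> \<open>With the slope at A0 and this w, the line is the bitangent.\<close>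
          have "V_hat g \<psi> A0 x \<le> (INF \<tau>\<in>admissible_times M B. cost (X x) c g \<tau>)"
          proof (rule ge[where k="?H1 A0"])
            show "V_hat g \<psi> A0 x - \<psi> x + ?H1 A0 * (y - x) \<le> g y - \<psi> y" if "y \<in> {0<..<1}" for y
              using L.bitangent_support[OF bt, of y] that by (simp add: V_hat_def algebra_simps)
          qed
          \<comment> \<open>\<open>V_hat\<close> is the bitangent plus \<psi>, so its generator is
            -c, and the two contact points are where it agrees with g: the endpoints at which
            stopping takes place.\<close>
          moreover have "(INF \<tau>\<in>admissible_times M B. cost (X x) c g \<tau>) \<le> V_hat g \<psi> A0 x"
          proof (rule O.value_le[OF \<sigma>c nz])
            show "(V_hat g \<psi> A0 has_real_derivative ?H1 A0 + deriv \<psi> y) (at y)" if "y \<in> {0<..<1}" for y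
              unfolding V_hat_def[abs_def]
              using psi_solution_derivs(1)[OF \<psi> that] by (auto intro!: derivative_eq_intros)
            show "((\<lambda>y. ?H1 A0 + deriv \<psi> y) has_real_derivative - 2 * c / (\<sigma> y)\<^sup>2) (at y)" if "y \<in> {0<..<1}" for y
              using DERIV_add[OF DERIV_const psi_solution_derivs(2)[OF \<psi> that]] by simp
            show "V_hat g \<psi> A0 A0 = g A0" by (simp add: V_hat_def)
            have "?H B0 = ?H A0 + ?H1 A0 * (B0 - A0)" using AB(2) unfolding AB(4,5) by simp
            then show "V_hat g \<psi> A0 B0 = g B0" by (simp add: V_hat_def algebra_simps)
          qed (use True AB(1-3) in auto)
          ultimately show ?thesis unfolding value_function_eq using True by simp
        qed
      qed
    qed
    ultimately show ?thesis by blast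
  qed
  show ?thesis using part1 part2 by blast
qed

end
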